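(* Let $\beta>0$ and $[q_1,q_2]\subset(0,\infty)$. Then, for $N\in\mathbb N$ and $q\in[q_1,q_2]$ such that $qN^2\in\mathbb N$, $$\mathbf P_\beta\big(\mathcal V_{N,qN^2}\big)=\frac{C_{\beta,q}}{N^2}\,e^{-N\tilde\psi(q)}\,(1+o(1)),$$ where $o(1)\to0$ as $N\to\infty$ uniformly in $q\in[q_1,q_2]$ with $qN^2\in\mathbb N$, and $$\mathcal V_{n,k}:=\{X:\ X_n=0,\ A_n=k,\ X_i>0\text{ for }0<i<n\}.$$
   Context: For $\beta>0$, $\mathbf P_\beta$ is the law on $\mathbb Z$ with $\mathbf P_\beta(k)=e^{-\frac\beta2|k|}/c_\beta$, $c_\beta=\frac{1+e^{-\beta/2}}{1-e^{-\beta/2}}$; we also write $\mathbf P_\beta$ for the law of the random walk $X=(X_i)_{i\ge0}$ with $X_0=0$ and i.i.d. increments of law $\mathbf P_\beta$. $A_n=A_n(X)=X_1+\dots+X_n$. If $Z$ has law $\mathbf P_\beta$, let $\mathcal L(h)=\log\mathbf E_\beta[e^{hZ}]$ for $|h|<\beta/2$. Let $\tilde{\mathbf P}_h$ be the law on $\mathbb Z$ with $\tilde{\mathbf P}_h(k)=e^{hk-\mathcal L(h)}\mathbf P_\beta(k)$. For $h\in(0,\beta/2)$, $\kappa(h)=\tilde{\mathbf P}_h(X_i>0\ \forall i\in\mathbb N)$ for the walk started at $0$ with i.i.d. increments of law $\tilde{\mathbf P}_h$; one has $\kappa(h)=\frac{e^{2h}-1}{e^{h+\beta/2}-1}$. For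 $h\in(-\beta,\beta)$ let $\mathcal G(h)=\int_0^1\mathcal L(h(\tfrac12-x))\,dx$. The derivative $\mathcal G'$ is an increasing $C^1$ diffeomorphism from $(-\beta,\beta)$ onto $\mathbb R$ with $\mathcal G'(0)=0$; $q\mapsto\tilde h^q$ denotes its inverse. For $q>0$ let $\tilde\psi(q)=q\,\tilde h^q-\mathcal G(\tilde h^q)$, and $$C_{\beta,q}=\frac{1}{2\pi\,\vartheta(\tilde h^q)^{1/2}}\,\kappa\big(\tfrac{\tilde h^q}{2}\big)^2,$$ where for $h\in(-\beta,\beta)$ $$\vartheta(h)=\int_0^1x^2\mathcal L''[h(x-\tfrac12)]dx\int_0^1\mathcal L''[h(x-\tfrac12)]dx-\Big[\int_0^1x\,\mathcal L''[h(x-\tfrac12)]dx\Big]^2.$$ *)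

theory Defs
  imports "HOL-Probability.Probability"
begin

section \<open>The increment law and its tilted versions\<close>

definition c_const :: "real \<Rightarrow> real" where
  "c_const \<beta> = (1 + exp (- \<beta> / 2)) / (1 - exp (- \<beta> / 2))"

definition P_step :: "real \<Rightarrow> int pmf" where
  "P_step \<beta> = embed_pmf (\<lambda>k. exp (- (\<beta> / 2) * \<bar>of_int k\<bar>) / c_const \<beta>)"

definition log_mgf :: "real \<Rightarrow> real \<Rightarrow> real" where
  "log_mgf \<beta> h = ln (measure_pmf.expectation (P_step \<beta>) (\<lambda>z. exp (h * of_int z)))"

definition tilted_step :: "real \<Rightarrow> real \<Rightarrow> int pmf" where
  "tilted_step \<beta> h = embed_pmf (\<lambda>k. exp (h * of_int k - log_mgf \<beta> h) * pmf (P_step \<beta>) k)"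

text \<open>
  The argument of \<^const>\<open>embed_pmf\<close> is a probability mass function in the relevant parameter
  ranges; see \<open>pmf_P_step\<close> and \<open>pmf_tilted_step\<close>.
\<close>

lemma nn_integral_two_sided_geometric:
  fixes \<beta> h :: real
  assumes "\<bar>h\<bar> < \<beta> / 2"
  defines "S \<equiv> 1 / (1 - exp (h - \<beta> / 2)) + exp (- h - \<beta> / 2) / (1 - exp (- h - \<beta> / 2))"
  shows "(\<integral>\<^sup>+k. ennreal (exp (h * of_int k - (\<beta> / 2) * \<bar>of_int k\<bar>)) \<partial>count_space (UNIV :: int set)) = ennreal S"
proof -
  define f :: "int \<Rightarrow> real" where "f k = exp (h * of_int k - (\<beta> / 2) * \<bar>of_int k\<bar>)" for k
  define a where "a = exp (h - \<beta> / 2)"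
  define b where "b = exp (- h - \<beta> / 2)"
  have a: "0 < a" "a < 1" and b: "0 < b" "b < 1"
    using assms(1) by (auto simp: a_def b_def)
  have bij1: "bij_betw int UNIV {0..}"
    by (rule bij_betwI[where g = nat]) auto
  have bij2: "bij_betw (\<lambda>n. - int (Suc n)) UNIV {..<0}"
    by (rule bij_betwI[where g = "\<lambda>k. nat (- k - 1)"]) auto
  have f1: "f (int n) = a ^ n" for n
    by (simp add: f_def a_def flip: exp_of_nat_mult) (simp add: algebra_simps)
  have f2: "f (- int (Suc n)) = b * b ^ n" for n
  proof -
    have "f (- int (Suc n)) = exp (of_nat (Suc n) * (- h - \<beta> / 2))"
      unfolding f_def by (rule arg_cong[where f = exp]) (simp add: field_simps)
    then show ?thesis
      by (simp only: exp_of_nat_mult b_def power_Suc)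
  qed
  have "(\<integral>\<^sup>+k. ennreal (f k) \<partial>count_space {0..}) = (\<integral>\<^sup>+n. ennreal (f (int n)) \<partial>count_space UNIV)"
    by (rule nn_integral_bij_count_space[OF bij1, symmetric])
  also have "\<dots> = ennreal (1 / (1 - a))"
    unfolding nn_integral_count_space_nat f1
    by (rule suminf_ennreal_eq) (use a in \<open>auto intro!: geometric_sums\<close>)
  finally have 1: "(\<integral>\<^sup>+k. ennreal (f k) \<partial>count_space {0..}) = ennreal (1 / (1 - a))" .
  have "(\<integral>\<^sup>+k. ennreal (f k) \<partial>count_space {..<0})
      = (\<integral>\<^sup>+n. ennreal (f (- int (Suc n))) \<partial>count_space UNIV)"
    by (rule nn_integral_bij_count_space[OF bij2, symmetric])
  also have "\<dots> = ennreal (b * (1 / (1 - b)))"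
    unfolding nn_integral_count_space_nat f2
    by (rule suminf_ennreal_eq) (use b in \<open>auto intro!: sums_mult[OF geometric_sums] simp del: times_divide_eq_right mult_1_right\<close>)
  finally have 2: "(\<integral>\<^sup>+k. ennreal (f k) \<partial>count_space {..<0}) = ennreal (b / (1 - b))"
    by simp
  have "(\<integral>\<^sup>+k. ennreal (f k) \<partial>count_space UNIV)
      = (\<integral>\<^sup>+k\<in>{0..} \<union> {..<0}. ennreal (f k) \<partial>count_space UNIV)"
    by (intro nn_integral_cong) (auto simp: indicator_def)
  also have "\<dots> = (\<integral>\<^sup>+k\<in>{0..}. ennreal (f k) \<partial>count_space UNIV)
      + (\<integral>\<^sup>+k\<in>{..<0}. ennreal (f k) \<partial>count_space UNIV)"
    by (rule nn_integral_disjoint_pair_countspace) auto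
  also have "\<dots> = ennreal (1 / (1 - a)) + ennreal (b / (1 - b))"
    by (simp add: 1[symmetric] 2[symmetric] nn_integral_count_space_indicator)
  also have "\<dots> = ennreal S"
    using a b by (simp add: S_def a_def b_def)
  finally show ?thesis
    by (simp add: f_def)
qed

lemma c_const_pos: "\<beta> > 0 \<Longrightarrow> c_const \<beta> > 0"
  by (simp add: c_const_def divide_pos_pos add_pos_pos)

lemma pmf_P_step:
  assumes "\<beta> > 0"
  shows "pmf (P_step \<beta>) k = exp (- (\<beta> / 2) * \<bar>of_int k\<bar>) / c_const \<beta>"
proof -
  have "(\<integral>\<^sup>+k. ennreal (exp (- (\<beta> / 2) * \<bar>of_int k\<bar>) / c_const \<beta>) \<partial>count_space (UNIV :: int set))
      = (\<integral>\<^sup>+k. ennreal (exp (0 * of_int k - (\<beta> / 2) * \<bar>of_int k\<bar>)) * ennreal (1 / c_const \<beta>)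
          \<partial>count_space (UNIV :: int set))"
    using c_const_pos[OF assms]
    by (intro nn_integral_cong) (simp flip: ennreal_mult)
  also have "\<dots> = ennreal (1 / (1 - exp (0 - \<beta> / 2)) + exp (- 0 - \<beta> / 2) / (1 - exp (- 0 - \<beta> / 2)))
      * ennreal (1 / c_const \<beta>)"
    using assms
    by (subst nn_integral_multc, simp, subst nn_integral_two_sided_geometric) auto
  also have "\<dots> = ennreal (c_const \<beta>) * ennreal (1 / c_const \<beta>)"
    by (simp add: c_const_def add_divide_distrib)
  also have "\<dots> = 1"
    using c_const_pos[OF assms] by (simp flip: ennreal_mult)
  finally show ?thesis
    using c_const_pos[OF assms] unfolding P_step_def by (subst pmf_embed_pmf) auto
qed

lemma pmf_tilted_step:
  assumes "\<beta> > 0" "\<bar>h\<bar> < \<beta> / 2"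
  shows "pmf (tilted_step \<beta> h) k = exp (h * of_int k - log_mgf \<beta> h) * pmf (P_step \<beta>) k"
proof -
  define S where
    "S = 1 / (1 - exp (h - \<beta> / 2)) + exp (- h - \<beta> / 2) / (1 - exp (- h - \<beta> / 2))"
  have Spos: "S > 0"
    using assms by (auto simp: S_def intro!: add_pos_pos divide_pos_pos)
  note c = c_const_pos[OF assms(1)]
  have nn: "(\<integral>\<^sup>+k. ennreal (pmf (P_step \<beta>) k) * ennreal (exp (h * of_int k)) \<partial>count_space UNIV)
      = ennreal (S / c_const \<beta>)"
  proof -
    have "(\<integral>\<^sup>+k. ennreal (pmf (P_step \<beta>) k) * ennreal (exp (h * of_int k)) \<partial>count_space UNIV)
      = (\<integral>\<^sup>+k. ennreal (exp (h * of_int k - (\<beta> / 2) * \<bar>of_int k\<bar>)) * ennreal (1 / c_const \<beta>)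
          \<partial>count_space (UNIV :: int set))"
      using c by (intro nn_integral_cong)
        (simp add: pmf_P_step[OF assms(1)] flip: ennreal_mult exp_add)
    also have "\<dots> = ennreal S * ennreal (1 / c_const \<beta>)"
      unfolding S_def using assms
      by (subst nn_integral_multc, simp, subst nn_integral_two_sided_geometric) auto
    finally show ?thesis
      using c Spos by (simp flip: ennreal_mult)
  qed
  have "measure_pmf.expectation (P_step \<beta>) (\<lambda>z. exp (h * of_int z)) = S / c_const \<beta>"
    using c Spos
    by (subst integral_eq_nn_integral) (simp_all add: nn_integral_measure_pmf nn)
  then have expL: "exp (log_mgf \<beta> h) = S / c_const \<beta>"
    using c Spos by (simp add: log_mgf_def)
  have "(\<integral>\<^sup>+k. ennreal (exp (h * of_int k - log_mgf \<beta> h) * pmf (P_step \<beta>) k) \<partial>count_space UNIV)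
    = (\<integral>\<^sup>+k. ennreal (pmf (P_step \<beta>) k) * ennreal (exp (h * of_int k)) * ennreal (c_const \<beta> / S)
        \<partial>count_space UNIV)"
    using c Spos by (intro nn_integral_cong)
      (simp add: exp_diff expL field_simps flip: ennreal_mult)
  also have "\<dots> = ennreal (S / c_const \<beta>) * ennreal (c_const \<beta> / S)"
    by (subst nn_integral_multc) (simp_all add: nn)
  also have "\<dots> = 1"
    using c Spos by (simp flip: ennreal_mult)
  finally show ?thesis
    unfolding tilted_step_def by (subst pmf_embed_pmf) auto
qed


section \<open>The random walk\<close>

definition walk :: "(nat \<Rightarrow> int) \<Rightarrow> nat \<Rightarrow> int" where
  "walk \<xi> n = (\<Sum>i<n. \<xi> i)"

definition walk_law :: "int pmf \<Rightarrow> (nat \<Rightarrow> int) measure" where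
  "walk_law p = distr (\<Pi>\<^sub>M i\<in>(UNIV :: nat set). measure_pmf p) (\<Pi>\<^sub>M i\<in>UNIV. count_space UNIV) walk"

definition area :: "nat \<Rightarrow> (nat \<Rightarrow> int) \<Rightarrow> int" where
  "area n X = (\<Sum>i=1..n. X i)"

definition excursions :: "nat \<Rightarrow> nat \<Rightarrow> (nat \<Rightarrow> int) set" where
  "excursions n k = {X. X n = 0 \<and> area n X = int k \<and> (\<forall>i. 0 < i \<and> i < n \<longrightarrow> X i > 0)}"

definition kappa :: "real \<Rightarrow> real \<Rightarrow> real" where
  "kappa \<beta> h = measure (walk_law (tilted_step \<beta> h)) {X. \<forall>i\<ge>1. X i > 0}"

text \<open>
  Outside their domain of measurability \<^const>\<open>distr\<close> and \<^const>\<open>measure\<close> return default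
  values, so we record that the walk and the two events above are measurable.
\<close>

lemma measurable_sum_int:
  fixes f :: "'i \<Rightarrow> 'a \<Rightarrow> int"
  assumes "\<And>i. i \<in> A \<Longrightarrow> f i \<in> measurable M (count_space UNIV)"
  shows "(\<lambda>x. \<Sum>i\<in>A. f i x) \<in> measurable M (count_space UNIV)"
  using assms
proof (induction A rule: infinite_finite_induct)
  case (insert a A)
  have "(\<lambda>x. f a x + (\<Sum>i\<in>A. f i x)) \<in> measurable M (count_space UNIV)"
    by (rule measurable_compose_countable[where f = "\<lambda>m x. m + (\<Sum>i\<in>A. f i x)" and g = "f a"])
      (use insert in \<open>auto intro: measurable_compose[where N = "count_space UNIV"]\<close>)
  with insert show ?case by simp
qed auto

lemma walk_measurable [measurable]:
  "walk \<in> measurable (\<Pi>\<^sub>M i\<in>(UNIV :: nat set). measure_pmf p) (\<Pi>\<^sub>M i\<in>UNIV. count_space UNIV)"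
proof (rule measurable_PiM_single')
  fix n :: nat
  have [measurable]: "(\<lambda>\<xi>. \<xi> i) \<in> measurable (\<Pi>\<^sub>M i\<in>(UNIV :: nat set). measure_pmf p) (count_space UNIV)"
    for i
    using measurable_component_singleton[of i UNIV "\<lambda>_. measure_pmf p"]
    by (simp cong: measurable_cong_sets)
  show "(\<lambda>\<xi>. walk \<xi> n) \<in> measurable (\<Pi>\<^sub>M i\<in>(UNIV :: nat set). measure_pmf p) (count_space UNIV)"
    unfolding walk_def by (rule measurable_sum_int) measurable
qed auto

lemma prob_space_walk_law: "prob_space (walk_law p)"
proof -
  interpret prob_space "\<Pi>\<^sub>M i\<in>(UNIV :: nat set). measure_pmf p"
    by (intro prob_space_PiM measure_pmf.prob_space_axioms)
  show ?thesis
    unfolding walk_law_def by (rule prob_space_distr) measurable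
qed

lemma excursions_measurable: "excursions n k \<in> sets (walk_law p)"
proof -
  have [measurable]: "area n \<in> measurable (\<Pi>\<^sub>M i\<in>(UNIV :: nat set). count_space (UNIV :: int set)) (count_space UNIV)"
    unfolding area_def by (rule measurable_sum_int) measurable
  have "{X \<in> space (\<Pi>\<^sub>M i\<in>(UNIV :: nat set). count_space (UNIV :: int set)).
      X n = 0 \<and> area n X = int k \<and> (\<forall>i. 0 < i \<and> i < n \<longrightarrow> X i > 0)}
      \<in> sets (\<Pi>\<^sub>M i\<in>UNIV. count_space UNIV)"
    by measurable
  then show ?thesis
    by (simp add: excursions_def walk_law_def space_PiM)
qed

lemma positive_walks_measurable: "{X. \<forall>i\<ge>1. X i > 0} \<in> sets (walk_law p)"
proof -
  have "{X \<in> space (\<Pi>\<^sub>M i\<in>(UNIV :: nat set). count_space (UNIV :: int set)). \<forall>i\<ge>1. X i > 0}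
      \<in> sets (\<Pi>\<^sub>M i\<in>UNIV. count_space UNIV)"
    by measurable
  then show ?thesis
    by (simp add: walk_law_def space_PiM)
qed


section \<open>The rate function and the constant\<close>

definition G_fun :: "real \<Rightarrow> real \<Rightarrow> real" where
  "G_fun \<beta> h = integral {0..1} (\<lambda>x. log_mgf \<beta> (h * (1 / 2 - x)))"

definition h_tilde :: "real \<Rightarrow> real \<Rightarrow> real" where
  "h_tilde \<beta> q = the_inv_into {- \<beta><..<\<beta>} (deriv (G_fun \<beta>)) q"

definition psi_tilde :: "real \<Rightarrow> real \<Rightarrow> real" where
  "psi_tilde \<beta> q = q * h_tilde \<beta> q - G_fun \<beta> (h_tilde \<beta> q)"

definition theta :: "real \<Rightarrow> real \<Rightarrow> real" where
  "theta \<beta> h =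
     integral {0..1} (\<lambda>x. x\<^sup>2 * deriv (deriv (log_mgf \<beta>)) (h * (x - 1 / 2)))
       * integral {0..1} (\<lambda>x. deriv (deriv (log_mgf \<beta>)) (h * (x - 1 / 2)))
     - (integral {0..1} (\<lambda>x. x * deriv (deriv (log_mgf \<beta>)) (h * (x - 1 / 2))))\<^sup>2"

definition C_const :: "real \<Rightarrow> real \<Rightarrow> real" where
  "C_const \<beta> q = 1 / (2 * pi * sqrt (theta \<beta> (h_tilde \<beta> q))) * (kappa \<beta> (h_tilde \<beta> q / 2))\<^sup>2"

end

theory Submission
  imports Defs
begin

text \<open>
  The proof is an exponential change of measure followed by a two-dimensional local limit theorem.
  In terms of the increments \<open>\<xi>\<^sub>0, \<dots>, \<xi>\<^bsub>N-1\<^esub>\<close> the endpoint of the walk is the sum of the \<open>\<xi>\<^sub>i\<close>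
  and its area is the sum of the \<open>(N - i) \<xi>\<^sub>i\<close>.  Give the increment \<open>\<xi>\<^sub>i\<close> the law tilted by
  \<open>t\<^sub>i = h (1/2 - (i + 1/2)/N)\<close>.  On walks that end at \<open>0\<close> with area \<open>k\<close> the sum of the \<open>t\<^sub>i \<xi>\<^sub>i\<close> is the
  constant \<open>h k / N\<close>, so the tilt changes the probability of an excursion by an explicit factor
  (\<open>prob_excursions_eq\<close>).  The \<open>t\<^sub>i\<close> are the nodes of the midpoint rule, whose error is
  quadratic; hence the sum of the \<open>L(t\<^sub>i)\<close>, with \<open>L\<close> the logarithmic moment generating function,
  is \<open>N G(h) + O(1/N)\<close> (\<open>G_fun_midpoint\<close>).  For \<open>h\<close> the
  solution of \<open>G'(h) = q\<close> the factor is therefore \<open>exp (- N \<psi>(q)) (1 + o(1))\<close>, and the area has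
  mean \<open>q N\<^sup>2 + O(N)\<close> under the tilted law, which is centred on the scale \<open>N\<^bsup>3/2\<^esup>\<close> of its fluctuations.

  It remains to find the limit of \<open>N\<^sup>2\<close> times the tilted probability of an excursion, which has three
  ingredients.

  First, without positivity: the characteristic function of the pair (endpoint, area) is a product of
  explicit factors.  It is dominated by an integrable product function after rescaling
  (\<open>block_chf_bound\<close>), which gives the bound \<open>C / n\<^sup>2\<close> for point probabilities of any
  block of \<open>n\<close> increments (\<open>hit_le\<close>) and, by dominated convergence, the Gaussian limit
  (\<open>hit_local_limit\<close>).

  Second, positivity is free in the bulk: the tilts are positive in the first half, so there the walk
  drifts upwards and is nonpositive at time \<open>m\<close> with exponentially small probability, while the other
  half of the increments pays the factor \<open>C / N\<^sup>2\<close> for returning to a prescribed point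
  (\<open>prob_bridge_return_le\<close>).  Up to \<open>C r\<^sup>M / N\<^sup>2\<close> with \<open>r < 1\<close> only the first and last \<open>M\<close> steps
  have to be watched (\<open>edge_prob_approx\<close>).

  Third, for fixed \<open>M\<close> the first \<open>M\<close> steps, and the last \<open>M\<close> steps read backwards, converge to two
  independent walks with constant tilt \<open>h/2\<close>, and the local limit theorem applies to the increments in
  between (\<open>edge_prob_limit\<close>).  Letting \<open>M\<close> tend to infinity turns the two positivity
  probabilities into \<open>\<kappa>(h/2)\<^sup>2\<close> (\<open>excursion_prob_limit\<close>).

  All limits are taken along sequences of parameters, with \<open>N \<rightarrow> \<infinity>\<close> and \<open>h\<close> convergent inside \<open>(0, \<beta>)\<close>.
  Uniformity over \<open>q\<close> then follows by contradiction from compactness, because \<open>h\<close> is an increasing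
  function of \<open>q\<close> (\<open>excursion_ratio_uniform\<close>).  The constant is positive and continuous along such
  sequences, which makes the quotient meaningful (\<open>kappa_pos\<close>, \<open>kappa_tendsto\<close>, \<open>theta_pos\<close>).
\<close>

section \<open>Cumulants and characteristic functions of the tilted step law\<close>

locale laplace_walk =
  fixes \<beta> :: real
  assumes beta_pos: "0 < \<beta>"
begin

text \<open>
  The weight of a step \<open>k\<close> under an exponential tilt \<open>z\<close> is, up to normalisation, \<open>geo z ^ k\<close> for
  \<open>k \<ge> 0\<close> and \<open>geo (- z) ^ (- k)\<close> for \<open>k \<le> 0\<close>.  The functions built from this ratio are
  polymorphic, so that the same formulas serve real tilts and their complex perturbations.
\<close>

definition geo :: "'a::{real_normed_field,banach} \<Rightarrow> 'a" where
  "geo z = exp (z - of_real (\<beta> / 2))"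

definition mgf :: "'a::{real_normed_field,banach} \<Rightarrow> 'a" where
  "mgf z = of_real ((1 - exp (- \<beta> / 2))\<^sup>2) / ((1 - geo z) * (1 - geo (- z)))"

text \<open>
  The functions \<open>cum1\<close>, \<open>cum2\<close>, \<open>cum3\<close> are the first three derivatives of the logarithm of \<open>mgf\<close>.
\<close>

definition cum1 :: "'a::{real_normed_field,banach} \<Rightarrow> 'a" where
  "cum1 z = geo z / (1 - geo z) - geo (- z) / (1 - geo (- z))"

definition cum2 :: "'a::{real_normed_field,banach} \<Rightarrow> 'a" where
  "cum2 z = geo z / (1 - geo z)\<^sup>2 + geo (- z) / (1 - geo (- z))\<^sup>2"

definition cum3 :: "'a::{real_normed_field,banach} \<Rightarrow> 'a" where
  "cum3 z = geo z * (1 + geo z) / (1 - geo z) ^ 3 - geo (- z) * (1 + geo (- z)) / (1 - geo (- z)) ^ 3"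

text \<open>
  Splitting the integers at \<open>0\<close> leaves two geometric series.
\<close>

lemma infsetsum_two_sided_geometric:
  fixes E F :: "'a::{real_normed_field,banach,second_countable_topology}"
  assumes "norm E < 1" "norm F < 1"
  defines "g \<equiv> (\<lambda>k::int. if k \<ge> 0 then E ^ nat k else F ^ nat (- k))"
  shows "Infinite_Set_Sum.abs_summable_on g UNIV" "infsetsum g UNIV = 1 / (1 - E) + F / (1 - F)"
proof -
  have bij1: "bij_betw int UNIV {0..}"
    by (rule bij_betwI[where g = nat]) auto
  have bij2: "bij_betw (\<lambda>n. - int (Suc n)) UNIV {..<0}"
    by (rule bij_betwI[where g = "\<lambda>k. nat (- k - 1)"]) auto
  have g1: "g (int n) = E ^ n" for n
    by (simp add: g_def)
  have g2: "g (- int (Suc n)) = F * F ^ n" for n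
  proof -
    have "\<not> 0 \<le> - int (Suc n)" by simp
    then show ?thesis
      unfolding g_def by (simp only: if_False minus_minus nat_int power_Suc)
  qed
  have s1: "Infinite_Set_Sum.abs_summable_on g {0..}"
    unfolding abs_summable_on_reindex_bij_betw[OF bij1, symmetric] g1 abs_summable_on_nat_iff'
    using assms by (simp add: norm_power summable_geometric)
  have s2: "Infinite_Set_Sum.abs_summable_on g {..<0}"
    unfolding abs_summable_on_reindex_bij_betw[OF bij2, symmetric] g2 abs_summable_on_nat_iff'
    using assms by (auto simp: norm_power norm_mult intro!: summable_mult summable_geometric)
  have U: "UNIV = {0::int..} \<union> {..<0}" by auto
  show "Infinite_Set_Sum.abs_summable_on g UNIV"
    unfolding U by (intro abs_summable_on_union s1 s2)
  have "infsetsum g UNIV = infsetsum g {0..} + infsetsum g {..<0}"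
    unfolding U by (rule infsetsum_Un_disjoint[OF s1 s2]) auto
  also have "infsetsum g {0..} = infsetsum (\<lambda>n. g (int n)) UNIV"
    by (rule infsetsum_reindex_bij_betw[OF bij1, symmetric])
  also have "\<dots> = 1 / (1 - E)"
    unfolding g1 using assms s1[unfolded abs_summable_on_reindex_bij_betw[OF bij1, symmetric] g1]
    by (subst infsetsum_nat') (auto simp: suminf_geometric)
  also have "infsetsum g {..<0} = infsetsum (\<lambda>n. g (- int (Suc n))) UNIV"
    by (rule infsetsum_reindex_bij_betw[OF bij2, symmetric])
  also have "\<dots> = F / (1 - F)"
    unfolding g2 using assms s2[unfolded abs_summable_on_reindex_bij_betw[OF bij2, symmetric] g2]
    by (subst infsetsum_nat') (auto simp: suminf_mult suminf_geometric summable_geometric)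
  finally show "infsetsum g UNIV = 1 / (1 - E) + F / (1 - F)" .
qed

lemma c_const_inverse: "1 / c_const \<beta> = (1 - exp (- \<beta> / 2)) / (1 + exp (- \<beta> / 2))"
  by (simp add: c_const_def)

lemma expectation_P_step:
  fixes z :: "'a::{real_normed_field,banach,second_countable_topology}"
  assumes "norm (geo z) < 1" "norm (geo (- z)) < 1"
  shows "integrable (P_step \<beta>) (\<lambda>k. exp (z * of_int k))"
    and "measure_pmf.expectation (P_step \<beta>) (\<lambda>k. exp (z * of_int k)) = mgf z"
proof -
  define E where "E = exp (z - of_real (\<beta> / 2))"
  define F where "F = exp (- z - of_real (\<beta> / 2))"
  define g where "g = (\<lambda>k::int. if k \<ge> 0 then E ^ nat k else F ^ nat (- k))"
  have E1: "E \<noteq> 1" "F \<noteq> 1" using assms unfolding E_def F_def geo_def by auto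
  have g: "pmf (P_step \<beta>) k *\<^sub>R exp (z * of_int k) = (1 / c_const \<beta>) *\<^sub>R g k" for k
  proof -
    have "of_real (exp (- (\<beta> / 2) * \<bar>of_int k\<bar>)) * exp (z * of_int k) = g k"
    proof (cases "k \<ge> 0")
      case True
      then obtain n where k: "k = int n" using nonneg_int_cases by blast
      have "of_real (exp (- (\<beta> / 2) * \<bar>of_int k\<bar>)) * exp (z * of_int k)
         = exp (of_nat n * (z - of_real (\<beta> / 2)))"
        by (simp add: k exp_of_real[symmetric] exp_add[symmetric] algebra_simps)
      then show ?thesis using True by (simp only: exp_of_nat_mult E_def g_def k) simp
    next
      case False
      then have "k = - int (nat (- k))" by simp
      then obtain n where k: "k = - int n" by blast
      have "of_real (exp (- (\<beta> / 2) * \<bar>of_int k\<bar>)) * exp (z * of_int k)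
         = exp (of_nat n * (- z - of_real (\<beta> / 2)))"
        by (simp add: k exp_of_real[symmetric] exp_add[symmetric] algebra_simps)
      then show ?thesis using False by (simp only: exp_of_nat_mult F_def g_def k) simp
    qed
    then show ?thesis
      by (simp add: pmf_P_step[OF beta_pos] scaleR_conv_of_real field_simps)
  qed
  note geo = infsetsum_two_sided_geometric[of E F, folded g_def, folded E_def F_def,
      OF assms[unfolded geo_def, folded E_def F_def]]
  have int: "integrable (count_space UNIV) (\<lambda>k. (1 / c_const \<beta>) *\<^sub>R g k)"
    using geo(1) unfolding abs_summable_on_def by (intro integrable_scaleR_right) auto
  show "integrable (P_step \<beta>) (\<lambda>k. exp (z * of_int k))"
    unfolding measure_pmf_eq_density by (subst integrable_density) (use int in \<open>simp_all add: g\<close>)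
  have "measure_pmf.expectation (P_step \<beta>) (\<lambda>k. exp (z * of_int k))
      = infsetsum (\<lambda>k. (1 / c_const \<beta>) *\<^sub>R g k) UNIV"
    unfolding measure_pmf_eq_density infsetsum_def by (subst integral_density) (simp_all add: g)
  also have "\<dots> = (1 / c_const \<beta>) *\<^sub>R (1 / (1 - E) + F / (1 - F))"
    using geo by (simp add: infsetsum_scaleR_right del: scaleR_left.add)
  also have "1 / (1 - E) + F / (1 - F) = (1 - E * F) / ((1 - E) * (1 - F))"
    using E1 by (simp add: field_simps)
  also have "E * F = of_real (exp (- \<beta> / 2) * exp (- \<beta> / 2))"
    unfolding E_def F_def by (simp add: exp_of_real[symmetric] exp_add[symmetric])
  also have "(1 / c_const \<beta>) *\<^sub>R ((1 - of_real (exp (- \<beta> / 2) * exp (- \<beta> / 2))) / ((1 - E) * (1 - F)))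
      = of_real ((1 / c_const \<beta>) * (1 - exp (- \<beta> / 2) * exp (- \<beta> / 2))) / ((1 - E) * (1 - F))"
    by (simp add: scaleR_conv_of_real)
  also have "(1 / c_const \<beta>) * (1 - exp (- \<beta> / 2) * exp (- \<beta> / 2)) = (1 - exp (- \<beta> / 2))\<^sup>2"
  proof -
    have "1 + exp (- \<beta> / 2) \<noteq> 0" using exp_gt_zero[of "-\<beta>/2"] by linarith
    then show ?thesis unfolding c_const_inverse by (simp add: field_simps power2_eq_square)
  qed
  finally show "measure_pmf.expectation (P_step \<beta>) (\<lambda>k. exp (z * of_int k)) = mgf z"
    by (simp add: mgf_def E_def F_def geo_def)
qed


lemma geo_pos [simp]: "0 < geo (t::real)"
  by (simp add: geo_def)

lemma geo_less_1: "t < \<beta> / 2 \<Longrightarrow> geo (t::real) < 1"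
  by (simp add: geo_def)

lemma norm_geo_complex: "norm (geo (z::complex)) = geo (Re z)"
  by (simp add: geo_def)

lemma geo_of_real: "geo (of_real t) = of_real (geo t)"
  by (simp add: geo_def exp_of_real[symmetric])

lemma geo_minus_of_real: "geo (- of_real t) = of_real (geo (- t))"
  by (metis geo_of_real of_real_minus)

lemma mgf_of_real: "mgf (of_real t) = of_real (mgf t)"
  by (simp add: mgf_def geo_of_real geo_minus_of_real)

lemma mgf_pos:
  assumes "\<bar>t\<bar> < \<beta> / 2"
  shows "0 < mgf (t::real)"
  using assms geo_less_1[of t] geo_less_1[of "- t"] beta_pos unfolding mgf_def
  by (auto intro!: divide_pos_pos mult_pos_pos)

lemma exp_log_mgf:
  assumes "\<bar>t\<bar> < \<beta> / 2"
  shows "exp (log_mgf \<beta> t) = mgf t"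
proof -
  have "norm (geo t) < 1" "norm (geo (- t)) < 1"
    using assms geo_less_1[of t] geo_less_1[of "- t"] geo_pos[of t] geo_pos[of "- t"]
    by (auto simp del: geo_pos)
  from expectation_P_step(2)[OF this] mgf_pos[OF assms] show ?thesis
    by (simp add: log_mgf_def)
qed

lemma log_mgf_eq:
  assumes "\<bar>t\<bar> < \<beta> / 2"
  shows "log_mgf \<beta> t = ln ((1 - exp (- \<beta> / 2))\<^sup>2) - ln (1 - geo t) - ln (1 - geo (- t))"
proof -
  have g: "geo t < 1" "geo (- t) < 1"
    using assms geo_less_1[of t] geo_less_1[of "- t"] by auto
  have "log_mgf \<beta> t = ln (mgf t)"
    using exp_log_mgf[OF assms] by (metis ln_exp)
  then show ?thesis
    using g beta_pos by (simp add: mgf_def ln_div ln_mult)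
qed

lemma log_mgf_0: "log_mgf \<beta> 0 = 0"
  using exp_log_mgf[of 0] beta_pos by (simp add: mgf_def geo_def power2_eq_square)

lemma log_mgf_minus: "\<bar>t\<bar> < \<beta> / 2 \<Longrightarrow> log_mgf \<beta> (- t) = log_mgf \<beta> t"
  by (simp add: log_mgf_eq)

lemma cum1_minus: "cum1 (- z) = - cum1 z"
  by (simp add: cum1_def)

lemma cum1_0 [simp]: "cum1 0 = 0"
  by (simp add: cum1_def)

lemma cum2_minus: "cum2 (- z) = cum2 z"
  by (simp add: cum2_def)

lemma cum1_of_real: "cum1 (of_real t) = of_real (cum1 t)"
  by (simp add: cum1_def geo_of_real geo_minus_of_real)

lemma cum2_of_real: "cum2 (of_real t) = of_real (cum2 t)"
  by (simp add: cum2_def geo_of_real geo_minus_of_real)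

lemma DERIV_geo [derivative_intros]: "(f has_field_derivative f') (at x within s) \<Longrightarrow>
   ((\<lambda>x. geo (f x)) has_field_derivative geo (f x) * f') (at x within s)"
  unfolding geo_def by (auto intro!: derivative_eq_intros)

lemma DERIV_cum1:
  assumes "geo z \<noteq> 1" "geo (- z) \<noteq> 1"
  shows "(cum1 has_field_derivative cum2 z) (at z within s)"
proof -
  have "((\<lambda>z. geo z / (1 - geo z) - geo (- z) / (1 - geo (- z))) has_field_derivative cum2 z) (at z within s)"
    apply (rule derivative_eq_intros refl | use assms in force)+
    using assms by (simp add: cum2_def power2_eq_square algebra_simps)
  then show ?thesis unfolding cum1_def[abs_def] .
qed

lemma DERIV_cum2:
  assumes "geo z \<noteq> 1" "geo (- z) \<noteq> 1"
  shows "(cum2 has_field_derivative cum3 z) (at z within s)"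
proof -
  have *: "(w * (1 - w)\<^sup>2 + w * (2 * (1 - w) * w)) / ((1 - w)\<^sup>2 * (1 - w)\<^sup>2) = w * (1 + w) / (1 - w) ^ 3"
    if "w \<noteq> 1" for w :: 'a
  proof -
    define d where "d = 1 - w"
    have d: "d \<noteq> 0" "w = 1 - d" using that by (auto simp: d_def)
    have "(w * d\<^sup>2 + w * (2 * d * w)) / (d\<^sup>2 * d\<^sup>2) = (w * d + 2 * w * w) / d ^ 3"
      using d(1) by (simp add: field_simps power2_eq_square power3_eq_cube)
    also have "w * d + 2 * w * w = w * (1 + w)"
      by (simp add: d_def algebra_simps)
    finally show ?thesis by (simp add: d_def)
  qed
  have "((\<lambda>z. geo z / (1 - geo z)\<^sup>2 + geo (- z) / (1 - geo (- z))\<^sup>2) has_field_derivative cum3 z) (at z within s)"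
    apply (rule derivative_eq_intros refl | use assms in force)+
    using *[OF assms(1)] *[OF assms(2)] by (simp add: cum3_def algebra_simps diff_divide_distrib add_divide_distrib)
  then show ?thesis unfolding cum2_def[abs_def] .
qed

lemma DERIV_log_mgf:
  assumes "\<bar>t\<bar> < \<beta> / 2"
  shows "(log_mgf \<beta> has_field_derivative cum1 t) (at t)"
proof -
  have g: "geo t < 1" "geo (- t) < 1"
    using assms geo_less_1[of t] geo_less_1[of "- t"] by auto
  have "((\<lambda>t. ln ((1 - exp (- \<beta> / 2))\<^sup>2) - ln (1 - geo t) - ln (1 - geo (- t))) has_field_derivative cum1 t) (at t)"
    apply (rule derivative_eq_intros refl | use g in force)+
    by (simp add: cum1_def)
  moreover have "\<forall>\<^sub>F x in nhds t. log_mgf \<beta> x = ln ((1 - exp (- \<beta> / 2))\<^sup>2) - ln (1 - geo x) - ln (1 - geo (- x))"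
    by (rule eventually_nhds_in_open[of "{-\<beta>/2<..<\<beta>/2}", THEN eventually_mono])
      (use assms log_mgf_eq in \<open>auto simp: abs_less_iff\<close>)
  ultimately show ?thesis by (subst DERIV_cong_ev[OF refl _ refl])
qed

lemma deriv2_log_mgf:
  assumes "\<bar>t\<bar> < \<beta> / 2"
  shows "deriv (deriv (log_mgf \<beta>)) t = cum2 t"
proof -
  have g: "geo t < 1" "geo (- t) < 1"
    using assms geo_less_1[of t] geo_less_1[of "- t"] by auto
  have "\<forall>\<^sub>F x in nhds t. deriv (log_mgf \<beta>) x = cum1 x"
    by (rule eventually_nhds_in_open[of "{-\<beta>/2<..<\<beta>/2}", THEN eventually_mono])
      (use assms in \<open>auto simp: abs_less_iff intro!: DERIV_imp_deriv DERIV_log_mgf\<close>)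
  then have "deriv (deriv (log_mgf \<beta>)) t = deriv cum1 t"
    by (rule deriv_cong_ev) simp
  also have "\<dots> = cum2 t"
    using g by (intro DERIV_imp_deriv DERIV_cum1) auto
  finally show ?thesis .
qed

lemma cum2_ge:
  assumes "\<bar>t\<bar> < \<beta> / 2"
  shows "exp (- \<beta>) \<le> cum2 (t::real)"
proof -
  have g: "geo t < 1" "geo (- t) < 1"
    using assms geo_less_1[of t] geo_less_1[of "- t"] by auto
  have "exp (- \<beta>) \<le> geo t"
    using assms by (simp add: geo_def)
  also have "\<dots> \<le> geo t / (1 - geo t)\<^sup>2"
  proof -
    have "(1 - geo t)\<^sup>2 \<le> 1\<^sup>2"
      using g less_imp_le[OF geo_pos[of t]] by (intro power_mono) (auto simp del: geo_pos)
    then have "geo t * (1 - geo t)\<^sup>2 \<le> geo t * 1"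
      using less_imp_le[OF geo_pos[of t]] by (intro mult_left_mono) auto
    then show ?thesis using g less_imp_le[OF geo_pos[of t]] by (subst le_divide_eq) (auto simp del: geo_pos)
  qed
  also have "\<dots> \<le> cum2 t"
    using less_imp_le[OF geo_pos[of "- t"]] by (simp add: cum2_def del: geo_pos)
  finally show ?thesis .
qed

text \<open>
  Each of the three functions is a sum or difference of two terms of the form \<open>w v / (1 - w) ^ n\<close>
  with \<open>n \<le> 3\<close>, so a single bound covers all of them.
\<close>

lemma norm_cum_le:
  fixes z :: "'a::{real_normed_field,banach}"
  assumes "norm (geo z) \<le> \<rho>" "norm (geo (- z)) \<le> \<rho>" "\<rho> < 1"
  shows "norm (cum1 z) \<le> 4 / (1 - \<rho>) ^ 3" "norm (cum2 z) \<le> 4 / (1 - \<rho>) ^ 3"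
    "norm (cum3 z) \<le> 4 / (1 - \<rho>) ^ 3"
proof -
  have rho: "0 \<le> \<rho>" using assms(1) norm_ge_zero order_trans by blast
  have *: "norm (w * v / (1 - w) ^ n) \<le> 2 / (1 - \<rho>) ^ 3"
    if "norm w \<le> \<rho>" "norm v \<le> 2" "n \<le> 3" for w v :: 'a and n
  proof -
    have "1 - \<rho> \<le> norm (1 - w)"
      using that(1) norm_triangle_ineq2[of 1 w] by simp
    then have "(1 - \<rho>) ^ n \<le> norm ((1 - w) ^ n)"
      using assms(3) by (simp add: norm_power power_mono)
    moreover have "(1 - \<rho>) ^ 3 \<le> (1 - \<rho>) ^ n"
      using assms(3) rho that(3) by (intro power_decreasing) auto
    moreover have "norm w * norm v \<le> 1 * 2"
      using that assms(3) rho by (intro mult_mono) auto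
    ultimately show ?thesis
      using assms(3) by (auto simp: norm_divide norm_mult intro!: frac_le)
  qed
  have v: "norm (1 + w) \<le> 2" if "norm w \<le> \<rho>" for w :: 'a
    using norm_triangle_ineq[of 1 w] that assms(3) by simp
  note t = norm_triangle_le_diff norm_triangle_le
  show "norm (cum1 z) \<le> 4 / (1 - \<rho>) ^ 3"
    unfolding cum1_def using *[OF assms(1), of 1 1] *[OF assms(2), of 1 1] by (intro t) auto
  show "norm (cum2 z) \<le> 4 / (1 - \<rho>) ^ 3"
    unfolding cum2_def using *[OF assms(1), of 1 2] *[OF assms(2), of 1 2] by (intro t) auto
  show "norm (cum3 z) \<le> 4 / (1 - \<rho>) ^ 3"
    unfolding cum3_def using *[OF assms(1) v[OF assms(1)], of 3] *[OF assms(2) v[OF assms(2)], of 3]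
    by (intro t) auto
qed

text \<open>
  Tilts compose: an exponential moment of the law tilted by \<open>t\<close> is a quotient of exponential moments
  of the original law.
\<close>

lemma expectation_tilted_step:
  fixes z :: "'a::{real_normed_field,banach,second_countable_topology}"
  assumes "\<bar>t\<bar> < \<beta> / 2" "norm (geo (of_real t + z)) < 1" "norm (geo (- (of_real t + z))) < 1"
  shows "integrable (tilted_step \<beta> t) (\<lambda>k. exp (z * of_int k))"
    and "measure_pmf.expectation (tilted_step \<beta> t) (\<lambda>k. exp (z * of_int k))
       = mgf (of_real t + z) / of_real (mgf t)"
proof -
  have *: "pmf (tilted_step \<beta> t) k *\<^sub>R exp (z * of_int k)
     = (1 / mgf t) *\<^sub>R (pmf (P_step \<beta>) k *\<^sub>R exp ((of_real t + z) * of_int k))" for k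
  proof -
    have "pmf (tilted_step \<beta> t) k = (exp (t * of_int k) / mgf t) * pmf (P_step \<beta>) k"
      using exp_log_mgf[OF assms(1)] by (simp add: pmf_tilted_step[OF beta_pos assms(1)] exp_diff)
    then show ?thesis
      by (simp add: scaleR_conv_of_real exp_add distrib_right exp_of_real[symmetric] field_simps)
  qed
  have int: "integrable (count_space UNIV) (\<lambda>k. pmf (P_step \<beta>) k *\<^sub>R exp ((of_real t + z) * of_int k))"
    using expectation_P_step(1)[OF assms(2,3)] unfolding measure_pmf_eq_density
    by (subst (asm) integrable_density) simp_all
  show "integrable (tilted_step \<beta> t) (\<lambda>k. exp (z * of_int k))"
    unfolding measure_pmf_eq_density
    by (subst integrable_density) (use integrable_scaleR_right[OF int, of "1 / mgf t"] in \<open>simp_all only: * [symmetric], simp_all\<close>)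
  have "measure_pmf.expectation (tilted_step \<beta> t) (\<lambda>k. exp (z * of_int k))
     = (1 / mgf t) *\<^sub>R measure_pmf.expectation (P_step \<beta>) (\<lambda>k. exp ((of_real t + z) * of_int k))"
    unfolding measure_pmf_eq_density
    by (subst (1 2) integral_density) (simp_all only: * integral_scaleR_right, simp_all)
  then show "measure_pmf.expectation (tilted_step \<beta> t) (\<lambda>k. exp (z * of_int k))
       = mgf (of_real t + z) / of_real (mgf t)"
    using expectation_P_step(2)[OF assms(2,3)] by (simp add: scaleR_conv_of_real field_simps)
qed


definition chf :: "real \<Rightarrow> real \<Rightarrow> complex" where
  "chf t u = mgf (Complex t u) / of_real (mgf t)"

lemma
  assumes "\<bar>t\<bar> < \<beta> / 2"
  shows expectation_chf: "measure_pmf.expectation (tilted_step \<beta> t) (\<lambda>k. exp (\<i> * of_real u * of_int k)) = chf t u"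
    and norm_chf_le_1: "norm (chf t u) \<le> 1"
proof -
  have "norm (geo (of_real t + \<i> * of_real u)) < 1" "norm (geo (- (of_real t + \<i> * of_real u))) < 1"
    using assms geo_less_1[of t] geo_less_1[of "- t"] by (auto simp: norm_geo_complex)
  from expectation_tilted_step(2)[OF assms this]
  show *: "measure_pmf.expectation (tilted_step \<beta> t) (\<lambda>k. exp (\<i> * of_real u * of_int k)) = chf t u"
    by (simp add: chf_def Complex_eq)
  have "norm (measure_pmf.expectation (tilted_step \<beta> t) (\<lambda>k. exp (\<i> * of_real u * of_int k)))
     \<le> measure_pmf.expectation (tilted_step \<beta> t) (\<lambda>k. norm (exp (\<i> * of_real u * of_int k)))"
    by (rule integral_norm_bound)
  then show "norm (chf t u) \<le> 1"
    unfolding * by (simp add: norm_exp_eq_Re)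
qed

text \<open>
  This is the law of cosines for \<open>1\<close> and \<open>a e\<^sup>i\<^sup>u\<close> with \<open>a = geo t\<close>, written so that the distance
  to the value at \<open>u = 0\<close> is visible.
\<close>

lemma norm_one_minus_geo:
  "(norm (1 - geo (Complex t u)))\<^sup>2 = (1 - geo t)\<^sup>2 + 2 * geo t * (1 - cos u)"
proof -
  have "geo (Complex t u) = of_real (geo t) * cis u"
    by (simp add: geo_def cis_conv_exp exp_of_real[symmetric] exp_add[symmetric] Complex_eq algebra_simps)
  then have "(norm (1 - geo (Complex t u)))\<^sup>2 = (1 - geo t * cos u)\<^sup>2 + (geo t * sin u)\<^sup>2"
    by (simp add: cmod_power2)
  also have "(geo t * sin u)\<^sup>2 = (geo t)\<^sup>2 * (1 - (cos u)\<^sup>2)"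
    by (simp add: power_mult_distrib sin_squared_eq)
  finally show ?thesis by (simp add: power2_eq_square algebra_simps)
qed

text \<open>
  By the previous lemma the squared modulus is a product of two factors
  \<open>1 / (1 + 2 a (1 - cos u) / (1 - a)\<^sup>2)\<close>, and both ratios \<open>a\<close> are at least \<open>exp (- \<beta>)\<close>.  The rate
  therefore does not depend on the tilt.
\<close>

lemma norm_chf_le:
  assumes "\<bar>t\<bar> < \<beta> / 2"
  shows "norm (chf t u) \<le> exp (- (2 * exp (- \<beta>) / 5) * (1 - cos u))"
proof -
  define a0 where "a0 = exp (- \<beta>)"
  define x where "x = 2 * a0 * (1 - cos u)"
  have a0: "0 < a0" "a0 \<le> 1" using beta_pos by (auto simp: a0_def)
  have x: "0 \<le> x" "x \<le> 4"
  proof -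
    show "0 \<le> x" using a0 by (simp add: x_def)
    have "x \<le> 2 * a0 * 2" unfolding x_def using a0 cos_ge_minus_one[of u] by (intro mult_left_mono) linarith+
    then show "x \<le> 4" using a0 by linarith
  qed
  have g: "geo t < 1" "geo (- t) < 1"
    using assms geo_less_1[of t] geo_less_1[of "- t"] by auto
  have ge: "a0 \<le> geo t" "a0 \<le> geo (- t)"
    using assms by (auto simp: geo_def a0_def)
  have key: "(1 - geo s)\<^sup>2 / (norm (1 - geo (Complex s v)))\<^sup>2 \<le> 1 / (1 + x)"
    if "a0 \<le> geo s" "geo s < 1" "cos v = cos u" for s v
  proof -
    have "(1 - geo s)\<^sup>2 \<le> 1\<^sup>2"
      using that a0 by (intro power_mono) auto
    then have "(1 - geo s)\<^sup>2 * x \<le> 1 * x"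
      using x by (intro mult_right_mono) auto
    also have "\<dots> \<le> 2 * geo s * (1 - cos v)"
      unfolding x_def that(3) using that(1) by (simp add: mult_right_mono)
    finally have *: "(1 - geo s)\<^sup>2 * (1 + x) \<le> (norm (1 - geo (Complex s v)))\<^sup>2"
      unfolding norm_one_minus_geo by (simp add: algebra_simps)
    have "0 < (1 - geo s)\<^sup>2 * (1 + x)" using that x by simp
    with * show ?thesis using x by (simp add: divide_simps)
  qed
  have "(norm (chf t u))\<^sup>2 = ((1 - geo t)\<^sup>2 / (norm (1 - geo (Complex t u)))\<^sup>2)
       * ((1 - geo (- t))\<^sup>2 / (norm (1 - geo (Complex (- t) (- u))))\<^sup>2)"
  proof -
    have nr: "cmod (1 - complex_of_real a) = 1 - a" if "a < 1" for a
      using that norm_of_real[of "1 - a", where 'a = complex] by simp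
    have "norm (chf t u) = ((1 - geo t) / norm (1 - geo (Complex t u))) * ((1 - geo (- t)) / norm (1 - geo (Complex (- t) (- u))))"
      using beta_pos g by (simp add: chf_def mgf_def norm_divide norm_mult norm_power complex_minus abs_mult nr[OF g(1)] nr[OF g(2)])
    then show ?thesis by (simp add: power_mult_distrib power_divide)
  qed
  also have "\<dots> \<le> (1 / (1 + x)) * (1 / (1 + x))"
    using ge g x by (intro mult_mono key) auto
  finally have "(norm (chf t u))\<^sup>2 \<le> (1 / (1 + x))\<^sup>2"
    by (simp add: power2_eq_square)
  then have "norm (chf t u) \<le> 1 / (1 + x)"
    by (rule power2_le_imp_le) (use x in simp)
  \<comment> \<open>for \<open>0 \<le> x \<le> 4\<close> the argument \<open>x / 5\<close> is at most 1, where \<open>exp\<close> is below its quadratic bound\<close>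
  also have "\<dots> \<le> 1 / exp (x / 5)"
  proof -
    have "exp (x / 5) \<le> 1 + x / 5 + (x / 5)\<^sup>2"
      using x by (intro exp_bound) auto
    also have "(x / 5)\<^sup>2 \<le> (x / 5) * 1"
      unfolding power2_eq_square using x by (intro mult_left_mono) auto
    finally show ?thesis using x by (intro divide_left_mono) auto
  qed
  also have "\<dots> = exp (- (2 * exp (- \<beta>) / 5) * (1 - cos u))"
    by (simp add: x_def a0_def exp_minus inverse_eq_divide)
  finally show ?thesis .
qed

definition cgf_bound :: "real \<Rightarrow> real" where
  "cgf_bound T = 4 / (1 - geo T) ^ 3"

lemma norm_geo_le:
  fixes z :: complex
  assumes "\<bar>Re z\<bar> \<le> T"
  shows "norm (geo z) \<le> geo T" "norm (geo (- z)) \<le> geo T"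
  using assms by (auto simp: norm_geo_complex geo_def)

lemma cum_le:
  assumes "\<bar>t\<bar> \<le> T" "T < \<beta> / 2"
  shows "\<bar>cum1 (t::real)\<bar> \<le> cgf_bound T" "\<bar>cum2 (t::real)\<bar> \<le> cgf_bound T" "\<bar>cum3 (t::real)\<bar> \<le> cgf_bound T"
proof -
  have "norm (geo t) \<le> geo T" "norm (geo (- t)) \<le> geo T" "geo T < 1"
    using assms by (auto simp: geo_def)
  from norm_cum_le[OF this] show "\<bar>cum1 (t::real)\<bar> \<le> cgf_bound T" "\<bar>cum2 (t::real)\<bar> \<le> cgf_bound T" "\<bar>cum3 (t::real)\<bar> \<le> cgf_bound T"
    by (auto simp: cgf_bound_def)
qed

lemma cgf_bound_pos: "T < \<beta> / 2 \<Longrightarrow> 0 < cgf_bound T"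
  by (simp add: cgf_bound_def geo_less_1)

text \<open>
  On the strip \<open>\<bar>Re z\<bar> \<le> T\<close> the numbers \<open>1 - geo z\<close> stay in the right half plane, so the principal
  logarithm of the moment generating function is holomorphic there with derivatives \<open>cum1\<close>,
  \<open>cum2\<close>, \<open>cum3\<close>.  Taylor's theorem between \<open>t\<close> and \<open>t + \<i> u\<close> gives an expansion with a cubic
  error that is uniform in the tilt.
\<close>

lemma chf_Taylor:
  assumes "\<bar>t\<bar> \<le> T" "T < \<beta> / 2"
  shows "\<exists>R. chf t u = exp (\<i> * of_real (u * cum1 t) - of_real (u\<^sup>2 / 2 * cum2 t) + R)
     \<and> norm R \<le> cgf_bound T * \<bar>u\<bar> ^ 3"
proof -
  define S where "S = {z::complex. \<bar>Re z\<bar> \<le> T}"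
  define K where "K z = - Ln (1 - geo z) - Ln (1 - geo (- z))" for z
  define f where "f i = (if i = 0 then K else if i = 1 then cum1 else if i = 2 then cum2 else cum3)" for i :: nat
  have S: "convex S"
  proof -
    have "S = {z. Re z \<le> T} \<inter> {z. Re z \<ge> - T}" by (auto simp: S_def)
    then show ?thesis by (simp add: convex_Int convex_halfspace_Re_le convex_halfspace_Re_ge)
  qed
  have gT: "geo T < 1" using assms by (simp add: geo_less_1)
  have ne: "geo z \<noteq> 1" "geo (- z) \<noteq> 1" if "z \<in> S" for z
    using norm_geo_le[of z T] that gT unfolding S_def by force+
  have nonpos: "1 - geo z \<notin> \<real>\<^sub>\<le>\<^sub>0" "1 - geo (- z) \<notin> \<real>\<^sub>\<le>\<^sub>0" if "z \<in> S" for z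
  proof -
    have "Re (geo z) < 1" "Re (geo (- z)) < 1"
      using norm_geo_le[of z T] that gT complex_Re_le_cmod[of "geo z"] complex_Re_le_cmod[of "geo (- z)"]
      unfolding S_def by auto
    then show "1 - geo z \<notin> \<real>\<^sub>\<le>\<^sub>0" "1 - geo (- z) \<notin> \<real>\<^sub>\<le>\<^sub>0"
      by (auto simp: complex_nonpos_Reals_iff)
  qed
  have K: "(K has_field_derivative cum1 z) (at z within S)" if "z \<in> S" for z
    unfolding K_def[abs_def]
    apply (rule derivative_eq_intros refl | use nonpos[OF that] in force)+
    using ne[OF that] by (simp add: cum1_def field_simps)
  have tS: "of_real t \<in> S" "Complex t u \<in> S" using assms by (auto simp: S_def)
  have expK: "exp (K z) = 1 / ((1 - geo z) * (1 - geo (- z)))" if "z \<in> S" for z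
    using ne[OF that] by (simp add: K_def exp_diff exp_minus inverse_eq_divide)
  have mgfK: "mgf z = of_real ((1 - exp (- \<beta> / 2))\<^sup>2) * exp (K z)" if "z \<in> S" for z
    by (simp add: mgf_def expK[OF that])
  have chf: "chf t u = exp (K (Complex t u) - K (of_real t))"
    using beta_pos unfolding chf_def mgf_of_real[symmetric] mgfK[OF tS(1)] mgfK[OF tS(2)]
    by (simp add: exp_diff)
  define R where "R = K (Complex t u) - K (of_real t) - (\<i> * of_real (u * cum1 t) - of_real (u\<^sup>2 / 2 * cum2 t))"
  have "cmod (f 0 (Complex t u) - (\<Sum>i\<le>2. f i (of_real t) * (Complex t u - of_real t) ^ i / fact i))
     \<le> cgf_bound T * cmod (Complex t u - of_real t) ^ Suc 2 / fact 2"
  proof (rule complex_Taylor[OF S])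
    show "(f i has_field_derivative f (Suc i) x) (at x within S)" if "x \<in> S" "i \<le> 2" for i x
    proof -
      have "i = 0 \<or> i = 1 \<or> i = 2" using that by auto
      then show ?thesis
        using K[OF that(1)] DERIV_cum1[OF ne[OF that(1)]] DERIV_cum2[OF ne[OF that(1)]]
        by (auto simp: f_def)
    qed
    show "cmod (f (Suc 2) x) \<le> cgf_bound T" if "x \<in> S" for x
      using norm_cum_le(3)[OF norm_geo_le[of x T] gT] that by (auto simp: f_def cgf_bound_def S_def)
  qed (use tS in auto)
  moreover have d: "Complex t u - of_real t = \<i> * of_real u"
    by (simp add: complex_eq_iff)
  moreover have "f 0 (Complex t u) - (\<Sum>i\<le>2. f i (of_real t) * (Complex t u - of_real t) ^ i / fact i) = R"
  proof -
    have "(\<Sum>i\<le>2. f i (of_real t) * (\<i> * of_real u) ^ i / fact i)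
       = K (of_real t) + cum1 (of_real t) * (\<i> * of_real u) + cum2 (of_real t) * (\<i> * of_real u)\<^sup>2 / 2"
      by (simp add: numeral_2_eq_2 f_def)
    also have "(\<i> * complex_of_real u)\<^sup>2 = - of_real (u\<^sup>2)"
      by (simp add: power_mult_distrib)
    finally show ?thesis
      unfolding d R_def by (simp add: f_def cum1_of_real cum2_of_real algebra_simps)
  qed
  ultimately have "cmod R \<le> cgf_bound T * \<bar>u\<bar> ^ 3 / 2"
    by (simp add: norm_mult numeral_3_eq_3 numeral_2_eq_2)
  moreover have "0 \<le> cgf_bound T * \<bar>u\<bar> ^ 3" using cgf_bound_pos[OF assms(2)] by simp
  ultimately have "cmod R \<le> cgf_bound T * \<bar>u\<bar> ^ 3" by linarith
  moreover have "chf t u = exp (\<i> * of_real (u * cum1 t) - of_real (u\<^sup>2 / 2 * cum2 t) + R)"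
    unfolding chf R_def by simp
  ultimately show ?thesis by blast
qed

end


section \<open>Fourier inversion and the uniform local bound\<close>

lemma borel_measurable_cis [measurable]: "cis \<in> borel_measurable borel"
  by (intro borel_measurable_continuous_onI continuous_intros)

lemma integral_cis_period:
  "(\<integral>s. indicator {- pi..pi} s *\<^sub>R cis (s * of_int n) \<partial>lborel) = (if n = 0 then 2 * pi else 0)"
proof (cases "n = 0")
  case True
  then show ?thesis by (simp add: scaleR_conv_of_real)
next
  case False
  have d: "((\<lambda>s. cis (s * of_int n) / (\<i> * of_int n)) has_vector_derivative cis (s * of_int n)) (at s within {-pi..pi})" for s
  proof -
    have "((\<lambda>s. cis (s * of_int n)) has_vector_derivative (of_int n *\<^sub>R (\<i> * cis (s * of_int n)))) (at s within {-pi..pi})"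
      unfolding has_vector_derivative_def
      by (auto intro!: derivative_eq_intros simp: scaleR_conv_of_real)
    from has_vector_derivative_mult_right[OF this, of "1 / (\<i> * of_int n)"] show ?thesis
      using False by (simp add: scaleR_conv_of_real field_simps)
  qed
  have "(\<integral>s. indicator {- pi..pi} s *\<^sub>R cis (s * of_int n) \<partial>lborel)
     = cis (pi * of_int n) / (\<i> * of_int n) - cis (- pi * of_int n) / (\<i> * of_int n)"
    by (rule integral_FTC_atLeastAtMost[OF _ d]) (auto intro!: continuous_intros)
  also have "cis (- pi * of_int n) = cis (pi * of_int n)"
    using sin_zero_iff_int2[of "pi * of_int n"] by (simp add: complex_eq_iff)
  finally show ?thesis using False by simp
qed

text \<open>
  Fubini's theorem and the orthogonality of characters over one period.
\<close>

lemma expectation_eq_fourier_integral: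
  fixes X :: "'a \<Rightarrow> int" and g :: "'a \<Rightarrow> complex"
  assumes "\<And>\<omega>. norm (g \<omega>) \<le> B"
  shows "measure_pmf.expectation p (\<lambda>\<omega>. if X \<omega> = x then g \<omega> else 0)
     = (1 / (2 * pi)) *\<^sub>R (\<integral>s. indicator {- pi..pi} s *\<^sub>R
         measure_pmf.expectation p (\<lambda>\<omega>. cis (s * of_int (X \<omega> - x)) * g \<omega>) \<partial>lborel)"
proof -
  define f where "f s \<omega> = indicator {- pi..pi} s *\<^sub>R (cis (s * of_int (X \<omega> - x)) * g \<omega>)" for s \<omega>
  interpret pair_sigma_finite lborel "measure_pmf p"
    by (intro pair_sigma_finite.intro lborel.sigma_finite_measure_axioms measure_pmf.sigma_finite_measure_axioms)
  have [measurable]: "(\<lambda>\<omega>. real_of_int (X \<omega> - x)) \<in> borel_measurable (measure_pmf p)"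
    "g \<in> borel_measurable (measure_pmf p)" by auto
  have "integrable (lborel \<Otimes>\<^sub>M measure_pmf p) (case_prod f)"
  proof (rule integrableI_bounded_set[where A = "{- pi..pi} \<times> UNIV" and B = B])
    show "{- pi..pi} \<times> UNIV \<in> sets (lborel \<Otimes>\<^sub>M measure_pmf p)"
      by (intro pair_measureI) auto
    show "case_prod f \<in> borel_measurable (lborel \<Otimes>\<^sub>M measure_pmf p)"
      unfolding f_def by measurable
    show "emeasure (lborel \<Otimes>\<^sub>M measure_pmf p) ({- pi..pi} \<times> UNIV) < \<infinity>"
      by (subst measure_pmf.emeasure_pair_measure_Times)
        (auto simp: measure_pmf.emeasure_space_1[simplified] ennreal_mult_less_top)
    show "AE \<omega> in lborel \<Otimes>\<^sub>M measure_pmf p. \<omega> \<in> {- pi..pi} \<times> UNIV \<longrightarrow> norm (case_prod f \<omega>) \<le> B"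
      by (rule AE_I2) (use assms in \<open>auto simp: f_def norm_mult\<close>)
    show "AE \<omega> in lborel \<Otimes>\<^sub>M measure_pmf p. \<omega> \<notin> {- pi..pi} \<times> UNIV \<longrightarrow> case_prod f \<omega> = 0"
      by (rule AE_I2) (auto simp: f_def indicator_def)
  qed
  from Fubini_integral[OF this]
  have "(\<integral>s. indicator {- pi..pi} s *\<^sub>R measure_pmf.expectation p (\<lambda>\<omega>. cis (s * of_int (X \<omega> - x)) * g \<omega>) \<partial>lborel)
      = measure_pmf.expectation p (\<lambda>\<omega>. \<integral>s. f s \<omega> \<partial>lborel)"
    by (simp add: f_def)
  also have "(\<lambda>\<omega>. \<integral>s. f s \<omega> \<partial>lborel) = (\<lambda>\<omega>. (2 * pi) *\<^sub>R (if X \<omega> = x then g \<omega> else 0))"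
  proof
    fix \<omega>
    have "(\<integral>s. f s \<omega> \<partial>lborel) = (\<integral>s. (indicator {- pi..pi} s *\<^sub>R cis (s * of_int (X \<omega> - x))) * g \<omega> \<partial>lborel)"
      by (simp add: f_def)
    also have "\<dots> = (\<integral>s. indicator {- pi..pi} s *\<^sub>R cis (s * of_int (X \<omega> - x)) \<partial>lborel) * g \<omega>"
      by (rule integral_mult_left_zero)
    finally show "(\<integral>s. f s \<omega> \<partial>lborel) = (2 * pi) *\<^sub>R (if X \<omega> = x then g \<omega> else 0)"
      unfolding integral_cis_period by (simp add: scaleR_conv_of_real)
  qed
  also have "measure_pmf.expectation p \<dots> = (2 * pi) *\<^sub>R measure_pmf.expectation p (\<lambda>\<omega>. if X \<omega> = x then g \<omega> else 0)"
    by (rule integral_scaleR_right)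
  finally show ?thesis by simp
qed

text \<open>
  The one-dimensional inversion is applied twice, first to \<open>X\<close> with the indicator of \<open>A = a\<close> as weight
  and then to \<open>A\<close> with a character as weight.  Iterated integrals suffice throughout, because the
  dominating function is a product.
\<close>

lemma prob_eq_fourier_integral:
  fixes X A :: "'a \<Rightarrow> int"
  shows "complex_of_real (measure_pmf.prob p {\<omega>. X \<omega> = x \<and> A \<omega> = a})
     = (1 / (2 * pi)\<^sup>2) *\<^sub>R (\<integral>s. indicator {- pi..pi} s *\<^sub>R (\<integral>v. indicator {- pi..pi} v *\<^sub>R
         measure_pmf.expectation p (\<lambda>\<omega>. cis (s * of_int (X \<omega> - x) + v * of_int (A \<omega> - a))) \<partial>lborel) \<partial>lborel)"
proof -
  have "complex_of_real (measure_pmf.prob p {\<omega>. X \<omega> = x \<and> A \<omega> = a})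
      = of_real (measure_pmf.expectation p (indicator {\<omega>. X \<omega> = x \<and> A \<omega> = a}))"
    by simp
  also have "\<dots> = measure_pmf.expectation p (\<lambda>\<omega>. of_real (indicator {\<omega>. X \<omega> = x \<and> A \<omega> = a} \<omega>))"
    by (rule integral_complex_of_real[symmetric])
  also have "\<dots> = measure_pmf.expectation p (\<lambda>\<omega>. if X \<omega> = x then (if A \<omega> = a then 1 else 0) else 0)"
    by (intro arg_cong[where f = "measure_pmf.expectation p"]) (auto simp: fun_eq_iff indicator_def)
  also have "\<dots> = (1 / (2 * pi)) *\<^sub>R (\<integral>s. indicator {- pi..pi} s *\<^sub>R
         measure_pmf.expectation p (\<lambda>\<omega>. cis (s * of_int (X \<omega> - x)) * (if A \<omega> = a then 1 else 0)) \<partial>lborel)"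
    by (rule expectation_eq_fourier_integral[where B = 1]) auto
  also have "(\<lambda>s. measure_pmf.expectation p (\<lambda>\<omega>. cis (s * of_int (X \<omega> - x)) * (if A \<omega> = a then 1 else 0)))
     = (\<lambda>s. measure_pmf.expectation p (\<lambda>\<omega>. if A \<omega> = a then cis (s * of_int (X \<omega> - x)) else 0))"
    by (intro ext arg_cong[where f = "measure_pmf.expectation p"]) auto
  also have "\<dots> = (\<lambda>s. (1 / (2 * pi)) *\<^sub>R (\<integral>v. indicator {- pi..pi} v *\<^sub>R
         measure_pmf.expectation p (\<lambda>\<omega>. cis (v * of_int (A \<omega> - a)) * cis (s * of_int (X \<omega> - x))) \<partial>lborel))"
    by (intro ext expectation_eq_fourier_integral[where B = 1]) auto
  also have "\<dots> = (\<lambda>s. (1 / (2 * pi)) *\<^sub>R (\<integral>v. indicator {- pi..pi} v *\<^sub>R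
         measure_pmf.expectation p (\<lambda>\<omega>. cis (s * of_int (X \<omega> - x) + v * of_int (A \<omega> - a))) \<partial>lborel))"
    by (simp add: cis_mult add.commute)
  finally show ?thesis
    by (simp only: scaleR_left_commute[of "indicator _ _" "1 / (2 * pi)"] integral_scaleR_right)
      (simp add: power2_eq_square)
qed

lemma expectation_prod_Pi_pmf_banach:
  fixes f :: "'i \<Rightarrow> 'b \<Rightarrow> 'c :: {real_normed_field, banach, second_countable_topology}"
  assumes "finite I" "\<And>i. i \<in> I \<Longrightarrow> integrable (measure_pmf (p i)) (f i)"
  shows "measure_pmf.expectation (Pi_pmf I d p) (\<lambda>h. \<Prod>i\<in>I. f i (h i))
      = (\<Prod>i\<in>I. measure_pmf.expectation (p i) (f i))"
proof -
  have ind: "prob_space.indep_vars (measure_pmf (Pi_pmf I d p)) (\<lambda>_. borel) (\<lambda>i h. f i (h i)) I"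
    by (rule prob_space.indep_vars_compose2[OF measure_pmf.prob_space_axioms indep_vars_Pi_pmf[OF assms(1)]]) simp
  have i: "integrable (measure_pmf (Pi_pmf I d p)) (\<lambda>h. f i (h i))" if "i \<in> I" for i
  proof -
    have "integrable (measure_pmf (map_pmf (\<lambda>h. h i) (Pi_pmf I d p))) (f i)"
      using assms that by (simp only: Pi_pmf_component if_True)
    then show ?thesis by (simp add: integrable_map_pmf_eq)
  qed
  have "measure_pmf.expectation (Pi_pmf I d p) (\<lambda>h. \<Prod>i\<in>I. f i (h i))
     = (\<Prod>i\<in>I. measure_pmf.expectation (Pi_pmf I d p) (\<lambda>h. f i (h i)))"
    by (rule prob_space.indep_vars_lebesgue_integral[OF measure_pmf.prob_space_axioms assms(1) ind i])
  also have "\<dots> = (\<Prod>i\<in>I. measure_pmf.expectation (map_pmf (\<lambda>h. h i) (Pi_pmf I d p)) (f i))"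
    by simp
  also have "\<dots> = (\<Prod>i\<in>I. measure_pmf.expectation (p i) (f i))"
    using assms(1) by (intro prod.cong refl) (simp only: Pi_pmf_component if_True)
  finally show ?thesis .
qed

context laplace_walk begin

text \<open>
  The probability that a block of \<open>n\<close> independent tilted increments, starting at index \<open>m\<close>, has sum
  \<open>x\<close> and weighted sum \<open>a\<close>.  The weights start at \<open>0\<close> whatever \<open>m\<close> is: given the sum, any other
  arithmetic progression of weights with step \<open>1\<close> or \<open>- 1\<close> leads to an event of this form.
\<close>

definition hit :: "nat \<Rightarrow> nat \<Rightarrow> (nat \<Rightarrow> real) \<Rightarrow> int \<Rightarrow> int \<Rightarrow> real" where
  "hit m n \<tau> x a = measure_pmf.prob (Pi_pmf {m..<m+n} 0 (\<lambda>j. tilted_step \<beta> (\<tau> j)))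
     {\<xi>. (\<Sum>j\<in>{m..<m+n}. \<xi> j) = x \<and> (\<Sum>j\<in>{m..<m+n}. (int j - int m) * \<xi> j) = a}"

definition block_chf :: "nat \<Rightarrow> nat \<Rightarrow> (nat \<Rightarrow> real) \<Rightarrow> real \<Rightarrow> real \<Rightarrow> complex" where
  "block_chf m n \<tau> s v = (\<Prod>j<n. chf (\<tau> (m + j)) (s + real j * v))"

lemma expectation_block_chf:
  assumes "\<And>j. j \<in> {m..<m+n} \<Longrightarrow> \<bar>\<tau> j\<bar> < \<beta> / 2"
  shows "measure_pmf.expectation (Pi_pmf {m..<m+n} 0 (\<lambda>j. tilted_step \<beta> (\<tau> j)))
    (\<lambda>\<xi>. cis (s * of_int ((\<Sum>j\<in>{m..<m+n}. \<xi> j) - x) + v * of_int ((\<Sum>j\<in>{m..<m+n}. (int j - int m) * \<xi> j) - a)))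
    = block_chf m n \<tau> s v * cis (- (s * of_int x + v * of_int a))"
proof -
  define u where "u j = s + (real j - real m) * v" for j
  have "(\<lambda>\<xi>. cis (s * of_int ((\<Sum>j\<in>{m..<m+n}. \<xi> j) - x) + v * of_int ((\<Sum>j\<in>{m..<m+n}. (int j - int m) * \<xi> j) - a)))
    = (\<lambda>\<xi>. (\<Prod>j\<in>{m..<m+n}. exp (\<i> * of_real (u j) * of_int (\<xi> j))) * cis (- (s * of_int x + v * of_int a)))"
  proof
    fix \<xi> :: "nat \<Rightarrow> int"
    have "(\<Prod>j\<in>{m..<m+n}. exp (\<i> * of_real (u j) * of_int (\<xi> j))) = exp (\<Sum>j\<in>{m..<m+n}. \<i> * of_real (u j) * of_int (\<xi> j))"
      by (simp add: exp_sum)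
    also have "\<dots> = cis (\<Sum>j\<in>{m..<m+n}. u j * of_int (\<xi> j))"
      by (simp add: cis_conv_exp sum_distrib_left mult.assoc)
    also have "(\<Sum>j\<in>{m..<m+n}. u j * of_int (\<xi> j)) = s * of_int (\<Sum>j\<in>{m..<m+n}. \<xi> j) + v * of_int (\<Sum>j\<in>{m..<m+n}. (int j - int m) * \<xi> j)"
      by (simp add: u_def sum_distrib_left sum.distrib[symmetric] algebra_simps)
    finally show "cis (s * of_int ((\<Sum>j\<in>{m..<m+n}. \<xi> j) - x) + v * of_int ((\<Sum>j\<in>{m..<m+n}. (int j - int m) * \<xi> j) - a))
      = (\<Prod>j\<in>{m..<m+n}. exp (\<i> * of_real (u j) * of_int (\<xi> j))) * cis (- (s * of_int x + v * of_int a))"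
      by (simp add: cis_mult) (simp add: algebra_simps)
  qed
  then have "measure_pmf.expectation (Pi_pmf {m..<m+n} 0 (\<lambda>j. tilted_step \<beta> (\<tau> j)))
    (\<lambda>\<xi>. cis (s * of_int ((\<Sum>j\<in>{m..<m+n}. \<xi> j) - x) + v * of_int ((\<Sum>j\<in>{m..<m+n}. (int j - int m) * \<xi> j) - a)))
    = measure_pmf.expectation (Pi_pmf {m..<m+n} 0 (\<lambda>j. tilted_step \<beta> (\<tau> j)))
       (\<lambda>\<xi>. \<Prod>j\<in>{m..<m+n}. exp (\<i> * of_real (u j) * of_int (\<xi> j))) * cis (- (s * of_int x + v * of_int a))"
    by (simp only: integral_mult_left_zero)
  also have "measure_pmf.expectation (Pi_pmf {m..<m+n} 0 (\<lambda>j. tilted_step \<beta> (\<tau> j)))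
       (\<lambda>\<xi>. \<Prod>j\<in>{m..<m+n}. exp (\<i> * of_real (u j) * of_int (\<xi> j)))
      = (\<Prod>j\<in>{m..<m+n}. measure_pmf.expectation (tilted_step \<beta> (\<tau> j)) (\<lambda>k. exp (\<i> * of_real (u j) * of_int k)))"
    by (intro expectation_prod_Pi_pmf_banach measure_pmf.integrable_const_bound[where B = 1])
      (auto simp: norm_exp_eq_Re)
  also have "\<dots> = (\<Prod>j\<in>{m..<m+n}. chf (\<tau> j) (u j))"
    by (intro prod.cong expectation_chf assms) auto
  also have "\<dots> = block_chf m n \<tau> s v"
    unfolding block_chf_def by (rule prod.reindex_bij_witness[of _ "\<lambda>j. m + j" "\<lambda>j. j - m"]) (auto simp: u_def)
  finally show ?thesis .
qed

lemma borel_measurable_chf [measurable]: "chf t \<in> borel_measurable borel"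
proof -
  have [measurable]: "(\<lambda>z::complex. exp z) \<in> borel_measurable borel"
    by (intro borel_measurable_continuous_onI continuous_intros)
  show ?thesis
    unfolding chf_def[abs_def] mgf_def geo_def Complex_eq by measurable
qed

text \<open>
  The integrand of the inversion formula in the variables \<open>\<sigma> = s \<surd>n\<close> and \<open>\<nu> = v n\<^bsup>3/2\<^esup>\<close>, which undo the
  fluctuations of order \<open>n\<^bsup>1/2\<^esup>\<close> of the sum and \<open>n\<^bsup>3/2\<^esup>\<close> of the weighted sum.
\<close>

definition scaled_integrand :: "nat \<Rightarrow> nat \<Rightarrow> (nat \<Rightarrow> real) \<Rightarrow> int \<Rightarrow> int \<Rightarrow> real \<Rightarrow> real \<Rightarrow> complex" where
  "scaled_integrand m n \<tau> x a \<sigma> \<nu> =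
     indicator {- pi..pi} (\<sigma> / sqrt n) *\<^sub>R (indicator {- pi..pi} (\<nu> / (real n * sqrt n)) *\<^sub>R
       (block_chf m n \<tau> (\<sigma> / sqrt n) (\<nu> / (real n * sqrt n))
         * cis (- (\<sigma> / sqrt n * of_int x + \<nu> / (real n * sqrt n) * of_int a))))"

text \<open>
  The factor \<open>n\<^sup>2\<close> is the Jacobian \<open>n\<^bsup>1/2\<^esup> n\<^bsup>3/2\<^esup>\<close> of the rescaling.
\<close>

lemma hit_eq_integral:
  assumes "\<And>j. j \<in> {m..<m+n} \<Longrightarrow> \<bar>\<tau> j\<bar> < \<beta> / 2" "0 < n"
  shows "complex_of_real ((real n)\<^sup>2 * hit m n \<tau> x a)
     = (1 / (2 * pi)\<^sup>2) *\<^sub>R (\<integral>\<sigma>. \<integral>\<nu>. scaled_integrand m n \<tau> x a \<sigma> \<nu> \<partial>lborel \<partial>lborel)"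
proof -
  define K where "K s v = block_chf m n \<tau> s v * cis (- (s * of_int x + v * of_int a))" for s v
  define b where "b = 1 / (real n * sqrt n)"
  define c where "c = 1 / sqrt n"
  have pos: "0 < b" "0 < c" using assms by (auto simp: b_def c_def)
  have swap: "(\<integral>\<sigma>. indicator {- pi..pi} (0 + c * \<sigma>) *\<^sub>R (b *\<^sub>R G \<sigma>) \<partial>lborel)
      = b *\<^sub>R (\<integral>\<sigma>. indicator {- pi..pi} (0 + c * \<sigma>) *\<^sub>R G \<sigma> \<partial>lborel)" for G :: "real \<Rightarrow> complex"
    unfolding integral_scaleR_right[symmetric] by (rule Bochner_Integration.integral_cong) (auto simp: mult.commute)
  have "complex_of_real (hit m n \<tau> x a) = (1 / (2 * pi)\<^sup>2) *\<^sub>R (\<integral>s. indicator {- pi..pi} s *\<^sub>R (\<integral>v. indicator {- pi..pi} v *\<^sub>R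
         K s v \<partial>lborel) \<partial>lborel)"
    unfolding hit_def prob_eq_fourier_integral K_def
    by (subst expectation_block_chf) (use assms(1) in auto)
  also have "(\<lambda>s. \<integral>v. indicator {- pi..pi} v *\<^sub>R K s v \<partial>lborel) = (\<lambda>s. b *\<^sub>R (\<integral>\<nu>. indicator {- pi..pi} (0 + b * \<nu>) *\<^sub>R K s (0 + b * \<nu>) \<partial>lborel))"
    using pos by (subst lborel_integral_real_affine[of b _ 0]) auto
  also have "(\<integral>s. indicator {- pi..pi} s *\<^sub>R (b *\<^sub>R (\<integral>\<nu>. indicator {- pi..pi} (0 + b * \<nu>) *\<^sub>R K s (0 + b * \<nu>) \<partial>lborel)) \<partial>lborel)
     = c *\<^sub>R (\<integral>\<sigma>. indicator {- pi..pi} (0 + c * \<sigma>) *\<^sub>R (b *\<^sub>R (\<integral>\<nu>. indicator {- pi..pi} (0 + b * \<nu>) *\<^sub>R K (0 + c * \<sigma>) (0 + b * \<nu>) \<partial>lborel)) \<partial>lborel)"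
    using pos by (subst lborel_integral_real_affine[of c _ 0]) auto
  also have "\<dots> = (c * b) *\<^sub>R (\<integral>\<sigma>. indicator {- pi..pi} (0 + c * \<sigma>) *\<^sub>R (\<integral>\<nu>. indicator {- pi..pi} (0 + b * \<nu>) *\<^sub>R K (0 + c * \<sigma>) (0 + b * \<nu>) \<partial>lborel) \<partial>lborel)"
    using swap[of "\<lambda>\<sigma>. \<integral>\<nu>. indicator {- pi..pi} (0 + b * \<nu>) *\<^sub>R K (0 + c * \<sigma>) (0 + b * \<nu>) \<partial>lborel"] by simp
  also have "(\<lambda>\<sigma>. indicator {- pi..pi} (0 + c * \<sigma>) *\<^sub>R (\<integral>\<nu>. indicator {- pi..pi} (0 + b * \<nu>) *\<^sub>R K (0 + c * \<sigma>) (0 + b * \<nu>) \<partial>lborel))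
      = (\<lambda>\<sigma>. \<integral>\<nu>. scaled_integrand m n \<tau> x a \<sigma> \<nu> \<partial>lborel)"
    unfolding scaled_integrand_def by (subst integral_scaleR_right) (simp add: K_def b_def c_def)
  finally have *: "complex_of_real (hit m n \<tau> x a) = (1 / (2 * pi)\<^sup>2) *\<^sub>R ((c * b) *\<^sub>R (\<integral>\<sigma>. \<integral>\<nu>. scaled_integrand m n \<tau> x a \<sigma> \<nu> \<partial>lborel \<partial>lborel))"
    by simp
  have one: "(real n)\<^sup>2 * (c * b) = 1"
    using assms(2) by (simp add: c_def b_def power2_eq_square)
  have "complex_of_real ((real n)\<^sup>2 * hit m n \<tau> x a) = (real n)\<^sup>2 *\<^sub>R complex_of_real (hit m n \<tau> x a)"
    by (simp add: scaleR_conv_of_real)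
  also have "\<dots> = (1 / (2 * pi)\<^sup>2 * ((real n)\<^sup>2 * (c * b))) *\<^sub>R (\<integral>\<sigma>. \<integral>\<nu>. scaled_integrand m n \<tau> x a \<sigma> \<nu> \<partial>lborel \<partial>lborel)"
    unfolding * scaleR_scaleR by (simp only: mult_ac)
  finally show ?thesis by (simp only: one mult_1_right)
qed

lemma borel_measurable_scaled_integrand [measurable]:
  assumes [measurable]: "f \<in> borel_measurable M" "g \<in> borel_measurable M"
  shows "(\<lambda>p. scaled_integrand m n \<tau> x a (f p) (g p)) \<in> borel_measurable M"
proof -
  have [measurable]: "(\<lambda>p. block_chf m n \<tau> (f p / sqrt n) (g p / (real n * sqrt n))) \<in> borel_measurable M"
    unfolding block_chf_def
    by (intro borel_measurable_prod measurable_compose[OF _ borel_measurable_chf]) measurable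
  have [measurable]: "(\<lambda>p. cis (- (f p / sqrt n * of_int x + g p / (real n * sqrt n) * of_int a))) \<in> borel_measurable M"
    by (rule measurable_compose[OF _ borel_measurable_cis]) measurable
  have [measurable]: "(\<lambda>p. indicat_real {- pi..pi} (f p / sqrt n)) \<in> borel_measurable M"
    "(\<lambda>p. indicat_real {- pi..pi} (g p / (real n * sqrt n))) \<in> borel_measurable M"
    by (rule measurable_compose[OF _ borel_measurable_indicator]; measurable)+
  show ?thesis unfolding scaled_integrand_def by (intro borel_measurable_scaleR borel_measurable_times) measurable
qed

text \<open>
  The Dirichlet kernel: multiplied by \<open>2 sin (v/2)\<close> the sum telescopes.
\<close>

lemma sum_cos_arith:
  "2 * sin (v / 2) * (\<Sum>j<n. cos (s + real j * v)) = sin (s + (real n - 1 / 2) * v) - sin (s - v / 2)"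
proof (induction n)
  case (Suc n)
  have "2 * sin (v / 2) * cos (s + real n * v) = sin (s + (real (Suc n) - 1 / 2) * v) - sin (s + (real n - 1 / 2) * v)"
  proof -
    have "s + (real (Suc n) - 1 / 2) * v = (s + real n * v) + v / 2" "s + (real n - 1 / 2) * v = (s + real n * v) - v / 2"
      by (auto simp: algebra_simps)
    then show ?thesis by (simp only: sin_add sin_diff) simp
  qed
  then show ?case using Suc.IH by (simp add: algebra_simps)
qed (simp add: algebra_simps)

lemma sin_ge_quarter:
  assumes "0 \<le> y" "y \<le> 21 / 10"
  shows "y / 4 \<le> sin (y::real)"
proof -
  have "\<bar>sin y - (\<Sum>m<3. sin_coeff m * y ^ m)\<bar> \<le> inverse (fact 3) * \<bar>y\<bar> ^ 3"
    by (rule Maclaurin_sin_bound)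
  moreover have "(\<Sum>m<3. sin_coeff m * y ^ m) = y"
    by (simp add: sin_coeff_def numeral_3_eq_3)
  ultimately have "sin y \<ge> y - y ^ 3 / 6"
    using assms by (simp add: fact_numeral abs_if split: if_splits)
  moreover have "y ^ 3 \<le> y * (21 / 10)\<^sup>2"
  proof -
    have "y * y\<^sup>2 \<le> y * (21 / 10)\<^sup>2" using assms by (intro mult_left_mono power_mono) auto
    then show ?thesis by (simp add: power3_eq_cube power2_eq_square)
  qed
  ultimately show ?thesis using assms by (simp add: power2_eq_square)
qed

lemma one_minus_cos_ge:
  assumes "\<bar>x\<bar> \<le> 42 / 10"
  shows "x\<^sup>2 / 32 \<le> 1 - cos (x::real)"
proof -
  have "\<bar>x\<bar> / 2 / 4 \<le> sin (\<bar>x\<bar> / 2)" using assms by (intro sin_ge_quarter) auto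
  then have "(\<bar>x\<bar> / 8)\<^sup>2 \<le> (sin (\<bar>x\<bar> / 2))\<^sup>2" by (intro power_mono) auto
  moreover have "cos \<bar>x\<bar> = 1 - 2 * (sin (\<bar>x\<bar> / 2))\<^sup>2"
    using cos_double_sin[of "\<bar>x\<bar> / 2"] by simp
  moreover have "cos \<bar>x\<bar> = cos x" by (simp add: abs_if)
  ultimately show ?thesis by (simp add: power_divide power_mult_distrib)
qed

text \<open>
  A linear phase that is small on the first \<open>a\<close> indices cannot also be small on the third group of
  \<open>a\<close> indices unless its slope \<open>v\<close> is small: the two differ by \<open>2 a v\<close>.  This controls \<open>v\<close>; on the
  first group alone the phase then controls \<open>s\<close>.
\<close>

lemma sum_quadratic_ge:
  "real a * s\<^sup>2 / 6 + real a ^ 3 * v\<^sup>2 \<le> (\<Sum>j<3 * a. (s + real j * v)\<^sup>2)"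
proof -
  define Q where "Q = (\<Sum>j<a. (s + real j * v)\<^sup>2 + (s + (real j + 2 * real a) * v)\<^sup>2)"
  have "(\<Sum>j<a. (s + (real j + 2 * real a) * v)\<^sup>2) = (\<Sum>j\<in>{2 * a..<3 * a}. (s + real j * v)\<^sup>2)"
    by (rule sum.reindex_bij_witness[of _ "\<lambda>j. j - 2 * a" "\<lambda>j. j + 2 * a"]) (auto simp: algebra_simps)
  then have "Q = (\<Sum>j\<in>{..<a} \<union> {2 * a..<3 * a}. (s + real j * v)\<^sup>2)"
    unfolding Q_def sum.distrib by (subst sum.union_disjoint) auto
  also have "\<dots> \<le> (\<Sum>j<3 * a. (s + real j * v)\<^sup>2)"
    by (intro sum_mono2) auto
  finally have Q: "Q \<le> (\<Sum>j<3 * a. (s + real j * v)\<^sup>2)" .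
  have "(\<Sum>j<a. 2 * (real a * v)\<^sup>2) \<le> Q"
    unfolding Q_def
  proof (intro sum_mono)
    fix j
    have "0 \<le> (2 * s + (2 * real j + 2 * real a) * v)\<^sup>2 / 2" by simp
    then show "2 * (real a * v)\<^sup>2 \<le> (s + real j * v)\<^sup>2 + (s + (real j + 2 * real a) * v)\<^sup>2"
      by (simp add: power2_eq_square algebra_simps)
  qed
  then have 1: "2 * (real a ^ 3 * v\<^sup>2) \<le> Q" by (simp add: power2_eq_square power3_eq_cube algebra_simps)
  have "(\<Sum>j<a. s\<^sup>2 / 2 - (real a * v)\<^sup>2) \<le> Q"
    unfolding Q_def
  proof (intro sum_mono)
    fix j assume j: "j \<in> {..<a}"
    have "0 \<le> (s + 2 * (real j * v))\<^sup>2 / 2" by simp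
    then have "s\<^sup>2 / 2 - (real j * v)\<^sup>2 \<le> (s + real j * v)\<^sup>2"
      by (simp add: power2_eq_square algebra_simps)
    moreover have "(real j * v)\<^sup>2 \<le> (real a * v)\<^sup>2"
      using j by (simp add: power_mult_distrib mult_right_mono)
    ultimately show "s\<^sup>2 / 2 - (real a * v)\<^sup>2 \<le> (s + real j * v)\<^sup>2 + (s + (real j + 2 * real a) * v)\<^sup>2"
      using zero_le_power2[of "s + (real j + 2 * real a) * v"] by linarith
  qed
  then have 2: "real a * s\<^sup>2 / 2 - real a ^ 3 * v\<^sup>2 \<le> Q"
    by (simp add: power2_eq_square power3_eq_cube algebra_simps)
  show ?thesis using 1 2 Q by linarith
qed

text \<open>
  If the slope \<open>v\<close> is at least of order \<open>1/n\<close>, the phases \<open>s + j v\<close> spread over the circle and the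
  Dirichlet kernel bounds the sum of the cosines by \<open>n/2\<close>.  If it is smaller, the phases with \<open>j \<le> n/16\<close>
  stay within distance \<open>4.2\<close> of \<open>0\<close>, hence away from \<open>2 \<pi>\<close>, and \<open>1 - cos\<close> is comparable
  with the square of the phase.
\<close>

lemma sum_one_minus_cos_ge:
  assumes "\<bar>s\<bar> \<le> pi" "\<bar>v\<bar> \<le> pi" "96 \<le> n"
  shows "real n / 2 \<le> (\<Sum>j<n. 1 - cos (s + real j * v))
       \<or> (real n * s\<^sup>2 + real n ^ 3 * v\<^sup>2) / 10 ^ 8 \<le> (\<Sum>j<n. 1 - cos (s + real j * v))"
proof (cases "16 / real n \<le> \<bar>v\<bar>")
  case True
  have n: "0 < real n" using assms(3) by simp
  have v: "0 < \<bar>v\<bar>" using True n by (smt (verit) divide_pos_pos)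
  have pi4: "pi \<le> 4" using pi_less_4 by simp
  have sv: "\<bar>v\<bar> / 8 \<le> \<bar>sin (v / 2)\<bar>"
  proof -
    have "\<bar>v\<bar> / 2 / 4 \<le> sin (\<bar>v\<bar> / 2)"
      using assms(2) pi4 by (intro sin_ge_quarter) auto
    then show ?thesis by (auto simp: abs_if split: if_splits)
  qed
  define S where "S = (\<Sum>j<n. cos (s + real j * v))"
  have "\<bar>2 * sin (v / 2) * S\<bar> \<le> 2"
    unfolding S_def sum_cos_arith using abs_sin_le_one[of "s + (real n - 1 / 2) * v"] abs_sin_le_one[of "s - v / 2"] by linarith
  then have "\<bar>sin (v / 2)\<bar> * \<bar>S\<bar> \<le> 1" by (simp add: abs_mult)
  then have "\<bar>v\<bar> / 8 * \<bar>S\<bar> \<le> 1"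
    using mult_right_mono[OF sv, of "\<bar>S\<bar>"] by simp
  then have "\<bar>S\<bar> \<le> 8 / \<bar>v\<bar>" using v by (simp add: field_simps)
  also have "\<dots> \<le> 8 / (16 / real n)"
    using True n v by (intro divide_left_mono) auto
  finally have "S \<le> real n / 2" using n by simp
  then have "real n / 2 \<le> (\<Sum>j<n. 1 - cos (s + real j * v))"
    by (simp add: sum_subtractf S_def)
  then show ?thesis ..
next
  case False
  \<comment> \<open>three groups of \<open>a\<close> indices make up at most a sixteenth of the block\<close>
  define a where "a = n div 48"
  have n: "0 < real n" using assms(3) by simp
  have a: "48 * a \<le> n" "n \<le> 96 * a" using assms(3) unfolding a_def by auto
  have nv: "real n * \<bar>v\<bar> \<le> 16" using False n by (simp add: field_simps)
  have small: "\<bar>s + real j * v\<bar> \<le> 42 / 10" if "j < 3 * a" for j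
  proof -
    have "16 * real j \<le> real n" using that a by linarith
    then have "16 * real j * \<bar>v\<bar> \<le> real n * \<bar>v\<bar>" by (intro mult_right_mono) auto
    then have "\<bar>real j * v\<bar> \<le> 1" using nv by (simp add: abs_mult)
    moreover have "pi \<le> 32 / 10" using pi_approx by simp
    ultimately show ?thesis using assms(1) by linarith
  qed
  have "(\<Sum>j<3 * a. (s + real j * v)\<^sup>2 / 32) \<le> (\<Sum>j<3 * a. 1 - cos (s + real j * v))"
    by (intro sum_mono one_minus_cos_ge small) auto
  also have "\<dots> \<le> (\<Sum>j<n. 1 - cos (s + real j * v))"
    using a by (intro sum_mono2) auto
  finally have low: "(real a * s\<^sup>2 / 6 + real a ^ 3 * v\<^sup>2) / 32 \<le> (\<Sum>j<n. 1 - cos (s + real j * v))"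
    using sum_quadratic_ge[of a s v] by (simp add: sum_divide_distrib[symmetric])
  have "real n * s\<^sup>2 \<le> 96 * (real a * s\<^sup>2)"
    using a mult_right_mono[of "real n" "96 * real a" "s\<^sup>2"] by simp
  moreover have "real n ^ 3 * v\<^sup>2 \<le> 884736 * (real a ^ 3 * v\<^sup>2)"
    using a mult_right_mono[OF power_mono[of "real n" "96 * real a" 3], of "v\<^sup>2"] by (simp add: power_mult_distrib)
  moreover have "real n * s\<^sup>2 / 10 ^ 8 \<le> real n * s\<^sup>2 / 18432" "real n ^ 3 * v\<^sup>2 / 10 ^ 8 \<le> real n ^ 3 * v\<^sup>2 / 28311552"
    by (auto intro!: divide_left_mono)
  ultimately have "(real n * s\<^sup>2 + real n ^ 3 * v\<^sup>2) / 10 ^ 8 \<le> (\<Sum>j<n. 1 - cos (s + real j * v))"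
    using low unfolding add_divide_distrib by linarith
  then show ?thesis ..
qed

lemma exp_minus_le_inverse:
  assumes "0 < k" "0 \<le> (x::real)"
  shows "exp (- (k * x)) \<le> (1 / min k 1) / (1 + x)"
proof -
  have "min k 1 * (1 + x) \<le> 1 + k * x"
    using assms mult_right_mono[of "min k 1" k x] by (simp add: distrib_left)
  also have "\<dots> \<le> exp (k * x)" by (rule exp_ge_add_one_self)
  finally have "1 / exp (k * x) \<le> 1 / (min k 1 * (1 + x))"
    using assms by (intro divide_left_mono) auto
  then show ?thesis by (simp add: exp_minus inverse_eq_divide)
qed

lemma exp_minus_le_fourth_power:
  assumes "0 < k" "0 \<le> (x::real)"
  shows "exp (- (k * x)) \<le> (4 / min k 4) ^ 4 / (1 + x) ^ 4"
proof -
  have "exp (- (k / 4 * x)) \<le> (1 / min (k / 4) 1) / (1 + x)"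
    using assms by (intro exp_minus_le_inverse) auto
  also have "1 / min (k / 4) 1 = 4 / min k 4" by (simp add: min_def)
  finally have "exp (- (k / 4 * x)) ^ 4 \<le> (4 / min k 4 / (1 + x)) ^ 4"
    by (intro power_mono) auto
  moreover have "exp (- (k / 4 * x)) ^ 4 = exp (- (k * x))"
    by (simp add: exp_of_nat_mult[symmetric])
  ultimately show ?thesis by (simp add: power_divide power_mult_distrib)
qed

text \<open>
  In the first case of \<open>sum_one_minus_cos_ge\<close> the left-hand side is exponentially small in \<open>n\<close> and beats
  the polynomial \<open>(1 + n \<pi>\<^sup>2) (1 + n\<^sup>3 \<pi>\<^sup>2)\<close>; in the second case it is a product of two Gaussians.
  Blocks of fewer than 96 increments only affect the constant.
\<close>

lemma exp_sum_cos_bound: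
  assumes "0 < c"
  shows "\<exists>C>0. \<forall>n s v. \<bar>s\<bar> \<le> pi \<longrightarrow> \<bar>v\<bar> \<le> pi \<longrightarrow>
    exp (- (c * (\<Sum>j<n. 1 - cos (s + real j * v)))) \<le> C / ((1 + real n * s\<^sup>2) * (1 + real n ^ 3 * v\<^sup>2))"
proof -
  define k where "k = c / 10 ^ 8"
  define C1 where "C1 = (97 * pi\<^sup>2) * (97 ^ 3 * pi\<^sup>2)"
  define C2 where "C2 = (4 / min (c / 2) 4) ^ 4 * (pi\<^sup>2 * pi\<^sup>2)"
  define C3 where "C3 = (1 / min k 1) * (1 / min k 1)"
  have pos: "0 < k" "0 < C1" "0 < C2" "0 < C3" using assms by (auto simp: k_def C1_def C2_def C3_def)
  have pi1: "1 \<le> pi\<^sup>2"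
    using pi_gt3 by (intro one_le_power) simp
  have nn: "(1 + real n * s\<^sup>2) \<le> (1 + real n) * pi\<^sup>2" "(1 + real n ^ 3 * v\<^sup>2) \<le> (1 + real n) ^ 3 * pi\<^sup>2"
    if "\<bar>s\<bar> \<le> pi" "\<bar>v\<bar> \<le> pi" for n s v
  proof -
    have sv: "s\<^sup>2 \<le> pi\<^sup>2" "v\<^sup>2 \<le> pi\<^sup>2"
      using that power_mono[of "\<bar>s\<bar>" pi 2] power_mono[of "\<bar>v\<bar>" pi 2] by auto
    have "1 + real n * s\<^sup>2 \<le> pi\<^sup>2 + real n * pi\<^sup>2"
      using pi1 sv by (intro add_mono mult_left_mono) auto
    then show "(1 + real n * s\<^sup>2) \<le> (1 + real n) * pi\<^sup>2" by (simp add: algebra_simps)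
    have "1 + real n ^ 3 * v\<^sup>2 \<le> pi\<^sup>2 + real n ^ 3 * pi\<^sup>2"
      using pi1 sv by (intro add_mono mult_left_mono) auto
    also have "\<dots> = (1 + real n ^ 3) * pi\<^sup>2" by (simp add: algebra_simps)
    also have "\<dots> \<le> (1 + real n) ^ 3 * pi\<^sup>2"
      by (intro mult_right_mono) (simp_all add: power3_eq_cube algebra_simps)
    finally show "(1 + real n ^ 3 * v\<^sup>2) \<le> (1 + real n) ^ 3 * pi\<^sup>2" .
  qed
  have "exp (- (c * (\<Sum>j<n. 1 - cos (s + real j * v)))) \<le> (C1 + C2 + C3) / ((1 + real n * s\<^sup>2) * (1 + real n ^ 3 * v\<^sup>2))"
    if sv: "\<bar>s\<bar> \<le> pi" "\<bar>v\<bar> \<le> pi" for n s v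
  proof -
    define D where "D = (1 + real n * s\<^sup>2) * (1 + real n ^ 3 * v\<^sup>2)"
    define S where "S = (\<Sum>j<n. 1 - cos (s + real j * v))"
    have D: "0 < D" unfolding D_def by (intro mult_pos_pos add_pos_nonneg) auto
    have D2: "D \<le> ((1 + real n) * pi\<^sup>2) * ((1 + real n) ^ 3 * pi\<^sup>2)"
      unfolding D_def using nn[OF sv, of n] by (intro mult_mono) auto
    have "exp (- (c * S)) \<le> C1 / D \<or> exp (- (c * S)) \<le> C2 / D \<or> exp (- (c * S)) \<le> C3 / D"
    proof (cases "96 \<le> n")
      case False
      have "0 \<le> S" unfolding S_def by (intro sum_nonneg) simp
      then have "exp (- (c * S)) \<le> 1" using assms by simp
      also have "D \<le> C1"
        unfolding C1_def using False by (intro order_trans[OF D2] mult_mono power_mono) auto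
      then have "1 \<le> C1 / D" using D by simp
      finally show ?thesis by simp
    next
      case n: True
      from sum_one_minus_cos_ge[OF sv n] show ?thesis
      proof
        assume "real n / 2 \<le> (\<Sum>j<n. 1 - cos (s + real j * v))"
        then have "c / 2 * real n \<le> c * S" using assms by (simp add: S_def)
        then have "exp (- (c * S)) \<le> exp (- (c / 2 * real n))" by simp
        also have "\<dots> \<le> (4 / min (c / 2) 4) ^ 4 / (1 + real n) ^ 4"
          using assms by (intro exp_minus_le_fourth_power) auto
        also have "\<dots> = C2 / (((1 + real n) * pi\<^sup>2) * ((1 + real n) ^ 3 * pi\<^sup>2))"
          by (simp add: C2_def power4_eq_xxxx power3_eq_cube power2_eq_square)
        also have "\<dots> \<le> C2 / D"
          using D D2 pos by (intro divide_left_mono) auto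
        finally show ?thesis by simp
      next
        assume "(real n * s\<^sup>2 + real n ^ 3 * v\<^sup>2) / 10 ^ 8 \<le> (\<Sum>j<n. 1 - cos (s + real j * v))"
        then have "c * ((real n * s\<^sup>2 + real n ^ 3 * v\<^sup>2) / 10 ^ 8) \<le> c * S"
          unfolding S_def using assms by (intro mult_left_mono) auto
        then have "exp (- (c * S)) \<le> exp (- (k * (real n * s\<^sup>2)) + - (k * (real n ^ 3 * v\<^sup>2)))"
          by (simp add: k_def algebra_simps add_divide_distrib)
        also have "\<dots> = exp (- (k * (real n * s\<^sup>2))) * exp (- (k * (real n ^ 3 * v\<^sup>2)))"
          by (rule exp_add)
        also have "\<dots> \<le> ((1 / min k 1) / (1 + real n * s\<^sup>2)) * ((1 / min k 1) / (1 + real n ^ 3 * v\<^sup>2))"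
          using pos by (intro mult_mono exp_minus_le_inverse) auto
        also have "\<dots> = C3 / D" by (simp add: C3_def D_def)
        finally show ?thesis by simp
      qed
    qed
    moreover have "C1 / D \<le> (C1 + C2 + C3) / D" "C2 / D \<le> (C1 + C2 + C3) / D" "C3 / D \<le> (C1 + C2 + C3) / D"
      using D pos by (auto intro!: divide_right_mono)
    ultimately show ?thesis unfolding D_def S_def by linarith
  qed
  moreover have "0 < C1 + C2 + C3" using pos by simp
  ultimately show ?thesis by blast
qed

lemma block_chf_bound:
  "\<exists>C>0. \<forall>m n \<tau> s v. (\<forall>j\<in>{m..<m+n}. \<bar>\<tau> j\<bar> < \<beta> / 2) \<longrightarrow> \<bar>s\<bar> \<le> pi \<longrightarrow> \<bar>v\<bar> \<le> pi \<longrightarrow>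
    norm (block_chf m n \<tau> s v) \<le> C / ((1 + real n * s\<^sup>2) * (1 + real n ^ 3 * v\<^sup>2))"
proof -
  define c where "c = 2 * exp (- \<beta>) / 5"
  have "0 < c" by (simp add: c_def)
  from exp_sum_cos_bound[OF this] obtain C where C: "C > 0" "\<And>n s v. \<bar>s\<bar> \<le> pi \<Longrightarrow> \<bar>v\<bar> \<le> pi \<Longrightarrow>
    exp (- (c * (\<Sum>j<n. 1 - cos (s + real j * v)))) \<le> C / ((1 + real n * s\<^sup>2) * (1 + real n ^ 3 * v\<^sup>2))"
    by blast
  have "norm (block_chf m n \<tau> s v) \<le> C / ((1 + real n * s\<^sup>2) * (1 + real n ^ 3 * v\<^sup>2))"
    if "\<forall>j\<in>{m..<m+n}. \<bar>\<tau> j\<bar> < \<beta> / 2" "\<bar>s\<bar> \<le> pi" "\<bar>v\<bar> \<le> pi" for m n \<tau> s v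
  proof -
    have "norm (block_chf m n \<tau> s v) = (\<Prod>j<n. norm (chf (\<tau> (m + j)) (s + real j * v)))"
      by (simp add: block_chf_def prod_norm)
    also have "\<dots> \<le> (\<Prod>j<n. exp (- c * (1 - cos (s + real j * v))))"
      using that(1) unfolding c_def by (intro prod_mono conjI norm_ge_zero norm_chf_le) auto
    also have "\<dots> = exp (- (c * (\<Sum>j<n. 1 - cos (s + real j * v))))"
      by (simp add: exp_sum[symmetric] sum_distrib_left sum_negf)
    also note C(2)[OF that(2,3), of n]
    finally show ?thesis .
  qed
  with C(1) show ?thesis by blast
qed

lemma integrable_Cauchy: "integrable lborel (\<lambda>x::real. 1 / (1 + x\<^sup>2))"
  and integral_Cauchy: "(\<integral>x. 1 / (1 + x\<^sup>2) \<partial>lborel) = pi"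
  using integrable_inverse_1_plus_square LBINT_inverse_1_plus_square
  by (simp_all add: set_integrable_def interval_lebesgue_integral_def set_lebesgue_integral_def inverse_eq_divide)

text \<open>
  The Cauchy density serves as the dominating function in both variables.
\<close>

lemma Cauchy_dominated:
  fixes F :: "real \<Rightarrow> complex"
  assumes "F \<in> borel_measurable lborel" "\<And>x. norm (F x) \<le> K * (1 / (1 + x\<^sup>2))"
  shows "integrable lborel F" "norm (\<integral>x. F x \<partial>lborel) \<le> K * pi"
proof -
  have i: "integrable lborel (\<lambda>x. K * (1 / (1 + x\<^sup>2)))"
    by (intro integrable_mult_right integrable_Cauchy)
  show I: "integrable lborel F"
    by (rule Bochner_Integration.integrable_bound[OF i assms(1)])
      (use assms(2) in \<open>auto intro!: AE_I2 order_trans[OF _ abs_ge_self] simp del: times_divide_eq_right\<close>)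
  have "norm (\<integral>x. F x \<partial>lborel) \<le> (\<integral>x. K * (1 / (1 + x\<^sup>2)) \<partial>lborel)"
    by (rule Bochner_Integration.integral_norm_bound_integral[OF I i assms(2)])
  then show "norm (\<integral>x. F x \<partial>lborel) \<le> K * pi"
    by (simp only: integral_mult_right_zero integral_Cauchy)
qed

lemma norm_scaled_integrand_le:
  "\<exists>C>0. \<forall>m n \<tau> x a \<sigma> \<nu>. (\<forall>j\<in>{m..<m+n}. \<bar>\<tau> j\<bar> < \<beta> / 2) \<longrightarrow> 0 < n \<longrightarrow>
    norm (scaled_integrand m n \<tau> x a \<sigma> \<nu>) \<le> C * (1 / (1 + \<sigma>\<^sup>2)) * (1 / (1 + \<nu>\<^sup>2))"
proof -
  obtain C where C: "C > 0" "\<And>m n \<tau> s v. (\<forall>j\<in>{m..<m+n}. \<bar>\<tau> j\<bar> < \<beta> / 2) \<Longrightarrow> \<bar>s\<bar> \<le> pi \<Longrightarrow> \<bar>v\<bar> \<le> pi \<Longrightarrow>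
    norm (block_chf m n \<tau> s v) \<le> C / ((1 + real n * s\<^sup>2) * (1 + real n ^ 3 * v\<^sup>2))"
    using block_chf_bound by blast
  have "norm (scaled_integrand m n \<tau> x a \<sigma> \<nu>) \<le> C * (1 / (1 + \<sigma>\<^sup>2)) * (1 / (1 + \<nu>\<^sup>2))"
    if "\<forall>j\<in>{m..<m+n}. \<bar>\<tau> j\<bar> < \<beta> / 2" "0 < n" for m n \<tau> x a \<sigma> \<nu>
  proof (cases "\<bar>\<sigma> / sqrt n\<bar> \<le> pi \<and> \<bar>\<nu> / (real n * sqrt n)\<bar> \<le> pi")
    case True
    have "norm (scaled_integrand m n \<tau> x a \<sigma> \<nu>) \<le> norm (block_chf m n \<tau> (\<sigma> / sqrt n) (\<nu> / (real n * sqrt n)))"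
      by (auto simp: scaled_integrand_def norm_mult indicator_def)
    also have "\<dots> \<le> C / ((1 + real n * (\<sigma> / sqrt n)\<^sup>2) * (1 + real n ^ 3 * (\<nu> / (real n * sqrt n))\<^sup>2))"
      using True that by (intro C) auto
    also have "real n * (\<sigma> / sqrt n)\<^sup>2 = \<sigma>\<^sup>2"
      using that by (simp add: power_divide)
    also have "real n ^ 3 * (\<nu> / (real n * sqrt n))\<^sup>2 = \<nu>\<^sup>2"
      using that by (simp add: power_divide power_mult_distrib power3_eq_cube power2_eq_square)
    finally show ?thesis by simp
  next
    case False
    then have "scaled_integrand m n \<tau> x a \<sigma> \<nu> = 0"
      by (auto simp: scaled_integrand_def indicator_def abs_le_iff)
    then show ?thesis using C(1) by simp
  qed
  with C(1) show ?thesis by blast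
qed

text \<open>
  Integrating the dominating function gives a bound that is uniform in the tilts and in the target
  point.
\<close>

lemma hit_le:
  "\<exists>C>0. \<forall>m n \<tau> x a. (\<forall>j\<in>{m..<m+n}. \<bar>\<tau> j\<bar> < \<beta> / 2) \<longrightarrow> 0 < n \<longrightarrow> hit m n \<tau> x a \<le> C / (real n)\<^sup>2"
proof -
  obtain C where C: "C > 0" "\<And>m n \<tau> x a \<sigma> \<nu>. (\<forall>j\<in>{m..<m+n}. \<bar>\<tau> j\<bar> < \<beta> / 2) \<Longrightarrow> 0 < n \<Longrightarrow>
    norm (scaled_integrand m n \<tau> x a \<sigma> \<nu>) \<le> C * (1 / (1 + \<sigma>\<^sup>2)) * (1 / (1 + \<nu>\<^sup>2))"
    using norm_scaled_integrand_le by blast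
  have "hit m n \<tau> x a \<le> C / (real n)\<^sup>2" if "\<forall>j\<in>{m..<m+n}. \<bar>\<tau> j\<bar> < \<beta> / 2" "0 < n" for m n \<tau> x a
  proof -
    have "norm (\<integral>\<nu>. scaled_integrand m n \<tau> x a \<sigma> \<nu> \<partial>lborel) \<le> C * (1 / (1 + \<sigma>\<^sup>2)) * pi" for \<sigma>
      by (rule Cauchy_dominated(2)[OF _ C(2)[OF that]]) measurable
    then have inner: "norm (\<integral>\<nu>. scaled_integrand m n \<tau> x a \<sigma> \<nu> \<partial>lborel) \<le> C * pi * (1 / (1 + \<sigma>\<^sup>2))" for \<sigma>
      by (simp only: mult_ac)
    have I: "norm (\<integral>\<sigma>. \<integral>\<nu>. scaled_integrand m n \<tau> x a \<sigma> \<nu> \<partial>lborel \<partial>lborel) \<le> C * pi * pi"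
      by (rule Cauchy_dominated(2)[OF _ inner])
        (auto intro!: lborel.borel_measurable_lebesgue_integral simp: split_beta')
    have "(real n)\<^sup>2 * hit m n \<tau> x a \<le> norm (complex_of_real ((real n)\<^sup>2 * hit m n \<tau> x a))"
      by (simp only: norm_of_real abs_ge_self)
    also have "\<dots> \<le> (1 / (2 * pi)\<^sup>2) * (C * pi * pi)"
      using that I by (subst hit_eq_integral) (auto simp: field_simps)
    also have "\<dots> = C / 4" by (simp add: power2_eq_square)
    finally show ?thesis using that C(1) by (simp add: field_simps)
  qed
  with C(1) show ?thesis by blast
qed

end


section \<open>The local limit theorem\<close>

lemma integral_gaussian:
  assumes "0 < (a::real)"
  shows "integrable lborel (\<lambda>x. exp (- (a * (x - \<mu>)\<^sup>2 / 2)))"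
    and "(\<integral>x. exp (- (a * (x - \<mu>)\<^sup>2 / 2)) \<partial>lborel) = sqrt (2 * pi / a)"
proof -
  have *: "exp (- (a * (x - \<mu>)\<^sup>2 / 2)) = sqrt (2 * pi / a) * normal_density \<mu> (1 / sqrt a) x" for x
    using assms by (simp add: normal_density_def power_divide real_sqrt_divide real_sqrt_mult)
  show "integrable lborel (\<lambda>x. exp (- (a * (x - \<mu>)\<^sup>2 / 2)))"
    unfolding * using assms by (intro integrable_mult_right integrable_normal_density) auto
  show "(\<integral>x. exp (- (a * (x - \<mu>)\<^sup>2 / 2)) \<partial>lborel) = sqrt (2 * pi / a)"
    unfolding * using assms by (simp add: integral_normal_density)
qed

text \<open>
  Completing the square in \<open>\<nu>\<close> leaves two one-dimensional Gaussian integrals.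
\<close>

lemma integral_gaussian_2:
  fixes a b c :: real
  assumes "0 < c" "b\<^sup>2 < a * c"
  shows "(\<integral>\<sigma>. \<integral>\<nu>. exp (- ((\<sigma>\<^sup>2 * a + 2 * \<sigma> * \<nu> * b + \<nu>\<^sup>2 * c) / 2)) \<partial>lborel \<partial>lborel) = 2 * pi / sqrt (a * c - b\<^sup>2)"
proof -
  define d where "d = a - b\<^sup>2 / c"
  have d: "0 < d" "c * d = a * c - b\<^sup>2" using assms by (auto simp: d_def field_simps)
  have "exp (- ((\<sigma>\<^sup>2 * a + 2 * \<sigma> * \<nu> * b + \<nu>\<^sup>2 * c) / 2))
      = exp (- (d * (\<sigma> - 0)\<^sup>2 / 2)) * exp (- (c * (\<nu> - (- \<sigma> * b / c))\<^sup>2 / 2))" for \<sigma> \<nu>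
    unfolding exp_add[symmetric] using assms(1)
    by (simp add: d_def) (simp add: field_simps power2_eq_square)
  then have "(\<integral>\<sigma>. \<integral>\<nu>. exp (- ((\<sigma>\<^sup>2 * a + 2 * \<sigma> * \<nu> * b + \<nu>\<^sup>2 * c) / 2)) \<partial>lborel \<partial>lborel)
      = (\<integral>\<sigma>. exp (- (d * (\<sigma> - 0)\<^sup>2 / 2)) * sqrt (2 * pi / c) \<partial>lborel)"
    by (simp only: integral_mult_right_zero integral_gaussian(2)[OF assms(1)])
  also have "\<dots> = sqrt (2 * pi / d) * sqrt (2 * pi / c)"
    by (simp only: integral_mult_left_zero integral_gaussian(2)[OF d(1)])
  also have "\<dots> = sqrt ((2 * pi)\<^sup>2 / (a * c - b\<^sup>2))"
    unfolding d(2)[symmetric] by (simp add: real_sqrt_mult[symmetric] power2_eq_square mult.commute)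
  also have "\<dots> = 2 * pi / sqrt (a * c - b\<^sup>2)"
    by (simp only: real_sqrt_divide real_sqrt_abs) simp
  finally show ?thesis .
qed

context laplace_walk begin

text \<open>
  In the rescaled variables every phase is \<open>O(n\<^bsup>-1/2\<^esup>)\<close>, so the \<open>n\<close> cubic errors add up to \<open>O(n\<^bsup>-1/2\<^esup>)\<close>.
\<close>

lemma block_chf_Taylor:
  fixes \<sigma> \<nu> :: real
  assumes "\<And>j. j \<in> {m..<m+n} \<Longrightarrow> \<bar>\<tau> j\<bar> \<le> T" "T < \<beta> / 2" "0 < n"
  defines "u \<equiv> \<lambda>j. \<sigma> / sqrt n + real j * (\<nu> / (real n * sqrt n))"
  shows "\<exists>R. block_chf m n \<tau> (\<sigma> / sqrt n) (\<nu> / (real n * sqrt n))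
      = exp (\<i> * of_real (\<Sum>j<n. u j * cum1 (\<tau> (m + j))) - of_real ((\<Sum>j<n. (u j)\<^sup>2 * cum2 (\<tau> (m + j))) / 2) + R)
    \<and> norm R \<le> cgf_bound T * (\<bar>\<sigma>\<bar> + \<bar>\<nu>\<bar>) ^ 3 / sqrt n"
proof -
  have "\<forall>j\<in>{..<n}. \<exists>R. chf (\<tau> (m + j)) (u j) = exp (\<i> * of_real (u j * cum1 (\<tau> (m + j))) - of_real ((u j)\<^sup>2 / 2 * cum2 (\<tau> (m + j))) + R)
     \<and> norm R \<le> cgf_bound T * \<bar>u j\<bar> ^ 3"
    using assms(1,2) by (intro ballI chf_Taylor) auto
  then obtain R where R: "\<And>j. j < n \<Longrightarrow> chf (\<tau> (m + j)) (u j) = exp (\<i> * of_real (u j * cum1 (\<tau> (m + j))) - of_real ((u j)\<^sup>2 / 2 * cum2 (\<tau> (m + j))) + R j)"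
     "\<And>j. j < n \<Longrightarrow> norm (R j) \<le> cgf_bound T * \<bar>u j\<bar> ^ 3"
    by (metis lessThan_iff)
  have B: "0 < cgf_bound T" using assms(2) by (rule cgf_bound_pos)
  have "block_chf m n \<tau> (\<sigma> / sqrt n) (\<nu> / (real n * sqrt n)) = (\<Prod>j<n. exp (\<i> * of_real (u j * cum1 (\<tau> (m + j))) - of_real ((u j)\<^sup>2 / 2 * cum2 (\<tau> (m + j))) + R j))"
    unfolding block_chf_def by (intro prod.cong refl) (use R(1) in \<open>auto simp: u_def\<close>)
  also have "\<dots> = exp (\<i> * of_real (\<Sum>j<n. u j * cum1 (\<tau> (m + j))) - of_real ((\<Sum>j<n. (u j)\<^sup>2 * cum2 (\<tau> (m + j))) / 2) + (\<Sum>j<n. R j))"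
    by (simp add: exp_sum[symmetric] sum.distrib sum_subtractf sum_distrib_left sum_divide_distrib)
  finally have 1: "block_chf m n \<tau> (\<sigma> / sqrt n) (\<nu> / (real n * sqrt n)) = \<dots>" .
  have uj: "\<bar>u j\<bar> \<le> (\<bar>\<sigma>\<bar> + \<bar>\<nu>\<bar>) / sqrt n" if "j < n" for j
  proof -
    have "\<bar>u j\<bar> \<le> \<bar>\<sigma>\<bar> / sqrt n + (real j / real n) * (\<bar>\<nu>\<bar> / sqrt n)"
      unfolding u_def by (rule order_trans[OF abs_triangle_ineq]) (simp add: abs_mult)
    also have "\<dots> \<le> \<bar>\<sigma>\<bar> / sqrt n + 1 * (\<bar>\<nu>\<bar> / sqrt n)"
      using that by (intro add_left_mono mult_right_mono) auto
    finally show ?thesis by (simp add: add_divide_distrib)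
  qed
  have "norm (\<Sum>j<n. R j) \<le> (\<Sum>j<n. cgf_bound T * ((\<bar>\<sigma>\<bar> + \<bar>\<nu>\<bar>) / sqrt n) ^ 3)"
    by (rule sum_norm_le, rule order_trans[OF R(2)])
      (use uj B in \<open>auto intro!: mult_left_mono power_mono\<close>)
  also have "\<dots> = real n * (cgf_bound T * ((\<bar>\<sigma>\<bar> + \<bar>\<nu>\<bar>) / sqrt n) ^ 3)" by simp
  also have "\<dots> = cgf_bound T * (\<bar>\<sigma>\<bar> + \<bar>\<nu>\<bar>) ^ 3 / sqrt n"
  proof -
    have "sqrt n ^ 3 = real n * sqrt n" by (simp add: power3_eq_cube)
    then show ?thesis using assms(3) by (simp add: power_divide)
  qed
  finally show ?thesis using 1 by blast
qed

text \<open>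
  The increments need not be identically distributed and the target may move with \<open>k\<close>: the hypotheses
  \<open>x\<close> and \<open>a\<close> say that it stays within \<open>o(n\<^bsup>1/2\<^esup>)\<close> and \<open>o(n\<^bsup>3/2\<^esup>)\<close> of the means, and \<open>A0\<close>, \<open>A1\<close>, \<open>A2\<close>
  say that the normalised covariances converge.  By the Taylor expansion the rescaled characteristic function converges
  pointwise to that of a centred Gaussian vector, and the product bound allows dominated convergence,
  first in \<open>\<nu>\<close> for fixed \<open>\<sigma>\<close> and then in \<open>\<sigma>\<close>.
\<close>

theorem hit_local_limit:
  fixes n m :: "nat \<Rightarrow> nat" and \<tau> :: "nat \<Rightarrow> nat \<Rightarrow> real" and x a :: "nat \<Rightarrow> int"
  assumes \<tau>: "\<And>k j. j \<in> {m k..<m k + n k} \<Longrightarrow> \<bar>\<tau> k j\<bar> \<le> T" and T: "T < \<beta> / 2"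
    and n: "filterlim n at_top sequentially" and n_pos: "\<And>k. 0 < n k"
    and x: "(\<lambda>k. ((\<Sum>j<n k. cum1 (\<tau> k (m k + j))) - of_int (x k)) / sqrt (n k)) \<longlonglongrightarrow> 0"
    and a: "(\<lambda>k. ((\<Sum>j<n k. real j * cum1 (\<tau> k (m k + j))) - of_int (a k)) / (real (n k) * sqrt (n k))) \<longlonglongrightarrow> 0"
    and A0: "(\<lambda>k. (\<Sum>j<n k. cum2 (\<tau> k (m k + j))) / real (n k)) \<longlonglongrightarrow> A0"
    and A1: "(\<lambda>k. (\<Sum>j<n k. real j / real (n k) * cum2 (\<tau> k (m k + j))) / real (n k)) \<longlonglongrightarrow> A1"
    and A2: "(\<lambda>k. (\<Sum>j<n k. (real j / real (n k))\<^sup>2 * cum2 (\<tau> k (m k + j))) / real (n k)) \<longlonglongrightarrow> A2"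
    and pos: "0 < A2" "A1\<^sup>2 < A0 * A2"
  shows "(\<lambda>k. (real (n k))\<^sup>2 * hit (m k) (n k) (\<tau> k) (x k) (a k)) \<longlonglongrightarrow> 1 / (2 * pi * sqrt (A0 * A2 - A1\<^sup>2))"
proof -
  define F where "F k = scaled_integrand (m k) (n k) (\<tau> k) (x k) (a k)" for k
  define Q where "Q \<sigma> \<nu> = (\<sigma>\<^sup>2 * A0 + 2 * \<sigma> * \<nu> * A1 + \<nu>\<^sup>2 * A2) / 2" for \<sigma> \<nu>
  have sqrt_n: "filterlim (\<lambda>k. sqrt (n k)) at_top sequentially"
    by (rule filterlim_compose[OF sqrt_at_top]) (rule filterlim_compose[OF filterlim_real_sequentially n])
  have inv0: "(\<lambda>k. c / sqrt (n k)) \<longlonglongrightarrow> 0" for c :: real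
    by (rule tendsto_divide_0[OF tendsto_const]) (use filterlim_at_top_imp_at_infinity[OF sqrt_n] in simp)
  have \<tau>': "\<forall>j\<in>{m k..<m k + n k}. \<bar>\<tau> k j\<bar> < \<beta> / 2" for k using \<tau>[of _ k] T by force
  have pointwise: "(\<lambda>k. F k \<sigma> \<nu>) \<longlonglongrightarrow> of_real (exp (- Q \<sigma> \<nu>))" for \<sigma> \<nu>
  proof -
    define u where "u k j = \<sigma> / sqrt (n k) + real j * (\<nu> / (real (n k) * sqrt (n k)))" for k j
    have "\<forall>k. \<exists>R. block_chf (m k) (n k) (\<tau> k) (\<sigma> / sqrt (n k)) (\<nu> / (real (n k) * sqrt (n k)))
      = exp (\<i> * of_real (\<Sum>j<n k. u k j * cum1 (\<tau> k (m k + j))) - of_real ((\<Sum>j<n k. (u k j)\<^sup>2 * cum2 (\<tau> k (m k + j))) / 2) + R)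
      \<and> norm R \<le> cgf_bound T * (\<bar>\<sigma>\<bar> + \<bar>\<nu>\<bar>) ^ 3 / sqrt (n k)"
      unfolding u_def by (intro allI block_chf_Taylor) (use \<tau> T n_pos in auto)
    then obtain R where R: "\<forall>k. block_chf (m k) (n k) (\<tau> k) (\<sigma> / sqrt (n k)) (\<nu> / (real (n k) * sqrt (n k)))
      = exp (\<i> * of_real (\<Sum>j<n k. u k j * cum1 (\<tau> k (m k + j))) - of_real ((\<Sum>j<n k. (u k j)\<^sup>2 * cum2 (\<tau> k (m k + j))) / 2) + R k)
      \<and> norm (R k) \<le> cgf_bound T * (\<bar>\<sigma>\<bar> + \<bar>\<nu>\<bar>) ^ 3 / sqrt (n k)"
      by (rule exE[OF choice])
    note R1 = R[THEN spec, THEN conjunct1] and R2 = R[THEN spec, THEN conjunct2]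
    have R0: "R \<longlonglongrightarrow> 0"
      by (rule Lim_null_comparison[OF _ inv0[of "cgf_bound T * (\<bar>\<sigma>\<bar> + \<bar>\<nu>\<bar>) ^ 3"]]) (intro always_eventually allI R2)
    define \<theta> where "\<theta> k = \<sigma> * (((\<Sum>j<n k. cum1 (\<tau> k (m k + j))) - of_int (x k)) / sqrt (n k))
       + \<nu> * (((\<Sum>j<n k. real j * cum1 (\<tau> k (m k + j))) - of_int (a k)) / (real (n k) * sqrt (n k)))" for k
    have \<theta>0: "\<theta> \<longlonglongrightarrow> 0"
      unfolding \<theta>_def[abs_def] using tendsto_add[OF tendsto_mult_left[OF x, of \<sigma>] tendsto_mult_left[OF a, of \<nu>]] by simp
    define q where "q k = \<sigma>\<^sup>2 * ((\<Sum>j<n k. cum2 (\<tau> k (m k + j))) / real (n k))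
       + 2 * \<sigma> * \<nu> * ((\<Sum>j<n k. real j / real (n k) * cum2 (\<tau> k (m k + j))) / real (n k))
       + \<nu>\<^sup>2 * ((\<Sum>j<n k. (real j / real (n k))\<^sup>2 * cum2 (\<tau> k (m k + j))) / real (n k))" for k
    have q0: "q \<longlonglongrightarrow> 2 * Q \<sigma> \<nu>"
    proof -
      have "q \<longlonglongrightarrow> \<sigma>\<^sup>2 * A0 + 2 * \<sigma> * \<nu> * A1 + \<nu>\<^sup>2 * A2"
        unfolding q_def[abs_def] by (intro tendsto_intros A0 A1 A2)
      moreover have "\<sigma>\<^sup>2 * A0 + 2 * \<sigma> * \<nu> * A1 + \<nu>\<^sup>2 * A2 = 2 * Q \<sigma> \<nu>" by (simp add: Q_def field_simps)
      ultimately show ?thesis by simp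
    qed
    have theta: "(\<Sum>j<n k. u k j * cum1 (\<tau> k (m k + j))) = \<theta> k + (\<sigma> / sqrt (n k) * of_int (x k) + \<nu> / (real (n k) * sqrt (n k)) * of_int (a k))" for k
    proof -
      have "(\<Sum>j<n k. u k j * cum1 (\<tau> k (m k + j))) = \<sigma> / sqrt (n k) * (\<Sum>j<n k. cum1 (\<tau> k (m k + j)))
         + \<nu> / (real (n k) * sqrt (n k)) * (\<Sum>j<n k. real j * cum1 (\<tau> k (m k + j)))"
        unfolding sum_distrib_left sum.distrib[symmetric] by (intro sum.cong refl) (simp add: u_def algebra_simps)
      then show ?thesis unfolding \<theta>_def by (simp add: right_diff_distrib diff_divide_distrib)
    qed
    have qq: "(\<Sum>j<n k. (u k j)\<^sup>2 * cum2 (\<tau> k (m k + j))) = q k" for k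
    proof -
      have "(u k j)\<^sup>2 = (\<sigma>\<^sup>2 + 2 * \<sigma> * \<nu> * (real j / real (n k)) + \<nu>\<^sup>2 * (real j / real (n k))\<^sup>2) / real (n k)" for j
      proof -
        have "u k j = (\<sigma> + \<nu> * (real j / real (n k))) / sqrt (n k)"
          using n_pos[of k] by (simp add: u_def field_simps)
        then show ?thesis by (simp add: power_divide power2_sum power_mult_distrib algebra_simps)
      qed
      then have "(u k j)\<^sup>2 * cum2 (\<tau> k (m k + j)) = \<sigma>\<^sup>2 * (cum2 (\<tau> k (m k + j)) / real (n k))
         + 2 * \<sigma> * \<nu> * (real j / real (n k) * cum2 (\<tau> k (m k + j)) / real (n k))
         + \<nu>\<^sup>2 * ((real j / real (n k))\<^sup>2 * cum2 (\<tau> k (m k + j)) / real (n k))" for j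
        by (simp add: algebra_simps add_divide_distrib)
      then show ?thesis
        by (simp only: q_def sum_divide_distrib sum_distrib_left sum.distrib)
    qed
    have G: "(\<lambda>k. exp (\<i> * of_real (\<theta> k) - of_real (q k / 2) + R k)) \<longlonglongrightarrow> exp (\<i> * of_real 0 - of_real (2 * Q \<sigma> \<nu> / 2) + 0)"
      by (intro tendsto_intros \<theta>0 q0 R0) auto
    have ev: "\<forall>\<^sub>F k in sequentially. exp (\<i> * of_real (\<theta> k) - of_real (q k / 2) + R k) = F k \<sigma> \<nu>"
    proof -
      have "\<forall>\<^sub>F k in sequentially. \<bar>\<sigma>\<bar> + \<bar>\<nu>\<bar> \<le> sqrt (n k)"
        using sqrt_n by (simp add: filterlim_at_top)
      then show ?thesis
      proof eventually_elim
        case (elim k)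
        have sn: "0 < sqrt (n k)" "1 \<le> real (n k)" using n_pos[of k] by auto
        have "\<bar>\<sigma>\<bar> \<le> pi * sqrt (n k)"
          using elim sn mult_right_mono[of 1 pi "sqrt (n k)"] pi_gt3 by linarith
        then have s1: "\<bar>\<sigma> / sqrt (n k)\<bar> \<le> pi" using sn by (simp add: field_simps)
        have "\<bar>\<nu>\<bar> \<le> pi * (real (n k) * sqrt (n k))"
        proof -
          have "1 * sqrt (n k) \<le> (pi * real (n k)) * sqrt (n k)"
            using sn pi_gt3 mult_mono[of 1 pi 1 "real (n k)"] by (intro mult_right_mono) auto
          then show ?thesis using elim by (simp add: mult.assoc)
        qed
        then have s2: "\<bar>\<nu> / (real (n k) * sqrt (n k))\<bar> \<le> pi" using sn by (simp add: abs_mult field_simps)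
        have "F k \<sigma> \<nu> = block_chf (m k) (n k) (\<tau> k) (\<sigma> / sqrt (n k)) (\<nu> / (real (n k) * sqrt (n k)))
            * cis (- (\<sigma> / sqrt (n k) * of_int (x k) + \<nu> / (real (n k) * sqrt (n k)) * of_int (a k)))"
        proof -
          have "\<sigma> / sqrt (n k) \<in> {-pi..pi}" "\<nu> / (real (n k) * sqrt (n k)) \<in> {-pi..pi}"
            using s1 s2 unfolding abs_le_iff atLeastAtMost_iff by linarith+
          then show ?thesis unfolding F_def scaled_integrand_def by (simp only: indicator_simps scaleR_one)
        qed
        also have "\<dots> = exp (\<i> * of_real (\<theta> k) - of_real (q k / 2) + R k)"
          unfolding R1 theta qq cis_conv_exp exp_add[symmetric] by (simp add: algebra_simps)
        finally show ?case by simp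
      qed
    qed
    have "(\<lambda>k. F k \<sigma> \<nu>) \<longlonglongrightarrow> exp (\<i> * of_real 0 - of_real (2 * Q \<sigma> \<nu> / 2) + 0)"
      by (rule Lim_transform_eventually[OF G ev])
    then show ?thesis by (simp add: exp_of_real[symmetric])
  qed
  obtain C where C: "C > 0" "\<And>k \<sigma> \<nu>. norm (F k \<sigma> \<nu>) \<le> C * (1 / (1 + \<sigma>\<^sup>2)) * (1 / (1 + \<nu>\<^sup>2))"
    unfolding F_def using norm_scaled_integrand_le \<tau>' n_pos by metis
  have F_meas: "F k \<sigma> \<in> borel_measurable lborel" for k \<sigma>
    unfolding F_def by measurable
  have inner: "(\<lambda>k. \<integral>\<nu>. F k \<sigma> \<nu> \<partial>lborel) \<longlonglongrightarrow> (\<integral>\<nu>. of_real (exp (- Q \<sigma> \<nu>)) \<partial>lborel)" for \<sigma>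
    by (rule integral_dominated_convergence[where w = "\<lambda>\<nu>. C * (1 / (1 + \<sigma>\<^sup>2)) * (1 / (1 + \<nu>\<^sup>2))"])
      (use pointwise C(2) F_meas in \<open>auto simp: Q_def intro!: integrable_mult_right integrable_Cauchy simp del: times_divide_eq_right times_divide_eq_left\<close>)
  have "norm (\<integral>\<nu>. F k \<sigma> \<nu> \<partial>lborel) \<le> C * (1 / (1 + \<sigma>\<^sup>2)) * pi" for k \<sigma>
    by (rule Cauchy_dominated(2)[OF F_meas C(2)])
  then have inner_bound: "norm (\<integral>\<nu>. F k \<sigma> \<nu> \<partial>lborel) \<le> C * pi * (1 / (1 + \<sigma>\<^sup>2))" for k \<sigma>
    by (simp only: mult_ac)
  have outer: "(\<lambda>k. \<integral>\<sigma>. \<integral>\<nu>. F k \<sigma> \<nu> \<partial>lborel \<partial>lborel) \<longlonglongrightarrow> (\<integral>\<sigma>. \<integral>\<nu>. complex_of_real (exp (- Q \<sigma> \<nu>)) \<partial>lborel \<partial>lborel)"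
  proof (rule integral_dominated_convergence[where w = "\<lambda>\<sigma>. C * pi * (1 / (1 + \<sigma>\<^sup>2))"])
    show "(\<lambda>\<sigma>. \<integral>\<nu>. complex_of_real (exp (- Q \<sigma> \<nu>)) \<partial>lborel) \<in> borel_measurable lborel"
      unfolding Q_def by (rule lborel.borel_measurable_lebesgue_integral) measurable
    show "(\<lambda>\<sigma>. \<integral>\<nu>. F k \<sigma> \<nu> \<partial>lborel) \<in> borel_measurable lborel" for k
      unfolding F_def by (rule lborel.borel_measurable_lebesgue_integral) (simp add: split_beta')
    show "integrable lborel (\<lambda>\<sigma>. C * pi * (1 / (1 + \<sigma>\<^sup>2)))"
      by (intro integrable_mult_right integrable_Cauchy)
  qed (use inner inner_bound in \<open>auto simp del: times_divide_eq_right times_divide_eq_left\<close>)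
  have "(\<integral>\<sigma>. \<integral>\<nu>. complex_of_real (exp (- Q \<sigma> \<nu>)) \<partial>lborel \<partial>lborel) = of_real (\<integral>\<sigma>. \<integral>\<nu>. exp (- Q \<sigma> \<nu>) \<partial>lborel \<partial>lborel)"
    by (simp only: integral_complex_of_real)
  also have "(\<integral>\<sigma>. \<integral>\<nu>. exp (- Q \<sigma> \<nu>) \<partial>lborel \<partial>lborel) = 2 * pi / sqrt (A0 * A2 - A1\<^sup>2)"
    unfolding Q_def by (rule integral_gaussian_2[OF pos])
  finally have "(\<lambda>k. (1 / (2 * pi)\<^sup>2) *\<^sub>R (\<integral>\<sigma>. \<integral>\<nu>. F k \<sigma> \<nu> \<partial>lborel \<partial>lborel)) \<longlonglongrightarrow> (1 / (2 * pi)\<^sup>2) *\<^sub>R of_real (2 * pi / sqrt (A0 * A2 - A1\<^sup>2))"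
    using outer by (intro tendsto_scaleR tendsto_const) simp
  moreover have "(1 / (2 * pi)\<^sup>2) *\<^sub>R complex_of_real (2 * pi / sqrt (A0 * A2 - A1\<^sup>2)) = of_real (1 / (2 * pi * sqrt (A0 * A2 - A1\<^sup>2)))"
    by (simp add: scaleR_conv_of_real power2_eq_square)
  moreover have "(1 / (2 * pi)\<^sup>2) *\<^sub>R (\<integral>\<sigma>. \<integral>\<nu>. F k \<sigma> \<nu> \<partial>lborel \<partial>lborel) = complex_of_real ((real (n k))\<^sup>2 * hit (m k) (n k) (\<tau> k) (x k) (a k))" for k
    unfolding F_def using \<tau>' n_pos by (subst hit_eq_integral) auto
  ultimately have "(\<lambda>k. complex_of_real ((real (n k))\<^sup>2 * hit (m k) (n k) (\<tau> k) (x k) (a k))) \<longlonglongrightarrow> of_real (1 / (2 * pi * sqrt (A0 * A2 - A1\<^sup>2)))"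
    by simp
  then show ?thesis by (simp only: tendsto_of_real_iff)
qed

end


section \<open>Finite products of probability mass functions\<close>

lemma prob_pair_pmf:
  "measure_pmf.prob (pair_pmf M N) S = measure_pmf.expectation M (\<lambda>x. measure_pmf.prob N {y. (x, y) \<in> S})"
proof -
  have "pair_pmf M N = bind_pmf M (\<lambda>x. map_pmf (Pair x) N)"
    by (simp add: pair_pmf_def map_pmf_def)
  then have "ennreal (measure_pmf.prob (pair_pmf M N) S) = (\<integral>\<^sup>+x. emeasure (map_pmf (Pair x) N) S \<partial>M)"
    by (simp only: measure_pmf.emeasure_eq_measure[symmetric] emeasure_bind_pmf)
  also have "\<dots> = (\<integral>\<^sup>+x. ennreal (measure_pmf.prob N {y. (x, y) \<in> S}) \<partial>M)"
    by (intro nn_integral_cong) (simp add: measure_pmf.emeasure_eq_measure vimage_def)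
  also have "\<dots> = ennreal (measure_pmf.expectation M (\<lambda>x. measure_pmf.prob N {y. (x, y) \<in> S}))"
    by (intro nn_integral_eq_integral measure_pmf.integrable_const_bound[where B = 1]) auto
  finally show ?thesis by (simp add: integral_nonneg_AE)
qed

lemma prob_Pi_pmf_Un:
  assumes "finite A" "finite B" "A \<inter> B = {}"
  shows "measure_pmf.prob (Pi_pmf (A \<union> B) d p) {\<xi>. \<Phi> \<xi>}
    = measure_pmf.expectation (Pi_pmf A d p) (\<lambda>\<xi>. measure_pmf.prob (Pi_pmf B d p) {\<eta>. \<Phi> (\<lambda>i. if i \<in> A then \<xi> i else \<eta> i)})"
  unfolding Pi_pmf_union[OF assms] measure_map_pmf prob_pair_pmf by (simp add: vimage_def)

text \<open>
  Relabelling the index set and applying an injective map in each coordinate; it is used below to read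
  the last increments of the walk backwards with the opposite sign.
\<close>

lemma Pi_pmf_reindex:
  fixes s :: "'i \<Rightarrow> 'b \<Rightarrow> 'c"
  assumes fin: "finite A" and bij: "bij_betw \<phi> A B" and s: "\<And>i. inj (s i)"
  shows "Pi_pmf A d' (\<lambda>j. map_pmf (s j) (p (\<phi> j)))
    = map_pmf (\<lambda>w j. if j \<in> A then s j (w (\<phi> j)) else d') (Pi_pmf B d p)"
proof (rule pmf_eqI)
  fix \<xi> :: "'i \<Rightarrow> 'c"
  define f where "f w j = (if j \<in> A then s j (w (\<phi> j)) else d')" for w j
  have finB: "finite B" using fin bij bij_betw_finite by blast
  have inj: "inj_on f (set_pmf (Pi_pmf B d p))"
  proof (rule inj_onI)
    fix w w' assume w: "w \<in> set_pmf (Pi_pmf B d p)" "w' \<in> set_pmf (Pi_pmf B d p)" "f w = f w'"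
    have "w i = w' i" if "i \<in> B" for i
    proof -
      obtain j where j: "j \<in> A" "i = \<phi> j" using \<open>i \<in> B\<close> bij_betw_imp_surj_on[OF bij] by blast
      then have "s j (w i) = s j (w' i)" using fun_cong[OF w(3), of j] by (simp add: f_def)
      then show ?thesis using s by (simp add: inj_eq)
    qed
    moreover have "w i = w' i" if "i \<notin> B" for i
      using w(1,2) set_Pi_pmf_subset[OF finB, of d p] that by auto
    ultimately show "w = w'" by auto
  qed
  have val: "pmf (Pi_pmf B d p) w = pmf (Pi_pmf A d' (\<lambda>j. map_pmf (s j) (p (\<phi> j)))) (f w)"
    if "\<And>i. i \<notin> B \<Longrightarrow> w i = d" for w
  proof -
    have "pmf (Pi_pmf A d' (\<lambda>j. map_pmf (s j) (p (\<phi> j)))) (f w) = (\<Prod>j\<in>A. pmf (map_pmf (s j) (p (\<phi> j))) (f w j))"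
      using fin by (subst pmf_Pi') (auto simp: f_def)
    also have "\<dots> = (\<Prod>j\<in>A. pmf (p (\<phi> j)) (w (\<phi> j)))"
      by (intro prod.cong refl) (simp add: f_def pmf_map_inj' s)
    also have "\<dots> = (\<Prod>i\<in>B. pmf (p i) (w i))"
      by (rule prod.reindex_bij_betw[OF bij])
    also have "\<dots> = pmf (Pi_pmf B d p) w"
      using finB that by (subst pmf_Pi') auto
    finally show ?thesis ..
  qed
  show "pmf (Pi_pmf A d' (\<lambda>j. map_pmf (s j) (p (\<phi> j)))) \<xi>
     = pmf (map_pmf (\<lambda>w j. if j \<in> A then s j (w (\<phi> j)) else d') (Pi_pmf B d p)) \<xi>"
  proof (cases "\<xi> \<in> f ` set_pmf (Pi_pmf B d p)")
    case True
    then obtain w where w: "w \<in> set_pmf (Pi_pmf B d p)" "\<xi> = f w" by blast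
    have "pmf (map_pmf f (Pi_pmf B d p)) (f w) = pmf (Pi_pmf B d p) w"
      by (rule pmf_map_inj[OF inj w(1)])
    also have "\<dots> = pmf (Pi_pmf A d' (\<lambda>j. map_pmf (s j) (p (\<phi> j)))) (f w)"
      using set_Pi_pmf_subset[OF finB, of d p] w(1) by (intro val) auto
    finally show ?thesis unfolding w(2) f_def[abs_def] by simp
  next
    case False
    then have 0: "pmf (map_pmf f (Pi_pmf B d p)) \<xi> = 0" by (simp add: pmf_eq_0_set_pmf)
    have "pmf (Pi_pmf A d' (\<lambda>j. map_pmf (s j) (p (\<phi> j)))) \<xi> = 0"
    proof (rule ccontr)
      assume "pmf (Pi_pmf A d' (\<lambda>j. map_pmf (s j) (p (\<phi> j)))) \<xi> \<noteq> 0"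
      then have "\<xi> \<in> set_pmf (Pi_pmf A d' (\<lambda>j. map_pmf (s j) (p (\<phi> j))))" by (simp add: set_pmf_iff)
      then have \<xi>: "\<And>j. j \<notin> A \<Longrightarrow> \<xi> j = d'" "\<And>j. j \<in> A \<Longrightarrow> \<exists>y\<in>set_pmf (p (\<phi> j)). \<xi> j = s j y"
        using fin by (auto simp: set_Pi_pmf PiE_dflt_def)
      define w where "w i = (if i \<in> B then (SOME y. \<xi> (the_inv_into A \<phi> i) = s (the_inv_into A \<phi> i) y) else d)" for i
      have "s j (w (\<phi> j)) = \<xi> j" if "j \<in> A" for j
      proof -
        have i: "the_inv_into A \<phi> (\<phi> j) = j" "\<phi> j \<in> B"
          using bij that by (auto simp: bij_betw_def the_inv_into_f_f)
        have "\<exists>y. \<xi> j = s j y" using \<xi>(2)[OF that] by blast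
        then show ?thesis using someI_ex[of "\<lambda>y. \<xi> j = s j y"] by (simp add: w_def i)
      qed
      then have fw: "f w = \<xi>" using \<xi>(1) by (auto simp: f_def fun_eq_iff)
      have "pmf (Pi_pmf B d p) w = pmf (Pi_pmf A d' (\<lambda>j. map_pmf (s j) (p (\<phi> j)))) (f w)"
        by (rule val) (simp add: w_def)
      then have "w \<in> set_pmf (Pi_pmf B d p)"
        using \<open>pmf (Pi_pmf A d' (\<lambda>j. map_pmf (s j) (p (\<phi> j)))) \<xi> \<noteq> 0\<close> fw by (simp add: set_pmf_iff)
      then show False using False fw by blast
    qed
    then show ?thesis using 0 by (simp add: f_def[abs_def])
  qed
qed

text \<open>
  Pointwise convergence of probability mass functions is convergence in total variation by Scheffe's
  lemma, and bounded pointwise convergence of the test functions is handled by dominated convergence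
  under the limit law.
\<close>

lemma pmf_tendsto_expectation:
  fixes p :: "nat \<Rightarrow> 'a pmf" and f :: "nat \<Rightarrow> 'a \<Rightarrow> real"
  assumes p: "\<And>x. (\<lambda>n. pmf (p n) x) \<longlonglongrightarrow> pmf q x"
    and f: "\<And>x. (\<lambda>n. f n x) \<longlonglongrightarrow> g x" and bound: "\<And>n x. \<bar>f n x\<bar> \<le> C"
  shows "(\<lambda>n. measure_pmf.expectation (p n) (f n)) \<longlonglongrightarrow> measure_pmf.expectation q g"
proof -
  have C: "0 \<le> C" using bound[of 0 undefined] by linarith
  have integral_pmf: "measure_pmf.expectation r h = (\<integral>x. pmf r x * h x \<partial>count_space UNIV)" for r :: "'a pmf" and h :: "'a \<Rightarrow> real"
    unfolding measure_pmf_eq_density by (subst integral_density) simp_all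
  have i: "integrable (count_space UNIV) (\<lambda>x. pmf (p n) x - pmf q x)" for n
    by (intro Bochner_Integration.integrable_diff integrable_pmf)
  have iq: "integrable (count_space UNIV) (\<lambda>x. pmf r x * f n x)" for n and r :: "'a pmf"
    by (rule Bochner_Integration.integrable_bound[where f = "\<lambda>x. C * pmf r x"])
      (use bound C in \<open>auto simp: integrable_pmf abs_mult mult.commute[of _ "pmf r _"] intro!: mult_left_mono\<close>)
  define D where "D n = (\<integral>x. \<bar>pmf (p n) x - pmf q x\<bar> \<partial>count_space UNIV)" for n
  have "(\<lambda>n. \<integral>\<^sup>+x. norm (pmf (p n) x - pmf q x) \<partial>count_space UNIV) \<longlonglongrightarrow> 0"
    by (rule Scheffe_lemma2) (use p in \<open>auto simp: integrable_pmf nn_integral_pmf_eq_1\<close>)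
  moreover have "(\<integral>\<^sup>+x. norm (pmf (p n) x - pmf q x) \<partial>count_space UNIV) = ennreal (D n)" for n
    unfolding D_def real_norm_def by (intro nn_integral_eq_integral integrable_abs i) auto
  moreover have "0 \<le> D n" for n unfolding D_def by (intro integral_nonneg_AE) auto
  ultimately have D: "D \<longlonglongrightarrow> 0" by (simp add: ennreal_tendsto_0_iff)
  have "(\<lambda>n. measure_pmf.expectation q (f n)) \<longlonglongrightarrow> measure_pmf.expectation q g"
    by (rule integral_dominated_convergence[where w = "\<lambda>_. C"]) (use f bound in auto)
  moreover have "(\<lambda>n. measure_pmf.expectation (p n) (f n) - measure_pmf.expectation q (f n)) \<longlonglongrightarrow> 0"
  proof (rule Lim_null_comparison[where g = "\<lambda>n. C * D n"])
    show "\<forall>\<^sub>F n in sequentially. norm (measure_pmf.expectation (p n) (f n) - measure_pmf.expectation q (f n)) \<le> C * D n"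
    proof (intro always_eventually allI)
      fix n
      have "measure_pmf.expectation (p n) (f n) - measure_pmf.expectation q (f n)
          = (\<integral>x. (pmf (p n) x - pmf q x) * f n x \<partial>count_space UNIV)"
        unfolding integral_pmf left_diff_distrib by (rule Bochner_Integration.integral_diff[symmetric]) (rule iq)+
      also have "norm \<dots> \<le> (\<integral>x. norm ((pmf (p n) x - pmf q x) * f n x) \<partial>count_space UNIV)"
        by (rule integral_norm_bound)
      also have "\<dots> \<le> (\<integral>x. C * \<bar>pmf (p n) x - pmf q x\<bar> \<partial>count_space UNIV)"
      proof (rule integral_mono)
        have "integrable (count_space UNIV) (\<lambda>x. pmf (p n) x * f n x - pmf q x * f n x)"
          by (intro Bochner_Integration.integrable_diff iq)
        then show "integrable (count_space UNIV) (\<lambda>x. norm ((pmf (p n) x - pmf q x) * f n x))"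
          by (intro integrable_norm) (simp add: left_diff_distrib)
        show "integrable (count_space UNIV) (\<lambda>x. C * \<bar>pmf (p n) x - pmf q x\<bar>)"
          by (intro integrable_mult_right integrable_abs i)
        show "norm ((pmf (p n) x - pmf q x) * f n x) \<le> C * \<bar>pmf (p n) x - pmf q x\<bar>" for x
          using mult_left_mono[OF bound[of n x], of "\<bar>pmf (p n) x - pmf q x\<bar>"] by (simp add: abs_mult mult.commute)
      qed
      also have "\<dots> = C * D n" unfolding D_def by simp
      finally show "norm (measure_pmf.expectation (p n) (f n) - measure_pmf.expectation q (f n)) \<le> C * D n" .
    qed
    show "(\<lambda>n. C * D n) \<longlonglongrightarrow> 0" using tendsto_mult_left[OF D, of C] by simp
  qed
  ultimately show ?thesis using tendsto_add by force
qed

lemma distr_Pi_pmf_restrict: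
  fixes p :: "'i \<Rightarrow> 'b::countable pmf"
  assumes "finite I" "I \<noteq> {}"
  shows "distr (measure_pmf (Pi_pmf I d p)) (PiM I (\<lambda>_. count_space UNIV)) (\<lambda>x. restrict x I) = PiM I (\<lambda>i. measure_pmf (p i))"
proof -
  have "distr (measure_pmf (Pi_pmf I d p)) (PiM I (\<lambda>_. count_space UNIV)) (\<lambda>x. \<lambda>i\<in>I. x i)
     = PiM I (\<lambda>i. distr (measure_pmf (Pi_pmf I d p)) (count_space UNIV) (\<lambda>f. f i))"
    using prob_space.indep_vars_iff_distr_eq_PiM'[OF measure_pmf.prob_space_axioms assms(2), where M' = "\<lambda>_. count_space UNIV" and X = "\<lambda>i f. f i" and M1 = "Pi_pmf I d p"]
      indep_vars_Pi_pmf[OF assms(1), of d p] by simp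
  also have "\<dots> = PiM I (\<lambda>i. measure_pmf (p i))"
  proof (rule PiM_cong)
    fix i assume "i \<in> I"
    then have "measure_pmf (map_pmf (\<lambda>f. f i) (Pi_pmf I d p)) = measure_pmf (p i)"
      using assms(1) by (simp add: Pi_pmf_component)
    then show "distr (measure_pmf (Pi_pmf I d p)) (count_space UNIV) (\<lambda>f. f i) = measure_pmf (p i)"
      by (simp add: map_pmf_rep_eq)
  qed simp
  finally show ?thesis by (simp add: restrict_def)
qed

text \<open>
  An event that depends on the walk up to time \<open>n\<close> is a cylinder event for the increments, and the
  restriction of an infinite product measure to finitely many coordinates is the finite product.
\<close>

lemma measure_walk_law_eq:
  fixes p :: "int pmf"
  assumes sets: "{X. P X} \<in> sets (walk_law p)" and n: "0 < n"
    and dep: "\<And>X Y. (\<And>i. i \<le> n \<Longrightarrow> X i = Y i) \<Longrightarrow> P X = P Y"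
  shows "measure (walk_law p) {X. P X} = measure_pmf.prob (Pi_pmf {..<n} 0 (\<lambda>_. p)) {\<xi>. P (walk \<xi>)}"
proof -
  define M where "M = (\<lambda>_::nat. measure_pmf p)"
  define I where "I = {..<n}"
  define S where "S = {\<xi> \<in> space (PiM I M). P (walk \<xi>)}"
  interpret product_prob_space M UNIV
    unfolding M_def by (intro product_prob_spaceI measure_pmf.prob_space_axioms)
  have I: "finite I" "I \<noteq> {}" using n by (auto simp: I_def)
  have setsI: "sets (PiM I M) = sets (PiM I (\<lambda>_. count_space UNIV))"
    by (rule sets_PiM_cong) (simp_all add: M_def)
  have restrict: "P (walk (restrict \<xi> I)) = P (walk \<xi>)" for \<xi>
    by (rule dep) (auto simp: walk_def I_def)
  have S: "S \<in> sets (PiM I M)"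
    unfolding setsI S_def using I(1) by (subst count_space_PiM_finite) (auto simp: space_PiM M_def)
  have m1: "(\<lambda>x. restrict x I) \<in> measurable (PiM UNIV M) (PiM I M)"
    by (rule measurable_restrict_subset) simp
  have w: "walk \<in> measurable (PiM UNIV M) (PiM UNIV (\<lambda>_. count_space UNIV))"
    unfolding M_def by (rule walk_measurable)
  have "measure (walk_law p) {X. P X} = measure (PiM UNIV M) (walk -` {X. P X} \<inter> space (PiM UNIV M))"
    unfolding walk_law_def M_def[symmetric]
    by (rule measure_distr[OF w]) (use sets in \<open>simp add: walk_law_def\<close>)
  also have "walk -` {X. P X} \<inter> space (PiM UNIV M) = (\<lambda>x. restrict x I) -` S \<inter> space (PiM UNIV M)"
    by (auto simp: S_def restrict space_PiM M_def)
  also have "measure (PiM UNIV M) \<dots> = measure (distr (PiM UNIV M) (PiM I M) (\<lambda>x. restrict x I)) S"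
    by (rule measure_distr[OF m1 S, symmetric])
  also have "\<dots> = measure (PiM I M) S"
    using I(1) by (subst distr_PiM_restrict_finite) auto
  also have "PiM I M = distr (measure_pmf (Pi_pmf I 0 (\<lambda>_. p))) (PiM I (\<lambda>_. count_space UNIV)) (\<lambda>x. restrict x I)"
    unfolding distr_Pi_pmf_restrict[OF I] M_def ..
  also have "measure \<dots> S = measure_pmf.prob (Pi_pmf I 0 (\<lambda>_. p)) ((\<lambda>x. restrict x I) -` S)"
    using S unfolding setsI by (subst measure_distr) (auto simp: space_PiM)
  also have "(\<lambda>x. restrict x I) -` S = {\<xi>. P (walk \<xi>)}"
    by (auto simp: S_def restrict space_PiM M_def)
  finally show ?thesis by (simp add: I_def)
qed

context laplace_walk begin

text \<open>
  The change of measure.  The Radon-Nikodym density \<open>exp (\<Sum>\<tau>\<^sub>i \<xi>\<^sub>i - \<Sum>L(\<tau>\<^sub>i))\<close> is constant on \<open>E\<close> as soon as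
  the linear functional is.
\<close>

lemma prob_tilt:
  assumes "finite I" "\<And>i. i \<in> I \<Longrightarrow> \<bar>\<tau> i\<bar> < \<beta> / 2"
    and const: "\<And>\<xi>. \<xi> \<in> E \<Longrightarrow> (\<Sum>i\<in>I. \<tau> i * of_int (\<xi> i)) = c"
  shows "measure_pmf.prob (Pi_pmf I 0 (\<lambda>_. P_step \<beta>)) E
    = exp ((\<Sum>i\<in>I. log_mgf \<beta> (\<tau> i)) - c) * measure_pmf.prob (Pi_pmf I 0 (\<lambda>i. tilted_step \<beta> (\<tau> i))) E"
proof -
  have "pmf (Pi_pmf I 0 (\<lambda>_. P_step \<beta>)) \<xi> = exp ((\<Sum>i\<in>I. log_mgf \<beta> (\<tau> i)) - c) * pmf (Pi_pmf I 0 (\<lambda>i. tilted_step \<beta> (\<tau> i))) \<xi>"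
    if "\<xi> \<in> E" for \<xi>
  proof -
    have "(\<Prod>i\<in>I. pmf (tilted_step \<beta> (\<tau> i)) (\<xi> i)) = (\<Prod>i\<in>I. exp (\<tau> i * of_int (\<xi> i) - log_mgf \<beta> (\<tau> i)) * pmf (P_step \<beta>) (\<xi> i))"
      using assms(2) by (intro prod.cong refl pmf_tilted_step beta_pos)
    also have "\<dots> = exp (c - (\<Sum>i\<in>I. log_mgf \<beta> (\<tau> i))) * (\<Prod>i\<in>I. pmf (P_step \<beta>) (\<xi> i))"
      using assms(1) const[OF that] by (simp add: prod.distrib exp_sum[symmetric] sum_subtractf)
    finally show ?thesis
      using assms(1) by (auto simp: pmf_Pi mult.assoc[symmetric] exp_add[symmetric])
  qed
  then show ?thesis
    unfolding measure_pmf_conv_infsetsum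
    by (subst infsetsum_cmult_right[symmetric]) (auto intro!: infsetsum_cong pmf_abs_summable)
qed

lemma map_uminus_tilted_step:
  assumes "\<bar>t\<bar> < \<beta> / 2"
  shows "map_pmf uminus (tilted_step \<beta> t) = tilted_step \<beta> (- t)"
proof (rule pmf_eqI)
  fix k :: int
  have "pmf (map_pmf uminus (tilted_step \<beta> t)) (- (- k)) = pmf (tilted_step \<beta> t) (- k)"
    by (rule pmf_map_inj') (simp add: inj_def)
  then show "pmf (map_pmf uminus (tilted_step \<beta> t)) k = pmf (tilted_step \<beta> (- t)) k"
    using assms by (simp add: pmf_tilted_step[OF beta_pos] pmf_P_step[OF beta_pos] log_mgf_minus)
qed

end


section \<open>Riemann sums, the rate function and the covariance\<close>

text \<open>
  Errors of order \<open>e / N\<close> on each of the \<open>N\<close> cells add up to an error of order \<open>e\<close>.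
\<close>

lemma riemann_cells:
  fixes f :: "real \<Rightarrow> real" and y :: "nat \<Rightarrow> real"
  assumes f: "continuous_on {0..1} f" and N: "0 < N"
    and cell: "\<And>i. i < N \<Longrightarrow> \<bar>integral {real i / real N..real (Suc i) / real N} f - y i / real N\<bar> \<le> e / real N"
  shows "\<bar>integral {0..1} f - (\<Sum>i<N. y i) / real N\<bar> \<le> e"
proof -
  have "integral {0..real m / real N} f = (\<Sum>i<m. integral {real i / real N..real (Suc i) / real N} f)" if "m \<le> N" for m
    using that
  proof (induction m)
    case (Suc m)
    have "real (Suc m) / real N \<le> 1" using Suc.prems N by (simp add: divide_le_eq_1)
    then have "continuous_on {0..real (Suc m) / real N} f"
      by (intro continuous_on_subset[OF f]) auto
    then have "f integrable_on {0..real (Suc m) / real N}" by (rule integrable_continuous_real)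
    then have "integral {0..real m / real N} f + integral {real m / real N..real (Suc m) / real N} f = integral {0..real (Suc m) / real N} f"
      by (intro Henstock_Kurzweil_Integration.integral_combine) (auto intro!: divide_right_mono)
    then show ?case using Suc by simp
  qed simp
  from this[of N] have I: "integral {0..1} f = (\<Sum>i<N. integral {real i / real N..real (Suc i) / real N} f)"
    using N by simp
  have "integral {0..1} f - (\<Sum>i<N. y i) / real N = (\<Sum>i<N. integral {real i / real N..real (Suc i) / real N} f - y i / real N)"
    unfolding I by (simp add: sum_subtractf sum_divide_distrib)
  also have "\<bar>\<dots>\<bar> \<le> (\<Sum>i<N. \<bar>integral {real i / real N..real (Suc i) / real N} f - y i / real N\<bar>)"
    by (rule sum_abs)
  also have "\<dots> \<le> (\<Sum>i<N. e / real N)" by (intro sum_mono cell) auto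
  also have "\<dots> = e" using N by simp
  finally show ?thesis .
qed

lemma cell_subset: "i < N \<Longrightarrow> {real i / real N..real (Suc i) / real N} \<subseteq> {0..1}"
proof
  fix x assume i: "i < N" and x: "x \<in> {real i / real N..real (Suc i) / real N}"
  have "real (Suc i) / real N \<le> 1" using i by (simp add: divide_le_eq_1)
  moreover have "0 \<le> real i / real N" by simp
  ultimately show "x \<in> {0..1}" using x unfolding atLeastAtMost_iff by linarith
qed

lemma riemann_sum_error:
  fixes f :: "real \<Rightarrow> real"
  assumes f: "continuous_on {0..1} f" and N: "0 < N"
    and x: "\<And>i. i < N \<Longrightarrow> x i \<in> {real i / real N..real (Suc i) / real N}"
    and osc: "\<And>s t. s \<in> {0..1} \<Longrightarrow> t \<in> {0..1} \<Longrightarrow> \<bar>s - t\<bar> \<le> 1 / real N \<Longrightarrow> \<bar>f s - f t\<bar> \<le> e"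
  shows "\<bar>integral {0..1} f - (\<Sum>i<N. f (x i)) / real N\<bar> \<le> e"
proof (rule riemann_cells[OF f N])
  fix i assume i: "i < N"
  define I where "I = {real i / real N..real (Suc i) / real N}"
  have len: "real (Suc i) / real N - real i / real N = 1 / real N" by (simp add: diff_divide_distrib[symmetric])
  have le: "real i / real N \<le> real (Suc i) / real N" by (intro divide_right_mono) auto
  have cf: "continuous_on I f" unfolding I_def by (rule continuous_on_subset[OF f cell_subset[OF i]])
  have "norm (integral I (\<lambda>t. f t - f (x i))) \<le> e * (real (Suc i) / real N - real i / real N)"
    unfolding I_def
  proof (rule integral_bound[OF le])
    show "continuous_on {real i / real N..real (Suc i) / real N} (\<lambda>t. f t - f (x i))"
      using cf unfolding I_def by (intro continuous_intros)
    fix t assume t: "t \<in> {real i / real N..real (Suc i) / real N}"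
    have "\<bar>t - x i\<bar> \<le> 1 / real N" using t x[OF i] len by auto
    then show "norm (f t - f (x i)) \<le> e"
      using osc[OF subsetD[OF cell_subset[OF i] t] subsetD[OF cell_subset[OF i] x[OF i]]] by simp
  qed
  moreover have "integral I (\<lambda>t. f t - f (x i)) = integral I f - f (x i) / real N"
    using len le integrable_continuous_real[OF cf[unfolded I_def]] unfolding I_def
    by (subst Henstock_Kurzweil_Integration.integral_diff) auto
  ultimately show "\<bar>integral {real i / real N..real (Suc i) / real N} f - f (x i) / real N\<bar> \<le> e / real N"
    unfolding len by (simp add: I_def)
qed

lemma riemann_sum_tendsto:
  fixes f :: "real \<Rightarrow> real" and n :: "nat \<Rightarrow> nat" and y :: "nat \<Rightarrow> nat \<Rightarrow> real"
  assumes f: "continuous_on {0..1} f" and n: "filterlim n at_top sequentially"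
    and y: "\<And>k j. j < n k \<Longrightarrow> \<bar>y k j - f (real j / real (n k))\<bar> \<le> e k" and e: "e \<longlonglongrightarrow> 0"
  shows "(\<lambda>k. (\<Sum>j<n k. y k j) / real (n k)) \<longlonglongrightarrow> integral {0..1} f"
proof -
  have "\<forall>\<^sub>F k in sequentially. 1 \<le> n k" using n by (simp add: filterlim_at_top)
  then have n0: "\<forall>\<^sub>F k in sequentially. 0 < n k" by (rule eventually_mono) simp
  have "(\<lambda>k. (\<Sum>j<n k. f (real j / real (n k))) / real (n k)) \<longlonglongrightarrow> integral {0..1} f"
  proof (rule tendstoI)
    fix r :: real assume r: "0 < r"
    have "uniformly_continuous_on {0..1} f" using f by (intro compact_uniformly_continuous) auto
    then obtain d where d: "0 < d" "\<And>s t. s \<in> {0..1} \<Longrightarrow> t \<in> {0..1} \<Longrightarrow> dist s t < d \<Longrightarrow> dist (f s) (f t) < r / 2"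
      unfolding uniformly_continuous_on_def using r by (metis half_gt_zero)
    have "\<forall>\<^sub>F k in sequentially. 1 / d < real (n k)"
      using filterlim_compose[OF filterlim_real_sequentially n] by (simp add: filterlim_at_top_dense)
    with n0 show "\<forall>\<^sub>F k in sequentially. dist ((\<Sum>j<n k. f (real j / real (n k))) / real (n k)) (integral {0..1} f) < r"
    proof eventually_elim
      case (elim k)
      have "1 / real (n k) < d" using elim d(1) by (simp add: field_simps)
      then have "\<bar>integral {0..1} f - (\<Sum>j<n k. f (real j / real (n k))) / real (n k)\<bar> \<le> r / 2"
      proof (intro riemann_sum_error[OF f])
        show "\<bar>f s - f t\<bar> \<le> r / 2" if "s \<in> {0..1}" "t \<in> {0..1}" "\<bar>s - t\<bar> \<le> 1 / real (n k)" for s t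
          using d(2)[OF that(1,2)] that(3) \<open>1 / real (n k) < d\<close> by (simp add: dist_real_def)
      qed (use elim in \<open>auto intro!: divide_right_mono\<close>)
      then show ?case using r by (simp add: dist_real_def abs_minus_commute)
    qed
  qed
  moreover have "(\<lambda>k. (\<Sum>j<n k. y k j) / real (n k) - (\<Sum>j<n k. f (real j / real (n k))) / real (n k)) \<longlonglongrightarrow> 0"
  proof (rule Lim_null_comparison[OF _ e])
    show "\<forall>\<^sub>F k in sequentially. norm ((\<Sum>j<n k. y k j) / real (n k) - (\<Sum>j<n k. f (real j / real (n k))) / real (n k)) \<le> e k"
      using n0
    proof eventually_elim
      case (elim k)
      have "\<bar>\<Sum>j<n k. y k j - f (real j / real (n k))\<bar> \<le> (\<Sum>j<n k. e k)"
        by (rule order_trans[OF sum_abs]) (intro sum_mono y, auto)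
      then show ?case using elim by (simp add: diff_divide_distrib[symmetric] sum_subtractf[symmetric] field_simps)
    qed
  qed
  ultimately show ?thesis using tendsto_add by force
qed

text \<open>
  On a cell with midpoint \<open>c\<close> the linear term of \<open>f\<close> around \<open>c\<close> integrates to \<open>0\<close>, and the remainder is
  at most \<open>K / N\<^sup>2\<close>.
\<close>

lemma midpoint_rule_error:
  fixes f f' :: "real \<Rightarrow> real"
  assumes N: "0 < N" and f': "\<And>x. x \<in> {0..1} \<Longrightarrow> (f has_real_derivative f' x) (at x)"
    and lip: "\<And>s t. s \<in> {0..1} \<Longrightarrow> t \<in> {0..1} \<Longrightarrow> \<bar>f' s - f' t\<bar> \<le> K * \<bar>s - t\<bar>" and K: "0 \<le> K"
  shows "\<bar>integral {0..1} f - (\<Sum>i<N. f ((real i + 1 / 2) / real N)) / real N\<bar> \<le> K / (real N)\<^sup>2"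
proof (rule riemann_cells[OF _ N])
  show f: "continuous_on {0..1} f"
    by (intro continuous_at_imp_continuous_on ballI) (rule DERIV_isCont[OF f'])
  fix i assume i: "i < N"
  define I where "I = {real i / real N..real (Suc i) / real N}"
  define c where "c = (real i + 1 / 2) / real N"
  have len: "real (Suc i) / real N - real i / real N = 1 / real N" by (simp add: diff_divide_distrib[symmetric])
  have le: "real i / real N \<le> real (Suc i) / real N" by (intro divide_right_mono) auto
  have c: "c \<in> I" unfolding c_def I_def by (auto intro!: divide_right_mono)
  have sub: "I \<subseteq> {0..1}" unfolding I_def by (rule cell_subset[OF i])
  have cf: "continuous_on I f" by (rule continuous_on_subset[OF f sub])
  have "norm (integral I (\<lambda>t. f t - f c - f' c * (t - c))) \<le> K * (1 / real N)\<^sup>2 * (real (Suc i) / real N - real i / real N)"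
    unfolding I_def
  proof (rule integral_bound[OF le])
    show "continuous_on {real i / real N..real (Suc i) / real N} (\<lambda>t. f t - f c - f' c * (t - c))"
      using cf unfolding I_def by (intro continuous_intros)
    fix t assume "t \<in> {real i / real N..real (Suc i) / real N}"
    then have t: "t \<in> I" by (simp add: I_def)
    have d: "\<bar>t - c\<bar> \<le> 1 / real N" using t c len by (auto simp: I_def)
    have "norm (f t - f c - f' c * (t - c)) \<le> (K * (1 / real N)) * norm (t - c)"
    proof -
      define g where "g s = f s - f' c * s" for s
      have "norm (g t - g c) \<le> (K * (1 / real N)) * norm (t - c)"
      proof (rule field_differentiable_bound[where S = I and f' = "\<lambda>s. f' s - f' c"])
        show "convex I" by (simp add: I_def)
        fix z assume z: "z \<in> I"
        show "(g has_field_derivative f' z - f' c) (at z within I)"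
        proof -
          have "(f has_field_derivative f' z) (at z within I)"
            by (rule has_field_derivative_at_within[OF f']) (use z sub in auto)
          from DERIV_diff[OF this DERIV_cmult_Id[of "f' c" z I]] show ?thesis by (simp add: g_def[abs_def])
        qed
        have "\<bar>z - c\<bar> \<le> 1 / real N" using z c len by (auto simp: I_def)
        then have "K * \<bar>z - c\<bar> \<le> K * (1 / real N)" using K by (intro mult_left_mono)
        then show "norm (f' z - f' c) \<le> K * (1 / real N)"
          using lip[OF subsetD[OF sub z] subsetD[OF sub c]] by simp
      qed (use t c in auto)
      then show ?thesis by (simp add: g_def algebra_simps)
    qed
    also have "\<dots> \<le> (K * (1 / real N)) * (1 / real N)"
      using d K by (intro mult_left_mono) auto
    finally show "norm (f t - f c - f' c * (t - c)) \<le> K * (1 / real N)\<^sup>2" by (simp add: power2_eq_square)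
  qed
  moreover have "integral I (\<lambda>t. f t - f c - f' c * (t - c)) = integral I f - f c / real N"
  proof -
    have "((\<lambda>t. f c + f' c * (t - c)) has_integral
       (f c * (real (Suc i) / real N) + f' c * (real (Suc i) / real N - c)\<^sup>2 / 2) - (f c * (real i / real N) + f' c * (real i / real N - c)\<^sup>2 / 2)) I"
      unfolding I_def
      by (rule fundamental_theorem_of_calculus[OF le])
        (auto intro!: derivative_eq_intros simp: has_real_derivative_iff_has_vector_derivative[symmetric])
    moreover have "(real (Suc i) / real N - c)\<^sup>2 = (real i / real N - c)\<^sup>2"
      using N by (simp add: c_def field_simps power2_eq_square)
    moreover have "f c * X + Y - (f c * Z + Y) = f c * (X - Z)" for X Y Z
      by (simp add: algebra_simps)
    ultimately have "((\<lambda>t. f c + f' c * (t - c)) has_integral f c / real N) I"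
      by (simp only: len) simp
    from has_integral_diff[OF integrable_integral[OF integrable_continuous_real[OF cf[unfolded I_def]]] this[unfolded I_def]]
    show ?thesis unfolding I_def[symmetric] by (simp add: algebra_simps integral_unique)
  qed
  ultimately show "\<bar>integral {real i / real N..real (Suc i) / real N} f - f ((real i + 1 / 2) / real N) / real N\<bar> \<le> K / (real N)\<^sup>2 / real N"
    unfolding len by (simp add: I_def c_def power_divide)
qed

context laplace_walk begin

lemma geo_ne_1:
  assumes "\<bar>t\<bar> < \<beta> / 2"
  shows "geo (t::real) \<noteq> 1" "geo (- t::real) \<noteq> 1"
proof -
  have "t < \<beta> / 2" "- t < \<beta> / 2" using assms by linarith+
  from this[THEN geo_less_1] show "geo (t::real) \<noteq> 1" "geo (- t::real) \<noteq> 1" by auto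
qed

lemma continuous_on_cum [continuous_intros]:
  fixes f :: "'a::topological_space \<Rightarrow> real"
  assumes "continuous_on S f" "\<And>x. x \<in> S \<Longrightarrow> \<bar>f x\<bar> < \<beta> / 2"
  shows "continuous_on S (\<lambda>x. cum1 (f x))" "continuous_on S (\<lambda>x. cum2 (f x))" "continuous_on S (\<lambda>x. log_mgf \<beta> (f x))"
proof -
  have U: "f ` S \<subseteq> {- (\<beta> / 2)<..<\<beta> / 2}"
  proof
    fix y assume "y \<in> f ` S"
    then have "\<bar>y\<bar> < \<beta> / 2" using assms(2) by blast
    then show "y \<in> {- (\<beta> / 2)<..<\<beta> / 2}" unfolding greaterThanLessThan_iff by linarith
  qed
  have *: "isCont cum1 x" "isCont cum2 x" "isCont (log_mgf \<beta>) x" if "x \<in> {- (\<beta> / 2)<..<\<beta> / 2}" for x :: real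
  proof -
    have "\<bar>x\<bar> < \<beta> / 2" using that by auto
    then show "isCont cum1 x" "isCont cum2 x" "isCont (log_mgf \<beta>) x"
      using geo_ne_1[of x] by (auto intro!: DERIV_isCont[OF DERIV_cum1] DERIV_isCont[OF DERIV_cum2] DERIV_isCont[OF DERIV_log_mgf])
  qed
  show "continuous_on S (\<lambda>x. cum1 (f x))" "continuous_on S (\<lambda>x. cum2 (f x))" "continuous_on S (\<lambda>x. log_mgf \<beta> (f x))"
    by (rule continuous_on_compose2[OF continuous_at_imp_continuous_on assms(1) U]; use * in blast)+
qed

lemma cum_Lipschitz:
  assumes "\<bar>s\<bar> \<le> T" "\<bar>t\<bar> \<le> T" "T < \<beta> / 2"
  shows "\<bar>cum1 s - cum1 t\<bar> \<le> cgf_bound T * \<bar>s - t\<bar>" "\<bar>cum2 s - cum2 t\<bar> \<le> cgf_bound T * \<bar>(s::real) - t\<bar>"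
proof -
  have x: "\<bar>x\<bar> \<le> T" "\<bar>x\<bar> < \<beta> / 2" if "x \<in> {-T..T}" for x
    using that assms(3) unfolding atLeastAtMost_iff by linarith+
  have st: "s \<in> {-T..T}" "t \<in> {-T..T}" using assms(1,2) unfolding atLeastAtMost_iff by linarith+
  have "norm (cum1 s - cum1 t) \<le> cgf_bound T * norm (s - t)"
    by (rule field_differentiable_bound[of "{-T..T}" cum1 cum2])
      (use x cum_le(2)[OF _ assms(3)] geo_ne_1 st in \<open>simp_all add: DERIV_cum1\<close>)
  then show "\<bar>cum1 s - cum1 t\<bar> \<le> cgf_bound T * \<bar>s - t\<bar>" by simp
  have "norm (cum2 s - cum2 t) \<le> cgf_bound T * norm (s - t)"
    by (rule field_differentiable_bound[of "{-T..T}" cum2 cum3])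
      (use x cum_le(3)[OF _ assms(3)] geo_ne_1 st in \<open>simp_all add: DERIV_cum2\<close>)
  then show "\<bar>cum2 s - cum2 t\<bar> \<le> cgf_bound T * \<bar>s - t\<bar>" by simp
qed

lemma cum1_increment_ge:
  assumes "\<bar>x\<bar> < \<beta> / 2" "\<bar>y\<bar> < \<beta> / 2" "x < y"
  shows "cum1 x + exp (- \<beta>) * (y - x) \<le> cum1 (y::real)"
proof -
  have "\<exists>z. x < z \<and> z < y \<and> cum1 y - cum1 x = (y - x) * cum2 z"
  proof (rule MVT2[OF assms(3)])
    fix z assume "x \<le> z" "z \<le> y"
    then have "geo z < 1" "geo (- z) < 1"
      using assms by (auto simp: geo_def)
    then show "(cum1 has_real_derivative cum2 z) (at z)" by (intro DERIV_cum1) auto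
  qed
  then obtain z where z: "x < z" "z < y" "cum1 y - cum1 x = (y - x) * cum2 z" by blast
  have "exp (- \<beta>) \<le> cum2 z" using z assms by (intro cum2_ge) auto
  then have "(y - x) * exp (- \<beta>) \<le> (y - x) * cum2 z" using assms by (intro mult_left_mono) auto
  then show ?thesis using z(3) by (simp add: algebra_simps)
qed

lemma cum1_mono:
  assumes "\<bar>x\<bar> < \<beta> / 2" "\<bar>y\<bar> < \<beta> / 2" "x \<le> y"
  shows "cum1 x \<le> cum1 (y::real)"
  using cum1_increment_ge[of x y] assms by (cases "x = y") (auto intro: order_trans[rotated])

lemma abs_arg_le:
  assumes "x \<in> {0..1::real}"
  shows "\<bar>h * (1 / 2 - x)\<bar> \<le> \<bar>h\<bar> / 2"
proof -
  have "\<bar>1 / 2 - x\<bar> \<le> 1 / 2" using assms unfolding atLeastAtMost_iff by linarith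
  then show ?thesis unfolding abs_mult using mult_left_mono[of "\<bar>1 / 2 - x\<bar>" "1 / 2" "\<bar>h\<bar>"] by simp
qed

lemma abs_arg_less: "x \<in> {0..1::real} \<Longrightarrow> \<bar>h\<bar> < \<beta> \<Longrightarrow> \<bar>h * (1 / 2 - x)\<bar> < \<beta> / 2"
  using abs_arg_le[of x h] by linarith

text \<open>
  The derivative of \<open>G_fun\<close>, obtained by differentiating under the integral sign (\<open>G_fun_deriv\<close>).
\<close>

definition G_prime :: "real \<Rightarrow> real" where
  "G_prime h = integral {0..1} (\<lambda>x. (1 / 2 - x) * cum1 (h * (1 / 2 - x)))"

text \<open>
  The error is quadratic in \<open>1/N\<close>, so it vanishes even after multiplication by \<open>N\<close>, as is
  needed in the exponent of the change of measure.
\<close>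

lemma G_fun_midpoint:
  assumes "\<bar>h\<bar> \<le> H" "H < \<beta>" "0 < N"
  shows "\<bar>G_fun \<beta> h - (\<Sum>i<N. log_mgf \<beta> (h * (1 / 2 - (real i + 1 / 2) / real N))) / real N\<bar>
    \<le> \<beta>\<^sup>2 * cgf_bound (H / 2) / (real N)\<^sup>2"
  unfolding G_fun_def
proof (rule midpoint_rule_error[where f' = "\<lambda>x. - h * cum1 (h * (1 / 2 - x))", OF assms(3)])
  have B: "0 < cgf_bound (H / 2)" using assms by (intro cgf_bound_pos) auto
  show "((\<lambda>x. log_mgf \<beta> (h * (1 / 2 - x))) has_real_derivative - h * cum1 (h * (1 / 2 - x))) (at x)" if "x \<in> {0..1}" for x
  proof -
    have a: "\<bar>h * (1 / 2 - x)\<bar> < \<beta> / 2" using abs_arg_less[OF that, of h] assms by simp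
    have b: "((\<lambda>x. h * (1 / 2 - x)) has_real_derivative - h) (at x)" by (auto intro!: derivative_eq_intros)
    show ?thesis by (rule DERIV_cong[OF DERIV_chain2[OF DERIV_log_mgf[OF a] b]]) simp
  qed
  show "0 \<le> \<beta>\<^sup>2 * cgf_bound (H / 2)" using B by simp
  fix s t :: real assume st: "s \<in> {0..1}" "t \<in> {0..1}"
  have "\<bar>- h * cum1 (h * (1 / 2 - s)) - - h * cum1 (h * (1 / 2 - t))\<bar> = \<bar>h\<bar> * \<bar>cum1 (h * (1 / 2 - s)) - cum1 (h * (1 / 2 - t))\<bar>"
    by (simp add: abs_mult[symmetric] right_diff_distrib' abs_minus_commute)
  also have "\<dots> \<le> \<bar>h\<bar> * (cgf_bound (H / 2) * \<bar>h * (1 / 2 - s) - h * (1 / 2 - t)\<bar>)"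
    using abs_arg_le[OF st(1), of h] abs_arg_le[OF st(2), of h] assms by (intro mult_left_mono cum_Lipschitz) auto
  also have "h * (1 / 2 - s) - h * (1 / 2 - t) = h * (t - s)" by (simp add: algebra_simps)
  also have "\<bar>h\<bar> * (cgf_bound (H / 2) * \<bar>h * (t - s)\<bar>) = \<bar>h\<bar>\<^sup>2 * (cgf_bound (H / 2) * \<bar>s - t\<bar>)"
    by (simp add: abs_mult power2_eq_square abs_minus_commute)
  also have "\<dots> \<le> \<beta>\<^sup>2 * (cgf_bound (H / 2) * \<bar>s - t\<bar>)"
    using assms B by (intro mult_right_mono power_mono) auto
  finally show "\<bar>- h * cum1 (h * (1 / 2 - s)) - - h * cum1 (h * (1 / 2 - t))\<bar> \<le> \<beta>\<^sup>2 * cgf_bound (H / 2) * \<bar>s - t\<bar>"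
    by (simp add: mult.assoc)
qed

lemma G_prime_riemann:
  assumes "\<bar>h\<bar> \<le> H" "H < \<beta>" "0 < N"
  shows "\<bar>G_prime h - (\<Sum>i<N. (1 / 2 - (real i + 1 / 2) / real N) * cum1 (h * (1 / 2 - (real i + 1 / 2) / real N))) / real N\<bar>
    \<le> (1 + \<beta>) * cgf_bound (H / 2) / real N"
  unfolding G_prime_def
proof (rule riemann_sum_error[OF _ assms(3)])
  have B: "0 < cgf_bound (H / 2)" using assms by (intro cgf_bound_pos) auto
  show "continuous_on {0..1} (\<lambda>x. (1 / 2 - x) * cum1 (h * (1 / 2 - x)))"
    by (intro continuous_intros abs_arg_less) (use assms in auto)
  show "(real i + 1 / 2) / real N \<in> {real i / real N..real (Suc i) / real N}" for i
    by (auto intro!: divide_right_mono)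
  fix s t :: real assume st: "s \<in> {0..1}" "t \<in> {0..1}" "\<bar>s - t\<bar> \<le> 1 / real N"
  define c where "c x = cum1 (h * (1 / 2 - x))" for x
  have "(1 / 2 - s) * c s - (1 / 2 - t) * c t = (t - s) * c s + (1 / 2 - t) * (c s - c t)"
    by (simp add: field_simps)
  then have "\<bar>(1 / 2 - s) * c s - (1 / 2 - t) * c t\<bar> = \<bar>(t - s) * c s + (1 / 2 - t) * (c s - c t)\<bar>"
    by simp
  also have "\<dots> \<le> \<bar>t - s\<bar> * \<bar>c s\<bar> + \<bar>1 / 2 - t\<bar> * \<bar>c s - c t\<bar>"
    by (rule order_trans[OF abs_triangle_ineq]) (simp add: abs_mult)
  also have "\<dots> \<le> \<bar>t - s\<bar> * cgf_bound (H / 2) + 1 * (cgf_bound (H / 2) * (\<beta> * \<bar>t - s\<bar>))"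
  proof (intro add_mono mult_mono)
    show "\<bar>c s\<bar> \<le> cgf_bound (H / 2)"
      unfolding c_def using abs_arg_le[OF st(1), of h] assms by (intro cum_le) auto
    have "\<bar>c s - c t\<bar> \<le> cgf_bound (H / 2) * \<bar>h * (1 / 2 - s) - h * (1 / 2 - t)\<bar>"
      unfolding c_def using abs_arg_le[OF st(1), of h] abs_arg_le[OF st(2), of h] assms by (intro cum_Lipschitz) auto
    also have "h * (1 / 2 - s) - h * (1 / 2 - t) = h * (t - s)" by (simp add: algebra_simps)
    also have "cgf_bound (H / 2) * \<bar>h * (t - s)\<bar> \<le> cgf_bound (H / 2) * (\<beta> * \<bar>t - s\<bar>)"
      using assms B unfolding abs_mult by (intro mult_left_mono mult_right_mono) auto
    finally show "\<bar>c s - c t\<bar> \<le> cgf_bound (H / 2) * (\<beta> * \<bar>t - s\<bar>)" .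
  qed (use st B in \<open>auto simp: abs_le_iff\<close>)
  also have "\<dots> = (1 + \<beta>) * cgf_bound (H / 2) * \<bar>s - t\<bar>" by (simp add: algebra_simps abs_minus_commute)
  also have "\<dots> \<le> (1 + \<beta>) * cgf_bound (H / 2) * (1 / real N)"
    using st(3) B beta_pos by (intro mult_left_mono) auto
  finally show "\<bar>(1 / 2 - s) * cum1 (h * (1 / 2 - s)) - (1 / 2 - t) * cum1 (h * (1 / 2 - t))\<bar> \<le> (1 + \<beta>) * cgf_bound (H / 2) / real N"
    by (simp add: c_def)
qed

lemma G_fun_deriv:
  assumes "\<bar>h\<bar> < \<beta>"
  shows "deriv (G_fun \<beta>) h = G_prime h"
proof -
  define U where "U = {- \<beta><..<\<beta>}"
  have U: "h \<in> U" "open U" using assms by (auto simp: U_def)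
  have "((\<lambda>h. integral (cbox 0 1) (\<lambda>x. log_mgf \<beta> (h * (1 / 2 - x)))) has_field_derivative
      integral (cbox 0 1) (\<lambda>x. (1 / 2 - x) * cum1 (h * (1 / 2 - x)))) (at h within U)"
  proof (rule leibniz_rule_field_derivative[OF _ _ _ U(1)])
    show "((\<lambda>h. log_mgf \<beta> (h * (1 / 2 - t))) has_real_derivative (1 / 2 - t) * cum1 (x * (1 / 2 - t))) (at x within U)"
      if "x \<in> U" "t \<in> cbox 0 1" for x t
    proof -
      have a: "\<bar>x * (1 / 2 - t)\<bar> < \<beta> / 2" using abs_arg_less[of t x] that by (auto simp: U_def)
      have b: "((\<lambda>x. x * (1 / 2 - t)) has_real_derivative 1 / 2 - t) (at x within U)" by (auto intro!: derivative_eq_intros)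
      show ?thesis by (rule DERIV_cong[OF DERIV_chain2[OF DERIV_log_mgf[OF a] b]]) simp
    qed
    show "(\<lambda>xa. log_mgf \<beta> (x * (1 / 2 - xa))) integrable_on cbox 0 1" if "x \<in> U" for x
      unfolding cbox_interval using that
      by (intro integrable_continuous_real continuous_intros abs_arg_less) (auto simp: U_def)
    show "continuous_on (U \<times> cbox 0 1) (\<lambda>(x, t). (1 / 2 - t) * cum1 (x * (1 / 2 - t)))"
      unfolding case_prod_unfold by (intro continuous_intros abs_arg_less) (auto simp: U_def)
    show "convex U" by (simp add: U_def)
  qed
  then have "(G_fun \<beta> has_field_derivative G_prime h) (at h)"
    using at_within_open[OF U] unfolding G_fun_def[abs_def] G_prime_def cbox_interval by simp
  then show ?thesis by (rule DERIV_imp_deriv)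
qed

lemma G_prime_integrable: "\<bar>h\<bar> < \<beta> \<Longrightarrow> (\<lambda>x. (1 / 2 - x) * cum1 (h * (1 / 2 - x))) integrable_on {0..1}"
  by (intro integrable_continuous_real continuous_intros abs_arg_less) auto


lemma G_prime_0: "G_prime 0 = 0"
  by (simp add: G_prime_def)

lemma integral_square_half: "integral {0..1} (\<lambda>x::real. (1 / 2 - x)\<^sup>2) = 1 / 12"
proof -
  have "((\<lambda>x::real. (1 / 2 - x)\<^sup>2) has_integral (- ((1 / 2 - 1) ^ 3) / 3) - (- ((1 / 2 - 0) ^ 3) / 3)) {0..1}"
    by (rule fundamental_theorem_of_calculus)
      (auto intro!: derivative_eq_intros simp: has_real_derivative_iff_has_vector_derivative[symmetric])
  then show ?thesis by (simp add: integral_unique power3_eq_cube)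
qed

text \<open>
  The integrand increases with \<open>h\<close> at rate at least \<open>exp (- \<beta>) (1/2 - x)\<^sup>2\<close>, because the variance
  \<open>cum2\<close> of the tilted steps is at least \<open>exp (- \<beta>)\<close>.
\<close>

lemma G_prime_strict_mono:
  assumes "\<bar>h\<bar> < \<beta>" "\<bar>h'\<bar> < \<beta>" "h < h'"
  shows "G_prime h < G_prime h'"
proof -
  have "(h' - h) * exp (- \<beta>) / 12 = integral {0..1} (\<lambda>x. ((h' - h) * exp (- \<beta>)) * (1 / 2 - x)\<^sup>2)"
    by (simp add: integral_square_half)
  also have "\<dots> \<le> integral {0..1} (\<lambda>x. (1 / 2 - x) * cum1 (h' * (1 / 2 - x)) - (1 / 2 - x) * cum1 (h * (1 / 2 - x)))"
  proof (rule integral_le)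
    show "(\<lambda>x. ((h' - h) * exp (- \<beta>)) * (1 / 2 - x)\<^sup>2) integrable_on {0..1}"
      by (intro integrable_continuous_real continuous_intros)
    show "(\<lambda>x. (1 / 2 - x) * cum1 (h' * (1 / 2 - x)) - (1 / 2 - x) * cum1 (h * (1 / 2 - x))) integrable_on {0..1}"
      using assms by (intro Henstock_Kurzweil_Integration.integrable_diff G_prime_integrable)
    fix x :: real assume x: "x \<in> {0..1}"
    define y where "y = 1 / 2 - x"
    note b = abs_arg_less[OF x assms(1), folded y_def] abs_arg_less[OF x assms(2), folded y_def]
    have "(h' - h) * exp (- \<beta>) * y\<^sup>2 \<le> y * (cum1 (h' * y) - cum1 (h * y))"
    proof (cases "0 \<le> y")
      case True
      have "h * y \<le> h' * y" using assms(3) True by (simp add: mult_right_mono)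
      then have "exp (- \<beta>) * (h' * y - h * y) \<le> cum1 (h' * y) - cum1 (h * y)"
        using cum1_increment_ge[OF b] by (cases "h * y = h' * y") auto
      from mult_left_mono[OF this True] show ?thesis by (simp add: power2_eq_square algebra_simps)
    next
      case False
      then have "h' * y \<le> h * y" using assms(3) by (simp add: mult_right_mono_neg)
      then have "exp (- \<beta>) * (h * y - h' * y) \<le> cum1 (h * y) - cum1 (h' * y)"
        using cum1_increment_ge[OF b(2,1)] by (cases "h * y = h' * y") auto
      from mult_left_mono[OF this, of "- y"] show ?thesis using False by (simp add: power2_eq_square algebra_simps)
    qed
    then show "((h' - h) * exp (- \<beta>)) * (1 / 2 - x)\<^sup>2 \<le> (1 / 2 - x) * cum1 (h' * (1 / 2 - x)) - (1 / 2 - x) * cum1 (h * (1 / 2 - x))"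
      by (simp add: y_def right_diff_distrib)
  qed
  also have "\<dots> = G_prime h' - G_prime h"
    unfolding G_prime_def by (rule Henstock_Kurzweil_Integration.integral_diff) (use assms in \<open>auto intro!: G_prime_integrable\<close>)
  finally have "(h' - h) * exp (- \<beta>) / 12 \<le> G_prime h' - G_prime h" .
  moreover have "0 < (h' - h) * exp (- \<beta>)" using assms(3) by simp
  ultimately show ?thesis by linarith
qed

lemma G_prime_continuous: "continuous_on {- \<beta><..<\<beta>} G_prime"
proof -
  have "continuous_on ({- \<beta><..<\<beta>} \<times> cbox 0 1) (\<lambda>(h, x). (1 / 2 - x) * cum1 (h * (1 / 2 - x)))"
    unfolding case_prod_unfold by (intro continuous_intros abs_arg_less) (auto simp: cbox_interval)
  from integral_continuous_on_param[OF this] show ?thesis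
    unfolding G_prime_def[abs_def] cbox_interval .
qed

lemma log_mgf_mono:
  assumes "0 \<le> s" "s \<le> t" "t < \<beta> / 2"
  shows "log_mgf \<beta> s \<le> log_mgf \<beta> t"
proof (rule DERIV_nonneg_imp_nondecreasing[OF assms(2)])
  fix x assume x: "s \<le> x" "x \<le> t"
  have b: "\<bar>x\<bar> < \<beta> / 2" using x assms by auto
  have "cum1 (0::real) \<le> cum1 x" using b x assms beta_pos by (intro cum1_mono) auto
  then show "\<exists>y. (log_mgf \<beta> has_real_derivative y) (at x) \<and> 0 \<le> y"
    using DERIV_log_mgf[OF b] by auto
qed

text \<open>
  The integrand is nonnegative, and on \<open>[0, 1/4]\<close> its first factor is at least \<open>1/4\<close> while the second
  one has an explicit antiderivative.  This bounds \<open>G_prime h\<close> from below by a multiple of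
  \<open>log_mgf \<beta> (h/2) - log_mgf \<beta> (h/4)\<close>; as \<open>h\<close> tends to \<open>\<beta>\<close> the first term diverges logarithmically and
  the second one stays bounded.
\<close>

lemma G_prime_unbounded: "\<exists>h. 0 < h \<and> h < \<beta> \<and> q \<le> G_prime h"
proof -
  define c where "c = ln ((1 - exp (- \<beta> / 2))\<^sup>2)"
  have low: "(log_mgf \<beta> (h / 2) - log_mgf \<beta> (h / 4)) / (4 * h) \<le> G_prime h" if h: "0 < h" "h < \<beta>" for h
  proof -
    define g where "g x = (1 / 2 - x) * cum1 (h * (1 / 2 - x))" for x
    have "\<bar>h\<bar> < \<beta>" using h by simp
    then have gi: "g integrable_on {0..1}" unfolding g_def[abs_def] by (rule G_prime_integrable)
    have b: "\<bar>h * (1 / 2 - x)\<bar> < \<beta> / 2" if "x \<in> {0..1}" for x using abs_arg_less[OF that, of h] h by simp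
    have g0: "0 \<le> g x" if "x \<in> {0..1}" for x
    proof (cases "0 \<le> 1 / 2 - x")
      case True
      then have "cum1 (0::real) \<le> cum1 (h * (1 / 2 - x))"
        using b[OF that] h beta_pos by (intro cum1_mono) auto
      then show ?thesis using True by (simp add: g_def)
    next
      case False
      then have "h * (1 / 2 - x) \<le> 0" using h by (simp add: mult_nonneg_nonpos)
      then have "cum1 (h * (1 / 2 - x)) \<le> cum1 0"
        using b[OF that] beta_pos by (intro cum1_mono) auto
      then show ?thesis using False by (simp add: g_def mult_nonpos_nonpos)
    qed
    have "((\<lambda>x. 1 / 4 * cum1 (h * (1 / 2 - x))) has_integral
       (- log_mgf \<beta> (h * (1 / 2 - 1 / 4)) / (4 * h)) - (- log_mgf \<beta> (h * (1 / 2 - 0)) / (4 * h))) {0..1 / 4}"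
    proof (rule fundamental_theorem_of_calculus)
      fix x :: real assume x: "x \<in> {0..1 / 4}"
      have a: "\<bar>h * (1 / 2 - x)\<bar> < \<beta> / 2" using b[of x] x by auto
      have d: "((\<lambda>x. h * (1 / 2 - x)) has_real_derivative - h) (at x within {0..1 / 4})" by (auto intro!: derivative_eq_intros)
      have "((\<lambda>x. - log_mgf \<beta> (h * (1 / 2 - x)) / (4 * h)) has_real_derivative - (cum1 (h * (1 / 2 - x)) * - h) / (4 * h)) (at x within {0..1 / 4})"
        by (intro DERIV_cdivide DERIV_minus DERIV_chain2[OF DERIV_log_mgf[OF a] d])
      then show "((\<lambda>x. - log_mgf \<beta> (h * (1 / 2 - x)) / (4 * h)) has_vector_derivative 1 / 4 * cum1 (h * (1 / 2 - x))) (at x within {0..1 / 4})"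
        using h by (simp add: has_real_derivative_iff_has_vector_derivative[symmetric])
    qed simp
    then have I: "((\<lambda>x. 1 / 4 * cum1 (h * (1 / 2 - x))) has_integral (log_mgf \<beta> (h / 2) - log_mgf \<beta> (h / 4)) / (4 * h)) {0..1 / 4}"
      by (simp add: diff_divide_distrib)
    have gi4: "g integrable_on {0..1 / 4}" "g integrable_on {1 / 4..1}"
      by (rule integrable_subinterval_real[OF gi]; simp)+
    have "(log_mgf \<beta> (h / 2) - log_mgf \<beta> (h / 4)) / (4 * h) = integral {0..1 / 4} (\<lambda>x. 1 / 4 * cum1 (h * (1 / 2 - x)))"
      by (rule integral_unique[OF I, symmetric])
    also have "\<dots> \<le> integral {0..1 / 4} g"
    proof (rule integral_le)
      show "(\<lambda>x. 1 / 4 * cum1 (h * (1 / 2 - x))) integrable_on {0..1 / 4}" using I by blast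
      fix x :: real assume x: "x \<in> {0..1 / 4}"
      then have "cum1 (0::real) \<le> cum1 (h * (1 / 2 - x))"
        using b[of x] h beta_pos by (intro cum1_mono) auto
      then show "1 / 4 * cum1 (h * (1 / 2 - x)) \<le> g x"
        unfolding g_def using x by (intro mult_right_mono) auto
    qed (rule gi4)
    also have "\<dots> \<le> integral {0..1 / 4} g + integral {1 / 4..1} g"
      using Henstock_Kurzweil_Integration.integral_nonneg[OF gi4(2)] g0 by simp
    also have "\<dots> = G_prime h"
      unfolding G_prime_def g_def[symmetric] by (rule Henstock_Kurzweil_Integration.integral_combine) (use gi in auto)
    finally show ?thesis .
  qed
  define m where "m = log_mgf \<beta> (\<beta> / 4)"
  define K where "K = 4 * \<beta> * \<bar>q\<bar> + m - c"
  \<comment> \<open>this choice makes \<open>1 - geo (h / 2)\<close> at most \<open>exp (- K)\<close>\<close>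
  define h where "h = max (\<beta> / 2) (\<beta> + 2 * ln (1 - min (1 / 2) (exp (- K))))"
  define w where "w = min (1 / 2) (exp (- K))"
  have w: "0 < w" "w \<le> 1 / 2" "w \<le> exp (- K)" by (auto simp: w_def)
  have lnw: "ln (1 - w) < 0" using w by (subst ln_less_zero_iff) auto
  have h: "0 < h" "h < \<beta>" "\<beta> + 2 * ln (1 - w) \<le> h" using beta_pos lnw by (auto simp: h_def w_def)
  have "ln (1 - w) \<le> h / 2 - \<beta> / 2" using h(3) by simp
  then have "exp (ln (1 - w)) \<le> geo (h / 2)" unfolding geo_def by (simp only: exp_le_cancel_iff of_real_eq_id id_apply)
  then have "1 - geo (h / 2) \<le> exp (- K)" using w by simp
  moreover have g1: "geo (h / 2) < 1" using h by (intro geo_less_1) simp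
  ultimately have "ln (1 - geo (h / 2)) \<le> - K" by (metis diff_gt_0_iff_gt ln_exp ln_le_cancel_iff exp_gt_zero)
  moreover have "ln (1 - geo (- (h / 2))) \<le> 0"
  proof -
    have "geo (- (h / 2)) < 1" using h by (intro geo_less_1) simp
    then show ?thesis using geo_pos[of "- (h / 2)"] by (subst ln_le_zero_iff) (auto simp del: geo_pos simp: less_imp_le)
  qed
  moreover have "\<bar>h / 2\<bar> < \<beta> / 2" using h by simp
  ultimately have "c + K \<le> log_mgf \<beta> (h / 2)" by (simp add: log_mgf_eq c_def)
  moreover have "log_mgf \<beta> (h / 4) \<le> m" unfolding m_def using h by (intro log_mgf_mono) auto
  ultimately have "4 * \<beta> * \<bar>q\<bar> \<le> log_mgf \<beta> (h / 2) - log_mgf \<beta> (h / 4)" by (simp add: K_def)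
  moreover have "4 * h * \<bar>q\<bar> \<le> 4 * \<beta> * \<bar>q\<bar>" using h by (intro mult_right_mono) auto
  ultimately have "\<bar>q\<bar> \<le> (log_mgf \<beta> (h / 2) - log_mgf \<beta> (h / 4)) / (4 * h)"
    using h by (simp add: field_simps)
  then have "q \<le> G_prime h" using low[OF h(1,2)] by linarith
  then show ?thesis using h by blast
qed

text \<open>
  The intermediate value theorem gives a solution of \<open>G_prime h = q\<close>, and injectivity of the derivative
  identifies it with the value of the inverse.
\<close>

lemma h_tilde_props:
  assumes "0 < q"
  shows "0 < h_tilde \<beta> q" "h_tilde \<beta> q < \<beta>" "G_prime (h_tilde \<beta> q) = q"
proof -
  obtain h1 where h1: "0 < h1" "h1 < \<beta>" "q \<le> G_prime h1" using G_prime_unbounded by blast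
  have "continuous_on {0..h1} G_prime"
    by (rule continuous_on_subset[OF G_prime_continuous]) (use h1 beta_pos in auto)
  then obtain h where h: "0 \<le> h" "h \<le> h1" "G_prime h = q"
    using IVT'[of G_prime 0 q h1] G_prime_0 assms h1 by auto
  have hpos: "0 < h" using h G_prime_0 assms by (cases "h = 0") auto
  have hin: "h \<in> {- \<beta><..<\<beta>}" using h h1 hpos by auto
  have inj: "inj_on (deriv (G_fun \<beta>)) {- \<beta><..<\<beta>}"
  proof (rule linorder_inj_onI')
    fix x y assume xy: "x \<in> {- \<beta><..<\<beta>}" "y \<in> {- \<beta><..<\<beta>}" "x < y"
    then have "\<bar>x\<bar> < \<beta>" "\<bar>y\<bar> < \<beta>" by auto
    from G_prime_strict_mono[OF this xy(3)] show "deriv (G_fun \<beta>) x \<noteq> deriv (G_fun \<beta>) y"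
      using \<open>\<bar>x\<bar> < \<beta>\<close> \<open>\<bar>y\<bar> < \<beta>\<close> by (simp add: G_fun_deriv)
  qed
  have "\<bar>h\<bar> < \<beta>" using hin by auto
  then have "deriv (G_fun \<beta>) h = q" using h(3) by (simp add: G_fun_deriv)
  then have "h_tilde \<beta> q = h"
    unfolding h_tilde_def using the_inv_into_f_f[OF inj hin] by simp
  then show "0 < h_tilde \<beta> q" "h_tilde \<beta> q < \<beta>" "G_prime (h_tilde \<beta> q) = q"
    using hpos hin h by auto
qed

lemma h_tilde_mono:
  assumes "0 < p" "p \<le> q"
  shows "h_tilde \<beta> p \<le> h_tilde \<beta> q"
proof (rule ccontr)
  assume "\<not> h_tilde \<beta> p \<le> h_tilde \<beta> q"
  then have "G_prime (h_tilde \<beta> q) < G_prime (h_tilde \<beta> p)"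
    using h_tilde_props[of p] h_tilde_props[of q] assms by (intro G_prime_strict_mono) auto
  then show False using h_tilde_props[of p] h_tilde_props[of q] assms by auto
qed

text \<open>
  The limits of the normalised covariances of the sum and the weighted sum of the increments: the
  factor \<open>x\<^sup>p\<close> comes from the weights and \<open>cum2\<close> is the variance of an increment.
\<close>

definition moment :: "nat \<Rightarrow> real \<Rightarrow> real" where
  "moment p h = integral {0..1} (\<lambda>x. x ^ p * cum2 (h * (1 / 2 - x)))"

lemma moment_integrable: "\<bar>h\<bar> < \<beta> \<Longrightarrow> (\<lambda>x. x ^ p * cum2 (h * (1 / 2 - x))) integrable_on {0..1}"
  by (intro integrable_continuous_real continuous_intros abs_arg_less) auto

text \<open>
  The definition of \<open>theta\<close> evaluates the variance at \<open>h (x - 1/2)\<close> instead of \<open>h (1/2 - x)\<close>, which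
  is the same because the variance is an even function of the tilt.
\<close>

lemma theta_eq_moments:
  assumes "\<bar>h\<bar> < \<beta>"
  shows "theta \<beta> h = moment 0 h * moment 2 h - (moment 1 h)\<^sup>2"
proof -
  have "deriv (deriv (log_mgf \<beta>)) (h * (x - 1 / 2)) = cum2 (h * (1 / 2 - x))" if "x \<in> {0..1}" for x
  proof -
    have e: "h * (x - 1 / 2) = - (h * (1 / 2 - x))" by (simp add: algebra_simps)
    show ?thesis using abs_arg_less[OF that assms] unfolding e by (simp add: deriv2_log_mgf cum2_minus)
  qed
  then have i: "integral {0..1} (\<lambda>x. f x * deriv (deriv (log_mgf \<beta>)) (h * (x - 1 / 2))) = integral {0..1} (\<lambda>x. f x * cum2 (h * (1 / 2 - x)))" for f
    by (intro Henstock_Kurzweil_Integration.integral_cong) simp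
  show ?thesis
    using i[of "\<lambda>x. x\<^sup>2"] i[of "\<lambda>x. x"] i[of "\<lambda>_. 1"] unfolding theta_def moment_def by (simp add: mult.commute)
qed

text \<open>
  Since \<open>cum2\<close> is at least \<open>exp (- \<beta>)\<close>, the quadratic polynomial in \<open>m\<close> obtained by integrating
  \<open>(x - m)\<^sup>2\<close> against it is bounded below by a positive constant, so its discriminant is negative.
\<close>

lemma moment_pos:
  assumes "\<bar>h\<bar> < \<beta>"
  shows "0 < moment 2 h" "(moment 1 h)\<^sup>2 < moment 0 h * moment 2 h"
proof -
  have quad: "exp (- \<beta>) * (1 / 3 - m + m\<^sup>2) \<le> moment 2 h - 2 * m * moment 1 h + m\<^sup>2 * moment 0 h" for m
  proof -
    have "((\<lambda>x::real. exp (- \<beta>) * (x - m)\<^sup>2) has_integral exp (- \<beta>) * ((1 - m) ^ 3 / 3) - exp (- \<beta>) * ((0 - m) ^ 3 / 3)) {0..1}"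
      by (rule fundamental_theorem_of_calculus)
        (auto intro!: derivative_eq_intros simp: has_real_derivative_iff_has_vector_derivative[symmetric])
    moreover have "(1 - m) ^ 3 / 3 - (0 - m) ^ 3 / 3 = 1 / 3 - m + m\<^sup>2"
      by (simp add: power3_eq_cube power2_eq_square field_simps)
    ultimately have A: "((\<lambda>x::real. exp (- \<beta>) * (x - m)\<^sup>2) has_integral exp (- \<beta>) * (1 / 3 - m + m\<^sup>2)) {0..1}"
      by (simp only: right_diff_distrib[symmetric])
    have B: "((\<lambda>x. x\<^sup>2 * cum2 (h * (1 / 2 - x)) - 2 * m * (x ^ 1 * cum2 (h * (1 / 2 - x))) + m\<^sup>2 * (x ^ 0 * cum2 (h * (1 / 2 - x))))
        has_integral moment 2 h - 2 * m * moment 1 h + m\<^sup>2 * moment 0 h) {0..1}"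
      unfolding moment_def
      by (intro has_integral_add has_integral_diff has_integral_mult_right integrable_integral moment_integrable assms)
    show ?thesis
    proof (rule has_integral_le[OF A B])
      fix x :: real assume x: "x \<in> {0..1}"
      have "exp (- \<beta>) \<le> cum2 (h * (1 / 2 - x))" by (intro cum2_ge abs_arg_less x assms)
      then have "exp (- \<beta>) * (x - m)\<^sup>2 \<le> cum2 (h * (1 / 2 - x)) * (x - m)\<^sup>2" by (intro mult_right_mono) auto
      also have "\<dots> = x\<^sup>2 * cum2 (h * (1 / 2 - x)) - 2 * m * (x ^ 1 * cum2 (h * (1 / 2 - x))) + m\<^sup>2 * (x ^ 0 * cum2 (h * (1 / 2 - x)))"
        by (simp add: power2_eq_square algebra_simps)
      finally show "exp (- \<beta>) * (x - m)\<^sup>2 \<le> x\<^sup>2 * cum2 (h * (1 / 2 - x)) - 2 * m * (x ^ 1 * cum2 (h * (1 / 2 - x))) + m\<^sup>2 * (x ^ 0 * cum2 (h * (1 / 2 - x)))" .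
    qed
  qed
  have "exp (- \<beta>) * (1 / 3) \<le> moment 2 h" using quad[of 0] by simp
  moreover have "0 < exp (- \<beta>)" by simp
  ultimately show "0 < moment 2 h" by linarith
  have "integral {0..1} (\<lambda>x::real. exp (- \<beta>)) \<le> moment 0 h"
    unfolding moment_def using moment_integrable[OF assms, of 0]
    by (intro integral_le) (auto intro!: cum2_ge abs_arg_less assms)
  then have "exp (- \<beta>) \<le> moment 0 h" by simp
  then have A0: "0 < moment 0 h" using exp_gt_zero[of "-\<beta>"] by linarith
  \<comment> \<open>the minimiser of the quadratic polynomial\<close>
  define m where "m = moment 1 h / moment 0 h"
  have "0 < 1 / 3 - m + m\<^sup>2"
  proof -
    have "1 / 3 - m + m\<^sup>2 = (m - 1 / 2)\<^sup>2 + 1 / 12" by (simp add: power2_eq_square field_simps)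
    then show ?thesis using zero_le_power2[of "m - 1 / 2"] by linarith
  qed
  then have "0 < exp (- \<beta>) * (1 / 3 - m + m\<^sup>2)" by simp
  then have "0 < moment 2 h - 2 * m * moment 1 h + m\<^sup>2 * moment 0 h" using quad[of m] by linarith
  also have "\<dots> = moment 2 h - (moment 1 h)\<^sup>2 / moment 0 h"
    using A0 by (simp add: m_def power2_eq_square field_simps)
  finally show "(moment 1 h)\<^sup>2 < moment 0 h * moment 2 h" using A0 by (simp add: field_simps)
qed

lemma theta_pos: "\<bar>h\<bar> < \<beta> \<Longrightarrow> 0 < theta \<beta> h"
  using moment_pos[of h] by (simp add: theta_eq_moments)

lemma theta_continuous: "continuous_on {- \<beta><..<\<beta>} (theta \<beta>)"
proof -
  have m: "continuous_on {- \<beta><..<\<beta>} (moment p)" for p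
  proof -
    have "continuous_on ({- \<beta><..<\<beta>} \<times> cbox 0 1) (\<lambda>(h, x). x ^ p * cum2 (h * (1 / 2 - x)))"
      unfolding case_prod_unfold by (intro continuous_intros abs_arg_less) (auto simp: cbox_interval)
    from integral_continuous_on_param[OF this] show ?thesis
      unfolding moment_def[abs_def] cbox_interval .
  qed
  have "continuous_on {- \<beta><..<\<beta>} (\<lambda>h. moment 0 h * moment 2 h - (moment 1 h)\<^sup>2)"
    by (intro continuous_intros m)
  then show ?thesis
    by (rule continuous_on_eq) (auto simp: theta_eq_moments abs_less_iff)
qed

end


section \<open>The tilted bridge\<close>

text \<open>
  The increment with index \<open>i\<close> contributes to the positions at times \<open>i + 1, \<dots>, n\<close>.
\<close>

lemma area_walk: "area n (walk \<xi>) = (\<Sum>i<n. (int n - int i) * \<xi> i)"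
proof (induction n)
  case (Suc n)
  have "area (Suc n) (walk \<xi>) = area n (walk \<xi>) + (\<Sum>i<Suc n. \<xi> i)"
    by (simp add: area_def walk_def)
  also have "area n (walk \<xi>) = (\<Sum>i<Suc n. (int n - int i) * \<xi> i)" using Suc by simp
  also have "\<dots> + (\<Sum>i<Suc n. \<xi> i) = (\<Sum>i<Suc n. (int (Suc n) - int i) * \<xi> i)"
    unfolding sum.distrib[symmetric] by (intro sum.cong refl) (simp add: algebra_simps)
  finally show ?case .
qed (simp add: area_def)

context laplace_walk begin

text \<open>
  The tilts decrease linearly from about \<open>h/2\<close> to about \<open>- h/2\<close>.  The half-integer shift makes them
  antisymmetric under time reversal and turns sums over \<open>i\<close> into midpoint rules.
\<close>

definition tilt :: "real \<Rightarrow> nat \<Rightarrow> nat \<Rightarrow> real" where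
  "tilt h N i = h * (1 / 2 - (real i + 1 / 2) / real N)"

definition increments :: "real \<Rightarrow> nat \<Rightarrow> nat set \<Rightarrow> (nat \<Rightarrow> int) pmf" where
  "increments h N A = Pi_pmf A 0 (\<lambda>i. tilted_step \<beta> (tilt h N i))"

definition bridge :: "nat \<Rightarrow> nat \<Rightarrow> (nat \<Rightarrow> int) \<Rightarrow> bool" where
  "bridge N k \<xi> \<longleftrightarrow> (\<Sum>i<N. \<xi> i) = 0 \<and> (\<Sum>i<N. (int N - int i) * \<xi> i) = int k"

lemma abs_tilt_le:
  assumes "i < N"
  shows "\<bar>tilt h N i\<bar> \<le> \<bar>h\<bar> / 2"
proof -
  have "(real i + 1 / 2) / real N \<le> 1" "0 \<le> (real i + 1 / 2) / real N"
    using assms by (auto simp: divide_le_eq_1)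
  then have "\<bar>1 / 2 - (real i + 1 / 2) / real N\<bar> \<le> 1 / 2" by linarith
  then show ?thesis unfolding tilt_def abs_mult
    using mult_left_mono[of "\<bar>1 / 2 - (real i + 1 / 2) / real N\<bar>" "1 / 2" "\<bar>h\<bar>"] by simp
qed

lemma abs_tilt_less: "i < N \<Longrightarrow> \<bar>h\<bar> < \<beta> \<Longrightarrow> \<bar>tilt h N i\<bar> < \<beta> / 2"
  using abs_tilt_le[of i N h] by linarith

lemma tilt_reflect:
  assumes "i < N"
  shows "tilt h N (N - 1 - i) = - tilt h N i"
proof -
  have "real (N - 1 - i) = real N - 1 - real i" using assms by auto
  then show ?thesis using assms unfolding tilt_def by (simp add: field_simps)
qed

text \<open>
  The sum of the \<open>t\<^sub>i \<xi>\<^sub>i\<close> equals \<open>h / N\<close> times the area minus \<open>h (N + 1) / (2 N)\<close> times the endpoint,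
  which is \<open>h k / N\<close> on bridges.
\<close>

lemma prob_excursions_eq:
  assumes "\<bar>h\<bar> < \<beta>" "0 < N"
  shows "measure (walk_law (P_step \<beta>)) (excursions N k)
    = exp ((\<Sum>i<N. log_mgf \<beta> (tilt h N i)) - h * real k / real N)
      * measure_pmf.prob (increments h N {..<N}) {\<xi>. bridge N k \<xi> \<and> (\<forall>i. 0 < i \<and> i < N \<longrightarrow> walk \<xi> i > 0)}"
proof -
  define E where "E = {\<xi>. bridge N k \<xi> \<and> (\<forall>i. 0 < i \<and> i < N \<longrightarrow> walk \<xi> i > 0)}"
  have "measure (walk_law (P_step \<beta>)) {X. X N = 0 \<and> area N X = int k \<and> (\<forall>i. 0 < i \<and> i < N \<longrightarrow> X i > 0)}
      = measure_pmf.prob (Pi_pmf {..<N} 0 (\<lambda>_. P_step \<beta>))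
         {\<xi>. walk \<xi> N = 0 \<and> area N (walk \<xi>) = int k \<and> (\<forall>i. 0 < i \<and> i < N \<longrightarrow> walk \<xi> i > 0)}"
  proof (rule measure_walk_law_eq)
    show "{X. X N = 0 \<and> area N X = int k \<and> (\<forall>i. 0 < i \<and> i < N \<longrightarrow> X i > 0)} \<in> sets (walk_law (P_step \<beta>))"
      using excursions_measurable[of N k] by (simp add: excursions_def)
    fix X Y :: "nat \<Rightarrow> int" assume XY: "\<And>i. i \<le> N \<Longrightarrow> X i = Y i"
    then have "area N X = area N Y" unfolding area_def by (intro sum.cong) auto
    then show "(X N = 0 \<and> area N X = int k \<and> (\<forall>i. 0 < i \<and> i < N \<longrightarrow> X i > 0)) = (Y N = 0 \<and> area N Y = int k \<and> (\<forall>i. 0 < i \<and> i < N \<longrightarrow> Y i > 0))"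
      using XY by auto
  qed fact
  also have "{\<xi>. walk \<xi> N = 0 \<and> area N (walk \<xi>) = int k \<and> (\<forall>i. 0 < i \<and> i < N \<longrightarrow> walk \<xi> i > 0)} = E"
    unfolding E_def bridge_def area_walk by (auto simp: walk_def)
  also have "measure_pmf.prob (Pi_pmf {..<N} 0 (\<lambda>_. P_step \<beta>)) E
      = exp ((\<Sum>i<N. log_mgf \<beta> (tilt h N i)) - h * real k / real N) * measure_pmf.prob (increments h N {..<N}) E"
    unfolding increments_def
  proof (rule prob_tilt)
    fix \<xi> assume "\<xi> \<in> E"
    then have b: "(\<Sum>i<N. \<xi> i) = 0" "(\<Sum>i<N. (int N - int i) * \<xi> i) = int k"
      by (auto simp: E_def bridge_def)
    have "(\<Sum>i<N. tilt h N i * of_int (\<xi> i)) = (\<Sum>i<N. h / real N * of_int ((int N - int i) * \<xi> i) - h * (real N + 1) / (2 * real N) * of_int (\<xi> i))"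
      using assms(2) by (intro sum.cong refl) (simp add: tilt_def field_simps)
    also have "\<dots> = h / real N * of_int (\<Sum>i<N. (int N - int i) * \<xi> i) - h * (real N + 1) / (2 * real N) * of_int (\<Sum>i<N. \<xi> i)"
      by (simp only: sum_subtractf sum_distrib_left of_int_sum)
    finally show "(\<Sum>i<N. tilt h N i * of_int (\<xi> i)) = h * real k / real N"
      unfolding b by simp
  qed (use abs_tilt_less assms in auto)
  finally show ?thesis by (simp add: excursions_def E_def)
qed

text \<open>
  Conditionally on the increments with index in \<open>A\<close>, being a bridge prescribes the sum and the
  weighted sum of the remaining block.
\<close>

lemma prob_bridge_block:
  assumes AB: "A \<inter> {m..<m+n} = {}" "A \<union> {m..<m+n} = {..<N}"
    and E: "\<And>\<xi> \<xi>'. (\<And>i. i \<in> A \<Longrightarrow> \<xi> i = \<xi>' i) \<Longrightarrow> E \<xi> = E \<xi>'"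
  shows "measure_pmf.prob (increments h N {..<N}) {\<xi>. E \<xi> \<and> bridge N k \<xi>}
    = measure_pmf.expectation (increments h N A) (\<lambda>\<xi>. indicator {\<xi>. E \<xi>} \<xi>
        * hit m n (tilt h N) (- (\<Sum>i\<in>A. \<xi> i))
            ((int N - int m) * - (\<Sum>i\<in>A. \<xi> i) - (int k - (\<Sum>i\<in>A. (int N - int i) * \<xi> i))))"
proof -
  define B where "B = {m..<m+n}"
  have fin: "finite A" "finite B"
    using AB(2) finite_subset[of A "{..<N}"] by (auto simp: B_def)
  have sums: "(\<Sum>i<N. f i) = (\<Sum>i\<in>A. f i) + (\<Sum>i\<in>B. f i)" for f :: "nat \<Rightarrow> int"
    unfolding AB(2)[symmetric] B_def[symmetric] using fin AB(1) by (intro sum.union_disjoint) (auto simp: B_def)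
  have "measure_pmf.prob (increments h N (A \<union> B)) {\<xi>. E \<xi> \<and> bridge N k \<xi>}
     = measure_pmf.expectation (increments h N A) (\<lambda>\<xi>. measure_pmf.prob (increments h N B)
         {\<eta>. E (\<lambda>i. if i \<in> A then \<xi> i else \<eta> i) \<and> bridge N k (\<lambda>i. if i \<in> A then \<xi> i else \<eta> i)})"
    unfolding increments_def using fin AB(1) by (intro prob_Pi_pmf_Un) (auto simp: B_def)
  also have "(\<lambda>\<xi>. measure_pmf.prob (increments h N B)
         {\<eta>. E (\<lambda>i. if i \<in> A then \<xi> i else \<eta> i) \<and> bridge N k (\<lambda>i. if i \<in> A then \<xi> i else \<eta> i)})
     = (\<lambda>\<xi>. indicator {\<xi>. E \<xi>} \<xi>
        * hit m n (tilt h N) (- (\<Sum>i\<in>A. \<xi> i))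
            ((int N - int m) * - (\<Sum>i\<in>A. \<xi> i) - (int k - (\<Sum>i\<in>A. (int N - int i) * \<xi> i))))"
  proof
    fix \<xi> :: "nat \<Rightarrow> int"
    have e: "E (\<lambda>i. if i \<in> A then \<xi> i else \<eta> i) = E \<xi>" for \<eta> by (rule E) auto
    have bA: "(\<Sum>i\<in>A. f i (if i \<in> A then \<xi> i else \<eta> i)) = (\<Sum>i\<in>A. f i (\<xi> i))" for \<eta> and f :: "nat \<Rightarrow> int \<Rightarrow> int"
      by (intro sum.cong) auto
    have bB: "(\<Sum>i\<in>B. f i (if i \<in> A then \<xi> i else \<eta> i)) = (\<Sum>i\<in>B. f i (\<eta> i))" for \<eta> and f :: "nat \<Rightarrow> int \<Rightarrow> int"
      using AB(1) by (intro sum.cong) (auto simp: B_def)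
    have w: "(\<Sum>i\<in>B. (int i - int m) * \<eta> i) = (int N - int m) * (\<Sum>i\<in>B. \<eta> i) - (\<Sum>i\<in>B. (int N - int i) * \<eta> i)" for \<eta>
      by (simp add: sum_distrib_left sum_subtractf[symmetric] algebra_simps)
    have "bridge N k (\<lambda>i. if i \<in> A then \<xi> i else \<eta> i) \<longleftrightarrow>
       (\<Sum>i\<in>B. \<eta> i) = - (\<Sum>i\<in>A. \<xi> i) \<and> (\<Sum>i\<in>B. (int i - int m) * \<eta> i) = (int N - int m) * - (\<Sum>i\<in>A. \<xi> i) - (int k - (\<Sum>i\<in>A. (int N - int i) * \<xi> i))" for \<eta>
      unfolding bridge_def sums w
      using bA[of "\<lambda>_ x. x" \<eta>] bB[of "\<lambda>_ x. x" \<eta>] bA[of "\<lambda>i x. (int N - int i) * x" \<eta>] bB[of "\<lambda>i x. (int N - int i) * x" \<eta>]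
      by (intro conj_cong) auto
    then show "measure_pmf.prob (increments h N B)
         {\<eta>. E (\<lambda>i. if i \<in> A then \<xi> i else \<eta> i) \<and> bridge N k (\<lambda>i. if i \<in> A then \<xi> i else \<eta> i)}
       = indicator {\<xi>. E \<xi>} \<xi> * hit m n (tilt h N) (- (\<Sum>i\<in>A. \<xi> i))
            ((int N - int m) * - (\<Sum>i\<in>A. \<xi> i) - (int k - (\<Sum>i\<in>A. (int N - int i) * \<xi> i)))"
      unfolding e hit_def increments_def[symmetric] B_def[symmetric] by (simp add: indicator_def)
  qed
  finally show ?thesis unfolding B_def AB(2) .
qed

lemma hit_nonneg: "0 \<le> hit m n \<tau> x a"
  by (simp add: hit_def)

lemma prob_bridge_block_le:
  "\<exists>C>0. \<forall>h N A m n E k. \<bar>h\<bar> < \<beta> \<longrightarrow> A \<inter> {m..<m+n} = {} \<longrightarrow> A \<union> {m..<m+n} = {..<N} \<longrightarrow> 0 < n \<longrightarrow>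
     (\<forall>\<xi> \<xi>'. (\<forall>i\<in>A. \<xi> i = \<xi>' i) \<longrightarrow> E \<xi> = E \<xi>') \<longrightarrow>
     measure_pmf.prob (increments h N {..<N}) {\<xi>. E \<xi> \<and> bridge N k \<xi>}
       \<le> C / (real n)\<^sup>2 * measure_pmf.prob (increments h N A) {\<xi>. E \<xi>}"
proof -
  obtain C where C: "C > 0" "\<And>m n \<tau> x a. (\<forall>j\<in>{m..<m+n}. \<bar>\<tau> j\<bar> < \<beta> / 2) \<Longrightarrow> 0 < n \<Longrightarrow> hit m n \<tau> x a \<le> C / (real n)\<^sup>2"
    using hit_le by blast
  have "measure_pmf.prob (increments h N {..<N}) {\<xi>. E \<xi> \<and> bridge N k \<xi>}
       \<le> C / (real n)\<^sup>2 * measure_pmf.prob (increments h N A) {\<xi>. E \<xi>}"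
    if h: "\<bar>h\<bar> < \<beta>" and AB: "A \<inter> {m..<m+n} = {}" "A \<union> {m..<m+n} = {..<N}" and n: "0 < n"
      and E: "\<forall>\<xi> \<xi>'. (\<forall>i\<in>A. \<xi> i = \<xi>' i) \<longrightarrow> E \<xi> = E \<xi>'" for h N A m n E k
  proof -
    define H where "H \<xi> = hit m n (tilt h N) (- (\<Sum>i\<in>A. \<xi> i))
            ((int N - int m) * - (\<Sum>i\<in>A. \<xi> i) - (int k - (\<Sum>i\<in>A. (int N - int i) * \<xi> i)))" for \<xi>
    have t: "\<forall>j\<in>{m..<m+n}. \<bar>tilt h N j\<bar> < \<beta> / 2"
    proof
      fix j assume "j \<in> {m..<m+n}"
      then have "j \<in> {..<N}" using AB(2) by blast
      then show "\<bar>tilt h N j\<bar> < \<beta> / 2" using h abs_tilt_less by simp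
    qed
    have H: "0 \<le> H \<xi>" "H \<xi> \<le> C / (real n)\<^sup>2" for \<xi>
      unfolding H_def using hit_nonneg C(2)[OF t n] by auto
    have "measure_pmf.prob (increments h N {..<N}) {\<xi>. E \<xi> \<and> bridge N k \<xi>}
       = measure_pmf.expectation (increments h N A) (\<lambda>\<xi>. indicator {\<xi>. E \<xi>} \<xi> * H \<xi>)"
      unfolding H_def by (rule prob_bridge_block[OF AB]) (use E in blast)
    also have "\<dots> \<le> measure_pmf.expectation (increments h N A) (\<lambda>\<xi>. C / (real n)\<^sup>2 * indicator {\<xi>. E \<xi>} \<xi>)"
    proof (rule integral_mono)
      show "integrable (increments h N A) (\<lambda>\<xi>. indicator {\<xi>. E \<xi>} \<xi> * H \<xi>)"
        by (rule measure_pmf.integrable_const_bound[where B = "C / (real n)\<^sup>2"]) (use H C(1) in \<open>auto simp: indicator_def\<close>)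
      show "integrable (increments h N A) (\<lambda>\<xi>. C / (real n)\<^sup>2 * indicator {\<xi>. E \<xi>} \<xi>)"
        by (rule measure_pmf.integrable_const_bound[where B = "C / (real n)\<^sup>2"]) (use C(1) in \<open>auto simp: indicator_def\<close>)
      show "indicator {\<xi>. E \<xi>} \<xi> * H \<xi> \<le> C / (real n)\<^sup>2 * indicator {\<xi>. E \<xi>} \<xi>" for \<xi>
        using H(2)[of \<xi>] by (simp add: indicator_def)
    qed
    also have "\<dots> = C / (real n)\<^sup>2 * measure_pmf.prob (increments h N A) {\<xi>. E \<xi>}"
      by (subst integral_mult_right_zero) simp
    finally show ?thesis .
  qed
  with C(1) show ?thesis by blast
qed

lemma norm_geo_real: "norm (geo (t::real)) = geo t"
  by (simp add: geo_def)

lemma expectation_exp_tilted: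
  assumes "\<bar>t\<bar> < \<beta> / 2" "\<bar>t + s\<bar> < \<beta> / 2"
  shows "integrable (tilted_step \<beta> t) (\<lambda>k. exp (s * of_int k))"
    and "measure_pmf.expectation (tilted_step \<beta> t) (\<lambda>k. exp (s * of_int k)) = exp (log_mgf \<beta> (t + s) - log_mgf \<beta> t)"
proof -
  have g: "norm (geo (of_real t + s)) < 1" "norm (geo (- (of_real t + s))) < 1"
  proof -
    have "t + s < \<beta> / 2" "- (t + s) < \<beta> / 2" using assms by linarith+
    from this[THEN geo_less_1] show "norm (geo (of_real t + s)) < 1" "norm (geo (- (of_real t + s))) < 1"
      by (simp_all only: norm_geo_real of_real_eq_id id_apply)
  qed
  show "integrable (tilted_step \<beta> t) (\<lambda>k. exp (s * of_int k))"
    by (rule expectation_tilted_step(1)[OF assms(1) g])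
  show "measure_pmf.expectation (tilted_step \<beta> t) (\<lambda>k. exp (s * of_int k)) = exp (log_mgf \<beta> (t + s) - log_mgf \<beta> t)"
    using expectation_tilted_step(2)[OF assms(1) g] exp_log_mgf[OF assms(1)] exp_log_mgf[OF assms(2)]
    by (simp add: exp_diff)
qed

text \<open>
  The exponential Markov inequality.
\<close>

lemma prob_sum_ge_le:
  fixes A :: "'i set"
  assumes "finite A" "\<And>i. i \<in> A \<Longrightarrow> \<bar>\<tau> i\<bar> < \<beta> / 2" "\<And>i. i \<in> A \<Longrightarrow> \<bar>\<tau> i + s\<bar> < \<beta> / 2"
  shows "measure_pmf.prob (Pi_pmf A 0 (\<lambda>i. tilted_step \<beta> (\<tau> i))) {\<xi>. b \<le> s * of_int (\<Sum>i\<in>A. \<xi> i)}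
    \<le> exp (- b) * exp (\<Sum>i\<in>A. log_mgf \<beta> (\<tau> i + s) - log_mgf \<beta> (\<tau> i))"
proof -
  define D where "D = Pi_pmf A (0::int) (\<lambda>i. tilted_step \<beta> (\<tau> i))"
  have int: "integrable D (\<lambda>\<xi>. \<Prod>i\<in>A. exp (s * of_int (\<xi> i)))"
    unfolding D_def using assms by (intro integrable_prod_Pi_pmf expectation_exp_tilted)
  have "measure_pmf.prob D {\<xi>. b \<le> s * of_int (\<Sum>i\<in>A. \<xi> i)} = measure_pmf.expectation D (indicator {\<xi>. b \<le> s * of_int (\<Sum>i\<in>A. \<xi> i)})"
    by simp
  also have "\<dots> \<le> measure_pmf.expectation D (\<lambda>\<xi>. exp (- b) * (\<Prod>i\<in>A. exp (s * of_int (\<xi> i))))"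
  proof (rule integral_mono)
    show "integrable D (\<lambda>\<xi>. exp (- b) * (\<Prod>i\<in>A. exp (s * of_int (\<xi> i))))"
      using int by (rule integrable_mult_right)
    fix \<xi> :: "'i \<Rightarrow> int"
    have "(\<Prod>i\<in>A. exp (s * of_int (\<xi> i))) = exp (s * of_int (\<Sum>i\<in>A. \<xi> i))"
      using assms(1) by (simp add: exp_sum[symmetric] sum_distrib_left)
    then show "indicator {\<xi>. b \<le> s * of_int (\<Sum>i\<in>A. \<xi> i)} \<xi> \<le> exp (- b) * (\<Prod>i\<in>A. exp (s * of_int (\<xi> i)))"
      by (simp add: indicator_def exp_add[symmetric])
  qed (auto intro!: measure_pmf.integrable_const_bound[where B = 1])
  also have "\<dots> = exp (- b) * (\<Prod>i\<in>A. measure_pmf.expectation (tilted_step \<beta> (\<tau> i)) (\<lambda>k. exp (s * of_int k)))"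
    unfolding integral_mult_right_zero D_def using assms
    by (subst expectation_prod_Pi_pmf_banach) (auto intro!: expectation_exp_tilted)
  also have "\<dots> = exp (- b) * exp (\<Sum>i\<in>A. log_mgf \<beta> (\<tau> i + s) - log_mgf \<beta> (\<tau> i))"
    using assms by (simp add: expectation_exp_tilted exp_sum)
  finally show ?thesis by (simp add: D_def)
qed

lemma log_mgf_shift_le:
  assumes "\<bar>t\<bar> < \<beta> / 2" "\<bar>t - s\<bar> < \<beta> / 2" "0 < s"
  shows "log_mgf \<beta> (t - s) - log_mgf \<beta> t \<le> - s * cum1 (t - s)"
proof -
  have "\<exists>z. t - s < z \<and> z < t \<and> log_mgf \<beta> t - log_mgf \<beta> (t - s) = (t - (t - s)) * cum1 z"
  proof (rule MVT2)
    show "(log_mgf \<beta> has_real_derivative cum1 z) (at z)" if "t - s \<le> z" "z \<le> t" for z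
      by (rule DERIV_log_mgf) (use assms that in linarith)
  qed (use assms in simp)
  then obtain z where z: "t - s < z" "z < t" "log_mgf \<beta> t - log_mgf \<beta> (t - s) = s * cum1 z" by auto
  have "\<bar>z\<bar> < \<beta> / 2" using z assms by linarith
  then have "cum1 (t - s) \<le> cum1 z" using z assms by (intro cum1_mono) auto
  then have "s * cum1 (t - s) \<le> s * cum1 z" using assms by simp
  then show ?thesis using z(3) by simp
qed

text \<open>
  Pairing \<open>i\<close> with \<open>m - 1 - i\<close>: at least one of the two lies in the first half.
\<close>

lemma sum_half_le:
  fixes f :: "nat \<Rightarrow> real"
  assumes "\<And>i. i < m \<Longrightarrow> f i \<le> b" "\<And>i. i < m \<Longrightarrow> 2 * i < m \<Longrightarrow> f i \<le> a" "a \<le> b"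
  shows "2 * (\<Sum>i<m. f i) \<le> real m * (a + b)"
proof -
  have "2 * (\<Sum>i<m. f i) = (\<Sum>i<m. f i) + (\<Sum>i<m. f (m - Suc i))"
    by (simp add: sum.nat_diff_reindex)
  also have "\<dots> = (\<Sum>i<m. f i + f (m - Suc i))" by (simp add: sum.distrib)
  also have "\<dots> \<le> (\<Sum>i<m. a + b)"
  proof (rule sum_mono)
    fix i assume i: "i \<in> {..<m}"
    show "f i + f (m - Suc i) \<le> a + b"
    proof (cases "2 * i < m")
      case True
      then show ?thesis using assms(2)[of i] assms(1)[of "m - Suc i"] i by auto
    next
      case False
      then have "2 * (m - Suc i) < m" using i by auto
      then show ?thesis using assms(2)[of "m - Suc i"] assms(1)[of i] i by auto
    qed
  qed
  finally show ?thesis by simp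
qed

text \<open>
  The exponential rate obtained from the exponential Markov inequality with parameter \<open>\<eta> / 16\<close> when all tilt parameters
  \<open>h\<close> are at least \<open>\<eta>\<close>: among the first \<open>m \<le> N/2\<close> increments those in the first half gain at least
  \<open>cum1 (\<eta> / 8)\<close> and the others lose at most \<open>cum1 (\<eta> / 16)\<close>, each multiplied by \<open>\<eta> / 16\<close>.
\<close>

definition decay_rate :: "real \<Rightarrow> real" where
  "decay_rate \<eta> = \<eta> / 16 * (cum1 (\<eta> / 8) - cum1 (\<eta> / 16)) / 2"

lemma decay_rate_pos:
  assumes "0 < \<eta>" "\<eta> < \<beta>"
  shows "0 < decay_rate \<eta>"
proof -
  have "cum1 (\<eta> / 16) + exp (- \<beta>) * (\<eta> / 8 - \<eta> / 16) \<le> cum1 (\<eta> / 8)"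
    using assms by (intro cum1_increment_ge) auto
  moreover have "0 < exp (- \<beta>) * (\<eta> / 8 - \<eta> / 16)" using assms by simp
  ultimately have "0 < cum1 (\<eta> / 8) - cum1 (\<eta> / 16)" by linarith
  then show ?thesis using assms unfolding decay_rate_def by (intro divide_pos_pos mult_pos_pos) auto
qed

text \<open>
  The increments with \<open>2 i < m\<close> have tilt at least \<open>\<eta> / 4\<close>, which stays above \<open>\<eta> / 8\<close> after the shift
  by \<open>\<eta> / 16\<close>.  The others have nonnegative tilt, so shifting costs at most the slope at \<open>- \<eta> / 16\<close>.
\<close>

lemma sum_log_mgf_shift_le:
  assumes h: "0 < \<eta>" "\<eta> \<le> h" "h < \<beta>" and m: "2 * m \<le> N"
  shows "(\<Sum>i<m. log_mgf \<beta> (tilt h N i - \<eta> / 16) - log_mgf \<beta> (tilt h N i)) \<le> - decay_rate \<eta> * real m"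
proof (cases "m = 0")
  case False
  define s where "s = \<eta> / 16"
  define f where "f i = log_mgf \<beta> (tilt h N i - s) - log_mgf \<beta> (tilt h N i)" for i
  have N: "0 < N" using False m by auto
  have s: "0 < s" "s < \<beta> / 2" using h by (auto simp: s_def)
  have t0: "0 \<le> tilt h N i" "tilt h N i < \<beta> / 2" if "i < m" for i
  proof -
    have "2 * real i + 1 \<le> real N" using that m by linarith
    then have "(real i + 1 / 2) / real N \<le> 1 / 2" using N by (simp add: field_simps)
    then show "0 \<le> tilt h N i" unfolding tilt_def using h by (intro mult_nonneg_nonneg) auto
    show "tilt h N i < \<beta> / 2" using abs_tilt_less[of i N h] that m h by linarith
  qed
  have t1: "\<eta> / 4 \<le> tilt h N i" if "2 * i < m" for i
  proof -
    have i: "2 * real i + 1 \<le> real m" "2 * real m \<le> real N" using that m by linarith+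
    have "(real i + 1 / 2) / real N \<le> 1 / 4" using i N by (simp add: field_simps)
    then have "\<eta> * (1 / 4) \<le> h * (1 / 2 - (real i + 1 / 2) / real N)"
      using h by (intro mult_mono) auto
    then show ?thesis by (simp add: tilt_def)
  qed
  have "2 * (\<Sum>i<m. f i) \<le> real m * (- s * cum1 (\<eta> / 8) + s * cum1 (\<eta> / 16))"
  proof (rule sum_half_le)
    fix i assume i: "i < m"
    have ts: "\<bar>tilt h N i\<bar> < \<beta> / 2" "\<bar>tilt h N i - s\<bar> < \<beta> / 2" using t0[OF i] s by linarith+
    have fi: "f i \<le> - s * cum1 (tilt h N i - s)"
      unfolding f_def using ts s by (intro log_mgf_shift_le) auto
    have "cum1 (- s) \<le> cum1 (tilt h N i - s)"
      using t0[OF i] s ts by (intro cum1_mono) auto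
    then have "s * - cum1 s \<le> s * cum1 (tilt h N i - s)"
      unfolding cum1_minus using s by (intro mult_left_mono) auto
    then show "f i \<le> s * cum1 (\<eta> / 16)" using fi by (simp add: s_def)
    assume "2 * i < m"
    from t1[OF this] have "cum1 (\<eta> / 8) \<le> cum1 (tilt h N i - s)"
      using t0[OF i] s h ts by (intro cum1_mono) (auto simp: s_def)
    then have "s * cum1 (\<eta> / 8) \<le> s * cum1 (tilt h N i - s)"
      using s by (intro mult_left_mono) auto
    then show "f i \<le> - s * cum1 (\<eta> / 8)" using fi by simp
  next
    have "cum1 (0::real) \<le> cum1 (\<eta> / 8)" "cum1 (0::real) \<le> cum1 (\<eta> / 16)"
      using h by (intro cum1_mono; simp)+
    then have "0 \<le> s * cum1 (\<eta> / 8)" "0 \<le> s * cum1 (\<eta> / 16)" using s by auto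
    then show "- s * cum1 (\<eta> / 8) \<le> s * cum1 (\<eta> / 16)" by simp
  qed
  moreover have "real m * (- s * cum1 (\<eta> / 8) + s * cum1 (\<eta> / 16)) = - 2 * (decay_rate \<eta> * real m)"
    by (simp add: decay_rate_def s_def field_simps)
  ultimately show ?thesis by (simp add: f_def s_def mult.commute)
qed simp

end


section \<open>Positivity away from the two ends\<close>

text \<open>
  The usual exchange of the limits in \<open>k\<close> and \<open>M\<close> under an error that is uniform in \<open>k\<close>.
\<close>

lemma tendsto_interchange:
  fixes a :: "nat \<Rightarrow> nat \<Rightarrow> real"
  assumes a: "\<And>M. (a M) \<longlonglongrightarrow> b M" and b: "b \<longlonglongrightarrow> L"
    and close: "\<And>M. \<forall>\<^sub>F k in sequentially. \<bar>a M k - c k\<bar> \<le> e M" and e: "e \<longlonglongrightarrow> 0"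
  shows "c \<longlonglongrightarrow> L"
proof (rule tendstoI)
  fix r :: real assume r: "0 < r"
  have "\<forall>\<^sub>F M in sequentially. dist (b M) L < r / 3" "\<forall>\<^sub>F M in sequentially. dist (e M) 0 < r / 3"
    using b e r by (auto dest: tendstoD[where e = "r / 3"])
  then have "\<forall>\<^sub>F M in sequentially. dist (b M) L < r / 3 \<and> dist (e M) 0 < r / 3" by (rule eventually_conj)
  then obtain M where M: "dist (b M) L < r / 3" "dist (e M) 0 < r / 3" by (rule eventually_happens'[rotated, THEN exE]) auto
  have "\<forall>\<^sub>F k in sequentially. dist (a M k) (b M) < r / 3"
    using a[of M] r by (auto dest: tendstoD[where e = "r / 3"])
  with close[of M] show "\<forall>\<^sub>F k in sequentially. dist (c k) L < r"
  proof eventually_elim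
    case (elim k)
    then show ?case using M unfolding dist_real_def by linarith
  qed
qed

lemma suminf_geometric_tail:
  fixes r :: real
  assumes "0 \<le> r" "r < 1"
  shows "(\<lambda>m. r ^ (m + k)) sums (r ^ k / (1 - r))"
  using sums_mult[OF geometric_sums[of r], of "r ^ k"] assms by (simp add: power_add mult.commute)

context laplace_walk begin

lemma log_mgf_pos:
  assumes "0 < t" "t < \<beta> / 2"
  shows "0 < log_mgf \<beta> t"
proof -
  have "log_mgf \<beta> 0 < log_mgf \<beta> t"
  proof (rule DERIV_pos_imp_increasing_open[OF assms(1)])
    fix x assume x: "0 < x" "x < t"
    have b: "\<bar>x\<bar> < \<beta> / 2" using x assms by auto
    have "cum1 0 + exp (- \<beta>) * (x - 0) \<le> cum1 x" using b x beta_pos by (intro cum1_increment_ge) auto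
    moreover have "0 < exp (- \<beta>) * x" using x by simp
    ultimately show "\<exists>y. (log_mgf \<beta> has_real_derivative y) (at x) \<and> 0 < y"
      using DERIV_log_mgf[OF b] by auto
  next
    show "continuous_on {0..t} (log_mgf \<beta>)"
      using continuous_on_cum(3)[of "{0..t}" "\<lambda>x. x"] assms by auto
  qed
  then show ?thesis by (simp add: log_mgf_0)
qed

text \<open>
  For \<open>m \<le> N/2\<close> the first \<open>m\<close> increments supply the exponential factor and the remaining ones, at least
  \<open>N/2\<close> in number, the factor \<open>C / N\<^sup>2\<close>.  For \<open>m > N/2\<close> the roles are exchanged: on a bridge the walk is
  nonpositive at \<open>m\<close> exactly if the increments after \<open>m\<close> have nonnegative sum, and these have the
  reflected tilts.
\<close>

lemma prob_bridge_return_le: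
  assumes \<eta>: "0 < \<eta>" "\<eta> < \<beta>"
  shows "\<exists>C>0. \<forall>h N m k. \<eta> \<le> h \<longrightarrow> h < \<beta> \<longrightarrow> 0 < m \<longrightarrow> m < N \<longrightarrow>
    measure_pmf.prob (increments h N {..<N}) {\<xi>. walk \<xi> m \<le> 0 \<and> bridge N k \<xi>}
      \<le> C / (real N)\<^sup>2 * (exp (- decay_rate \<eta>) ^ m + exp (- decay_rate \<eta>) ^ (N - m))"
proof -
  obtain C where C: "C > 0" and le: "\<And>h N A m n E k. \<bar>h\<bar> < \<beta> \<Longrightarrow> A \<inter> {m..<m+n} = {} \<Longrightarrow> A \<union> {m..<m+n} = {..<N} \<Longrightarrow> 0 < n \<Longrightarrow>
     (\<forall>\<xi> \<xi>'. (\<forall>i\<in>A. \<xi> i = \<xi>' i) \<longrightarrow> E \<xi> = E \<xi>') \<Longrightarrow>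
     measure_pmf.prob (increments h N {..<N}) {\<xi>. E \<xi> \<and> bridge N k \<xi>}
       \<le> C / (real n)\<^sup>2 * measure_pmf.prob (increments h N A) {\<xi>. E \<xi>}"
    using prob_bridge_block_le by blast
  have expm: "exp (- decay_rate \<eta> * real m) = exp (- decay_rate \<eta>) ^ m" for m
    by (simp add: exp_of_nat_mult[symmetric] mult.commute)
  have "measure_pmf.prob (increments h N {..<N}) {\<xi>. walk \<xi> m \<le> 0 \<and> bridge N k \<xi>}
      \<le> 4 * C / (real N)\<^sup>2 * (exp (- decay_rate \<eta>) ^ m + exp (- decay_rate \<eta>) ^ (N - m))"
    if h: "\<eta> \<le> h" "h < \<beta>" and m: "0 < m" "m < N" for h N m k
  proof -
    have h': "\<bar>h\<bar> < \<beta>" "0 < h" using h \<eta> by auto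
    \<comment> \<open>a block of at least half of the increments\<close>
    have quarter: "C / (real n)\<^sup>2 * p \<le> 4 * C / (real N)\<^sup>2 * p" if "N \<le> 2 * n" "0 \<le> p" "0 < n" for n p
    proof -
      have "(real N)\<^sup>2 \<le> (2 * real n)\<^sup>2" using that by (intro power_mono) auto
      then have "(real N)\<^sup>2 / 4 \<le> (real n)\<^sup>2" by (simp add: power_mult_distrib)
      then have "C / (real n)\<^sup>2 \<le> C / ((real N)\<^sup>2 / 4)"
        using C m that by (intro divide_left_mono) auto
      then have "C / (real n)\<^sup>2 \<le> 4 * C / (real N)\<^sup>2" by (simp add: mult.commute)
      then show ?thesis using that(2) by (rule mult_right_mono)
    qed
    show ?thesis
    proof (cases "2 * m \<le> N")
      case True
      have "measure_pmf.prob (increments h N {..<N}) {\<xi>. (\<Sum>i<m. \<xi> i) \<le> 0 \<and> bridge N k \<xi>}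
          \<le> C / (real (N - m))\<^sup>2 * measure_pmf.prob (increments h N {..<m}) {\<xi>. (\<Sum>i<m. \<xi> i) \<le> 0}"
        using m h' by (intro le[of _ "{..<m}" m "N - m"]) (auto intro: sum.cong)
      also have "\<dots> \<le> 4 * C / (real N)\<^sup>2 * measure_pmf.prob (increments h N {..<m}) {\<xi>. (\<Sum>i<m. \<xi> i) \<le> 0}"
        using True m by (intro quarter) auto
      also have "measure_pmf.prob (increments h N {..<m}) {\<xi>. (\<Sum>i<m. \<xi> i) \<le> 0} \<le> exp (- decay_rate \<eta>) ^ m"
      proof -
        have "{\<xi>. (\<Sum>i<m. \<xi> i) \<le> 0} = {\<xi>. 0 \<le> (- \<eta> / 16) * of_int (\<Sum>i<m. \<xi> i)}"
          using \<eta> by (auto simp: zero_le_mult_iff mult_le_0_iff simp del: of_int_sum)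
        then have "measure_pmf.prob (increments h N {..<m}) {\<xi>. (\<Sum>i<m. \<xi> i) \<le> 0}
          \<le> exp (- 0) * exp (\<Sum>i<m. log_mgf \<beta> (tilt h N i + (- \<eta> / 16)) - log_mgf \<beta> (tilt h N i))"
          unfolding increments_def
        proof (simp only:, intro prob_sum_ge_le)
          fix i assume "i \<in> {..<m}"
          then have i: "i < m" by simp
          have "2 * real i + 1 \<le> real N" using i True by linarith
          then have "(real i + 1 / 2) / real N \<le> 1 / 2" using m by (simp add: field_simps)
          then have "0 \<le> tilt h N i" unfolding tilt_def using h' by (intro mult_nonneg_nonneg) auto
          moreover show "\<bar>tilt h N i\<bar> < \<beta> / 2" using i m h' by (intro abs_tilt_less) auto
          ultimately show "\<bar>tilt h N i + - \<eta> / 16\<bar> < \<beta> / 2" using \<eta> by linarith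
        qed simp
        also have "\<dots> \<le> exp (- decay_rate \<eta> * real m)"
          using sum_log_mgf_shift_le[OF \<eta>(1) h True] by simp
        finally show ?thesis unfolding expm .
      qed
      finally have "measure_pmf.prob (increments h N {..<N}) {\<xi>. (\<Sum>i<m. \<xi> i) \<le> 0 \<and> bridge N k \<xi>} \<le> 4 * C / (real N)\<^sup>2 * exp (- decay_rate \<eta>) ^ m"
        using C by (simp add: mult_left_mono divide_right_mono)
      also have "\<dots> \<le> 4 * C / (real N)\<^sup>2 * (exp (- decay_rate \<eta>) ^ m + exp (- decay_rate \<eta>) ^ (N - m))"
        using C by (intro mult_left_mono) auto
      finally show ?thesis by (simp add: walk_def)
    next
      case False
      define A where "A = {m..<N}"
      have split: "(\<Sum>i<N. f i) = (\<Sum>i<m. f i) + (\<Sum>i\<in>A. f i)" for f :: "nat \<Rightarrow> int"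
      proof -
        have "{..<N} = {..<m} \<union> A" using m by (auto simp: A_def)
        then show ?thesis by (simp add: sum.union_disjoint A_def ivl_disj_int)
      qed
      have "{\<xi>. walk \<xi> m \<le> 0 \<and> bridge N k \<xi>} = {\<xi>. 0 \<le> (\<Sum>i\<in>A. \<xi> i) \<and> bridge N k \<xi>}"
        by (auto simp: walk_def bridge_def split)
      then have "measure_pmf.prob (increments h N {..<N}) {\<xi>. walk \<xi> m \<le> 0 \<and> bridge N k \<xi>}
          \<le> C / (real m)\<^sup>2 * measure_pmf.prob (increments h N A) {\<xi>. 0 \<le> (\<Sum>i\<in>A. \<xi> i)}"
      proof (simp only:, intro le[of _ A 0 m])
        show "\<forall>\<xi> \<xi>'. (\<forall>i\<in>A. \<xi> i = \<xi>' i) \<longrightarrow> (0 \<le> (\<Sum>i\<in>A. \<xi> i)) = (0 \<le> (\<Sum>i\<in>A. \<xi>' i :: int))"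
        proof (intro allI impI)
          fix \<xi> \<xi>' :: "nat \<Rightarrow> int" assume "\<forall>i\<in>A. \<xi> i = \<xi>' i"
          then have "(\<Sum>i\<in>A. \<xi> i) = (\<Sum>i\<in>A. \<xi>' i)" by (intro sum.cong) auto
          then show "(0 \<le> (\<Sum>i\<in>A. \<xi> i)) = (0 \<le> (\<Sum>i\<in>A. \<xi>' i))" by simp
        qed
      qed (use m h' in \<open>auto simp: A_def\<close>)
      also have "\<dots> \<le> 4 * C / (real N)\<^sup>2 * measure_pmf.prob (increments h N A) {\<xi>. 0 \<le> (\<Sum>i\<in>A. \<xi> i)}"
        using False m by (intro quarter) auto
      also have "measure_pmf.prob (increments h N A) {\<xi>. 0 \<le> (\<Sum>i\<in>A. \<xi> i)} \<le> exp (- decay_rate \<eta>) ^ (N - m)"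
      proof -
        have tilt_refl: "tilt h N i = - tilt h N (N - 1 - i)" if "i \<in> A" for i
          using tilt_reflect[of i N h] that by (auto simp: A_def)
        have t: "\<bar>tilt h N i\<bar> < \<beta> / 2" "\<bar>tilt h N i + \<eta> / 16\<bar> < \<beta> / 2" if "i \<in> A" for i
        proof -
          show a: "\<bar>tilt h N i\<bar> < \<beta> / 2" using that m h' by (intro abs_tilt_less) (auto simp: A_def)
          have "real N \<le> 2 * real i + 1" using that False by (auto simp: A_def)
          then have "1 / 2 \<le> (real i + 1 / 2) / real N" using m by (simp add: field_simps)
          then have "tilt h N i \<le> 0" unfolding tilt_def using h' by (intro mult_nonneg_nonpos) auto
          then show "\<bar>tilt h N i + \<eta> / 16\<bar> < \<beta> / 2" using a \<eta> by linarith
        qed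
        have "{\<xi>. 0 \<le> (\<Sum>i\<in>A. \<xi> i)} = {\<xi>. 0 \<le> (\<eta> / 16) * of_int (\<Sum>i\<in>A. \<xi> i)}"
          using \<eta> by (auto simp: zero_le_mult_iff simp del: of_int_sum)
        then have "measure_pmf.prob (increments h N A) {\<xi>. 0 \<le> (\<Sum>i\<in>A. \<xi> i)}
          \<le> exp (- 0) * exp (\<Sum>i\<in>A. log_mgf \<beta> (tilt h N i + \<eta> / 16) - log_mgf \<beta> (tilt h N i))"
          unfolding increments_def
          by (simp only:, intro prob_sum_ge_le) (use t in \<open>auto simp: A_def\<close>)
        also have "(\<Sum>i\<in>A. log_mgf \<beta> (tilt h N i + \<eta> / 16) - log_mgf \<beta> (tilt h N i))
          = (\<Sum>i\<in>A. log_mgf \<beta> (tilt h N (N - 1 - i) - \<eta> / 16) - log_mgf \<beta> (tilt h N (N - 1 - i)))"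
        proof (intro sum.cong refl)
          fix i assume i: "i \<in> A"
          have "tilt h N (N - 1 - i) - \<eta> / 16 = - (tilt h N i + \<eta> / 16)" "tilt h N (N - 1 - i) = - tilt h N i"
            using tilt_refl[OF i] by auto
          then show "log_mgf \<beta> (tilt h N i + \<eta> / 16) - log_mgf \<beta> (tilt h N i)
             = log_mgf \<beta> (tilt h N (N - 1 - i) - \<eta> / 16) - log_mgf \<beta> (tilt h N (N - 1 - i))"
            by (simp only: log_mgf_minus t[OF i])
        qed
        also have "\<dots> = (\<Sum>i<N - m. log_mgf \<beta> (tilt h N i - \<eta> / 16) - log_mgf \<beta> (tilt h N i))"
          using m by (intro sum.reindex_bij_witness[of _ "\<lambda>i. N - 1 - i" "\<lambda>i. N - 1 - i"]) (auto simp: A_def)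
        also have "\<dots> \<le> - decay_rate \<eta> * real (N - m)"
          using False m by (intro sum_log_mgf_shift_le[OF \<eta>(1) h]) auto
        finally show ?thesis unfolding expm[symmetric] by simp
      qed
      finally have "measure_pmf.prob (increments h N {..<N}) {\<xi>. walk \<xi> m \<le> 0 \<and> bridge N k \<xi>} \<le> 4 * C / (real N)\<^sup>2 * exp (- decay_rate \<eta>) ^ (N - m)"
        using C by (simp add: mult_left_mono divide_right_mono)
      also have "\<dots> \<le> 4 * C / (real N)\<^sup>2 * (exp (- decay_rate \<eta>) ^ m + exp (- decay_rate \<eta>) ^ (N - m))"
        using C by (intro mult_left_mono) auto
      finally show ?thesis .
    qed
  qed
  moreover have "0 < 4 * C" using C by simp
  ultimately show ?thesis by blast
qed

text \<open>
  On a bridge the second condition says that the walk is positive at the times \<open>N - M, \<dots>, N - 1\<close>;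
  in this form it only involves the last \<open>M\<close> increments.
\<close>

definition positive_edges :: "nat \<Rightarrow> nat \<Rightarrow> (nat \<Rightarrow> int) \<Rightarrow> bool" where
  "positive_edges M N \<xi> \<longleftrightarrow> (\<forall>m\<in>{1..M}. 0 < (\<Sum>i<m. \<xi> i)) \<and> (\<forall>m\<in>{1..M}. (\<Sum>i\<in>{N-m..<N}. \<xi> i) < 0)"

definition excursion_prob :: "real \<Rightarrow> nat \<Rightarrow> nat \<Rightarrow> real" where
  "excursion_prob h N k = measure_pmf.prob (increments h N {..<N}) {\<xi>. bridge N k \<xi> \<and> (\<forall>i. 0 < i \<and> i < N \<longrightarrow> walk \<xi> i > 0)}"

definition edge_prob :: "nat \<Rightarrow> real \<Rightarrow> nat \<Rightarrow> nat \<Rightarrow> real" where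
  "edge_prob M h N k = measure_pmf.prob (increments h N {..<N}) {\<xi>. positive_edges M N \<xi> \<and> bridge N k \<xi>}"

lemma edge_prob_approx:
  assumes \<eta>: "0 < \<eta>" "\<eta> < \<beta>"
  shows "\<exists>C>0. \<forall>M h N k. \<eta> \<le> h \<longrightarrow> h < \<beta> \<longrightarrow> 2 * M < N \<longrightarrow>
     \<bar>edge_prob M h N k - excursion_prob h N k\<bar> \<le> C * exp (- decay_rate \<eta>) ^ M / (real N)\<^sup>2"
proof -
  obtain C where C: "C > 0" and ret: "\<And>h N m k. \<eta> \<le> h \<Longrightarrow> h < \<beta> \<Longrightarrow> 0 < m \<Longrightarrow> m < N \<Longrightarrow>
    measure_pmf.prob (increments h N {..<N}) {\<xi>. walk \<xi> m \<le> 0 \<and> bridge N k \<xi>}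
      \<le> C / (real N)\<^sup>2 * (exp (- decay_rate \<eta>) ^ m + exp (- decay_rate \<eta>) ^ (N - m))"
    using prob_bridge_return_le[OF \<eta>] by blast
  define r where "r = exp (- decay_rate \<eta>)"
  have r: "0 < r" "r < 1" using decay_rate_pos[OF \<eta>] by (auto simp: r_def)
  define C' where "C' = 2 * C / (1 - r)"
  have "\<bar>edge_prob M h N k - excursion_prob h N k\<bar> \<le> C' * r ^ M / (real N)\<^sup>2"
    if h: "\<eta> \<le> h" "h < \<beta>" and M: "2 * M < N" for M h N k
  proof -
    define D where "D = increments h N {..<N}"
    define V where "V = {\<xi>. bridge N k \<xi> \<and> (\<forall>i. 0 < i \<and> i < N \<longrightarrow> walk \<xi> i > 0)}"
    define E where "E = {\<xi>. positive_edges M N \<xi> \<and> bridge N k \<xi>}"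
    define B where "B m = {\<xi>. walk \<xi> m \<le> 0 \<and> bridge N k \<xi>}" for m
    define I where "I = {Suc M..<N - M}"
    have tail: "(\<Sum>i\<in>{N-m..<N}. \<xi> i) = - walk \<xi> (N - m)" if "bridge N k \<xi>" "m \<le> N" for \<xi> m
    proof -
      have "{..<N} = {..<N - m} \<union> {N - m..<N}" using that by auto
      then have "(\<Sum>i<N. \<xi> i) = (\<Sum>i<N - m. \<xi> i) + (\<Sum>i\<in>{N - m..<N}. \<xi> i)"
        by (simp add: sum.union_disjoint ivl_disj_int)
      then show ?thesis using that(1) by (simp add: bridge_def walk_def)
    qed
    have VE: "V \<subseteq> E"
    proof
      fix \<xi> assume "\<xi> \<in> V"
      then have v: "bridge N k \<xi>" "\<And>i. 0 < i \<Longrightarrow> i < N \<Longrightarrow> walk \<xi> i > 0" by (auto simp: V_def)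
      have "0 < (\<Sum>i<m. \<xi> i)" if "m \<in> {1..M}" for m
        using v(2)[of m] that M by (auto simp: walk_def)
      moreover have "(\<Sum>i\<in>{N-m..<N}. \<xi> i) < 0" if "m \<in> {1..M}" for m
        using v(2)[of "N - m"] tail[OF v(1), of m] that M by auto
      ultimately show "\<xi> \<in> E" using v(1) by (simp add: E_def positive_edges_def)
    qed
    have EV: "E - V \<subseteq> (\<Union>m\<in>I. B m)"
    proof
      fix \<xi> assume x: "\<xi> \<in> E - V"
      then have b: "bridge N k \<xi>" and e: "positive_edges M N \<xi>" by (auto simp: E_def)
      obtain i where i: "0 < i" "i < N" "walk \<xi> i \<le> 0" using x b by (auto simp: V_def not_less)
      have "M < i"
      proof (rule ccontr)
        assume "\<not> M < i"
        then have "0 < (\<Sum>j<i. \<xi> j)" using e i by (auto simp: positive_edges_def)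
        then show False using i by (simp add: walk_def)
      qed
      moreover have "i < N - M"
      proof (rule ccontr)
        assume "\<not> i < N - M"
        then have "N - i \<in> {1..M}" using i by auto
        then have "(\<Sum>j\<in>{N-(N-i)..<N}. \<xi> j) < 0" using e by (auto simp: positive_edges_def)
        then show False using i tail[OF b, of "N - i"] by simp
      qed
      ultimately show "\<xi> \<in> (\<Union>m\<in>I. B m)" using i b by (auto simp: I_def B_def)
    qed
    have "measure_pmf.prob D E - measure_pmf.prob D V = measure_pmf.prob D (E - V)"
      using VE by (subst measure_pmf.finite_measure_Diff) auto
    also have "\<dots> \<le> measure_pmf.prob D (\<Union>m\<in>I. B m)"
      using EV by (intro measure_pmf.finite_measure_mono) auto
    also have "\<dots> \<le> (\<Sum>m\<in>I. measure_pmf.prob D (B m))"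
      by (intro measure_pmf.finite_measure_subadditive_finite) (auto simp: I_def)
    also have "\<dots> \<le> (\<Sum>m\<in>I. C / (real N)\<^sup>2 * (r ^ m + r ^ (N - m)))"
      unfolding D_def B_def r_def by (intro sum_mono ret h) (auto simp: I_def)
    also have "\<dots> = C / (real N)\<^sup>2 * ((\<Sum>m\<in>I. r ^ m) + (\<Sum>m\<in>I. r ^ (N - m)))"
      by (simp only: sum_distrib_left[symmetric] sum.distrib)
    also have "(\<Sum>m\<in>I. r ^ (N - m)) = (\<Sum>m\<in>I. r ^ m)"
      by (rule sum.reindex_bij_witness[of _ "\<lambda>m. N - m" "\<lambda>m. N - m"]) (auto simp: I_def)
    also have "(\<Sum>m\<in>I. r ^ m) \<le> r ^ M / (1 - r)"
    proof -
      have s: "(\<lambda>m. r ^ (m + M)) sums (r ^ M / (1 - r))" using r by (intro suminf_geometric_tail) auto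
      have "(\<Sum>m\<in>I. r ^ m) = (\<Sum>m\<in>{1..<N - M - M}. r ^ (m + M))"
        by (rule sum.reindex_bij_witness[of _ "\<lambda>m. m + M" "\<lambda>m. m - M"]) (auto simp: I_def)
      also have "\<dots> \<le> (\<Sum>m. r ^ (m + M))"
        using r by (intro sum_le_suminf sums_summable[OF s]) auto
      also have "\<dots> = r ^ M / (1 - r)" using s by (simp add: sums_iff)
      finally show ?thesis .
    qed
    finally have "measure_pmf.prob D E - measure_pmf.prob D V \<le> C / (real N)\<^sup>2 * (r ^ M / (1 - r) + r ^ M / (1 - r))"
      using C by (simp add: mult_left_mono divide_right_mono)
    also have "\<dots> = C' * r ^ M / (real N)\<^sup>2"
      by (simp add: C'_def mult_ac)
    finally have "measure_pmf.prob D E - measure_pmf.prob D V \<le> C' * r ^ M / (real N)\<^sup>2" .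
    moreover have "measure_pmf.prob D V \<le> measure_pmf.prob D E"
      using VE by (intro measure_pmf.finite_measure_mono) auto
    ultimately show ?thesis by (simp add: edge_prob_def excursion_prob_def D_def E_def V_def)
  qed
  moreover have "0 < C'" using C r by (simp add: C'_def)
  ultimately show ?thesis unfolding r_def by blast
qed

definition kappa_upto :: "nat \<Rightarrow> real \<Rightarrow> real" where
  "kappa_upto M h = measure_pmf.prob (Pi_pmf {..<M} 0 (\<lambda>_. tilted_step \<beta> h)) {w. \<forall>m\<in>{1..M}. 0 < (\<Sum>i<m. w i)}"

end


context laplace_walk begin

section \<open>The probability of staying positive forever\<close>

text \<open>
  With the Markov parameter \<open>h\<close> the tilt is undone exactly, and each increment contributes the factor
  \<open>exp (- log_mgf \<beta> h) < 1\<close>.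
\<close>

lemma prob_iid_sum_le:
  assumes h: "0 < h" "h < \<beta> / 2" and B: "finite B"
  shows "measure_pmf.prob (Pi_pmf B 0 (\<lambda>_. tilted_step \<beta> h)) {\<xi>. (\<Sum>i\<in>B. \<xi> i) \<le> - int J}
    \<le> exp (- h * real J) * exp (- log_mgf \<beta> h) ^ card B"
proof -
  have "{\<xi>. (\<Sum>i\<in>B. \<xi> i) \<le> - int J} \<subseteq> {\<xi>. h * real J \<le> - h * of_int (\<Sum>i\<in>B. \<xi> i)}"
  proof (intro subsetI CollectI)
    fix \<xi> assume "\<xi> \<in> {\<xi>. (\<Sum>i\<in>B. \<xi> i) \<le> - int J}"
    then have "of_int (\<Sum>i\<in>B. \<xi> i) \<le> (of_int (- int J) :: real)" by (simp only: of_int_le_iff mem_Collect_eq)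
    then have "real J \<le> - of_int (\<Sum>i\<in>B. \<xi> i)" by simp
    from mult_left_mono[OF this, of h] h show "h * real J \<le> - h * of_int (\<Sum>i\<in>B. \<xi> i)" by simp
  qed
  then have "measure_pmf.prob (Pi_pmf B 0 (\<lambda>_. tilted_step \<beta> h)) {\<xi>. (\<Sum>i\<in>B. \<xi> i) \<le> - int J}
     \<le> measure_pmf.prob (Pi_pmf B 0 (\<lambda>_. tilted_step \<beta> h)) {\<xi>. h * real J \<le> - h * of_int (\<Sum>i\<in>B. \<xi> i)}"
    by (intro measure_pmf.finite_measure_mono) auto
  also have "\<dots> \<le> exp (- (h * real J)) * exp (\<Sum>i\<in>B. log_mgf \<beta> (h + - h) - log_mgf \<beta> h)"
    using h B beta_pos by (intro prob_sum_ge_le) auto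
  also have "\<dots> = exp (- h * real J) * exp (- log_mgf \<beta> h) ^ card B"
    by (simp add: log_mgf_0 exp_of_nat_mult[symmetric])
  finally show ?thesis .
qed

lemma walk_law_sets:
  "{X. Q (X m)} \<in> sets (walk_law p)" "{X. \<forall>i\<in>A. Q (X i)} \<in> sets (walk_law p)"
  "{X. R (X m) \<and> Q (X n)} \<in> sets (walk_law p)"
proof -
  have "{X \<in> space (\<Pi>\<^sub>M i\<in>(UNIV :: nat set). count_space (UNIV :: int set)). Q (X m)} \<in> sets (\<Pi>\<^sub>M i\<in>UNIV. count_space UNIV)"
    by measurable
  then show "{X. Q (X m)} \<in> sets (walk_law p)" by (simp add: walk_law_def space_PiM)
  have "{X \<in> space (\<Pi>\<^sub>M i\<in>(UNIV :: nat set). count_space (UNIV :: int set)). \<forall>i\<in>A. Q (X i)} \<in> sets (\<Pi>\<^sub>M i\<in>UNIV. count_space UNIV)"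
    by measurable
  then show "{X. \<forall>i\<in>A. Q (X i)} \<in> sets (walk_law p)" by (simp add: walk_law_def space_PiM)
  have "{X \<in> space (\<Pi>\<^sub>M i\<in>(UNIV :: nat set). count_space (UNIV :: int set)). R (X m) \<and> Q (X n)} \<in> sets (\<Pi>\<^sub>M i\<in>UNIV. count_space UNIV)"
    by measurable
  then show "{X. R (X m) \<and> Q (X n)} \<in> sets (walk_law p)" by (simp add: walk_law_def space_PiM)
qed

text \<open>
  A walk that is positive up to time \<open>M\<close> but not forever is nonpositive at some later time; the
  probabilities of the latter events are dominated by a geometric series.
\<close>

lemma kappa_approx:
  assumes h: "0 < h" "h < \<beta> / 2" and M: "0 < M"
  shows "\<bar>kappa_upto M h - kappa \<beta> h\<bar> \<le> exp (- log_mgf \<beta> h) ^ M / (1 - exp (- log_mgf \<beta> h))"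
proof -
  define W where "W = walk_law (tilted_step \<beta> h)"
  define r where "r = exp (- log_mgf \<beta> h)"
  have r: "0 < r" "r < 1" using log_mgf_pos[OF h] by (auto simp: r_def)
  interpret W: prob_space W unfolding W_def by (rule prob_space_walk_law)
  define E where "E = {X::nat \<Rightarrow> int. \<forall>m\<in>{1..M}. 0 < X m}"
  define V where "V = {X::nat \<Rightarrow> int. \<forall>m\<in>{1..}. 0 < X m}"
  define B where "B m = {X::nat \<Rightarrow> int. X m \<le> 0}" for m
  have meas: "E \<in> W.events" "V \<in> W.events" "B m \<in> W.events" for m
    unfolding E_def V_def B_def W_def by (rule walk_law_sets)+
  have kap: "kappa \<beta> h = W.prob V"
    by (simp add: kappa_def W_def V_def Ball_def)
  have "W.prob E = measure_pmf.prob (Pi_pmf {..<M} 0 (\<lambda>_. tilted_step \<beta> h)) {\<xi>. \<forall>m\<in>{1..M}. 0 < walk \<xi> m}"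
    unfolding E_def W_def by (rule measure_walk_law_eq[OF walk_law_sets(2) M]) auto
  then have kup: "kappa_upto M h = W.prob E"
    by (simp add: kappa_upto_def walk_def)
  have Bm: "W.prob (B m) \<le> r ^ m" if "0 < m" for m
  proof -
    have "W.prob (B m) = measure_pmf.prob (Pi_pmf {..<m} 0 (\<lambda>_. tilted_step \<beta> h)) {\<xi>. walk \<xi> m \<le> 0}"
      unfolding B_def W_def by (rule measure_walk_law_eq[OF walk_law_sets(1) that]) auto
    also have "\<dots> \<le> r ^ m"
      using prob_iid_sum_le[OF h, of "{..<m}" 0] by (simp add: walk_def r_def)
    finally show ?thesis .
  qed
  have VE: "V \<subseteq> E" by (auto simp: V_def E_def)
  have EV: "E - V \<subseteq> (\<Union>m. B (m + Suc M))"
  proof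
    fix X assume "X \<in> E - V"
    then obtain m where m: "1 \<le> m" "X m \<le> 0" "\<forall>m\<in>{1..M}. 0 < X m" by (auto simp: E_def V_def not_less)
    then have "M < m" by (meson atLeastAtMost_iff not_less)
    then have "m = (m - Suc M) + Suc M" by simp
    then show "X \<in> (\<Union>m. B (m + Suc M))" using m(2) unfolding B_def by (metis UN_I UNIV_I mem_Collect_eq)
  qed
  have s: "(\<lambda>m. r ^ (m + Suc M)) sums (r ^ Suc M / (1 - r))" using r by (intro suminf_geometric_tail) auto
  have bs: "W.prob (B (m + Suc M)) \<le> r ^ (m + Suc M)" for m by (rule Bm) simp
  have sB: "summable (\<lambda>m. W.prob (B (m + Suc M)))"
    by (rule summable_comparison_test'[OF sums_summable[OF s]]) (use bs in auto)
  have "W.prob E - W.prob V = W.prob (E - V)"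
    using VE meas by (subst W.finite_measure_Diff) auto
  also have "\<dots> \<le> W.prob (\<Union>m. B (m + Suc M))"
    using EV meas by (intro W.finite_measure_mono) auto
  also have "\<dots> \<le> (\<Sum>m. W.prob (B (m + Suc M)))"
    using meas by (intro W.finite_measure_subadditive_countably sB) auto
  also have "\<dots> \<le> (\<Sum>m. r ^ (m + Suc M))"
    by (intro suminf_le bs sB sums_summable[OF s])
  also have "\<dots> = r ^ Suc M / (1 - r)" using s by (simp add: sums_iff)
  also have "\<dots> \<le> r ^ M / (1 - r)"
    using r by (intro divide_right_mono) (auto simp: mult_left_le_one_le)
  finally have "W.prob E - W.prob V \<le> r ^ M / (1 - r)" .
  moreover have "W.prob V \<le> W.prob E" using VE meas by (intro W.finite_measure_mono)
  ultimately show ?thesis unfolding kap kup r_def[symmetric] by simp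
qed

text \<open>
  Let the first step be a jump to a large height \<open>J\<close>.  The conditional probability of ever returning to
  the nonpositive half line is then at most \<open>exp (- h J) / (1 - r)\<close> by the union bound, where
  \<open>r = exp (- log_mgf \<beta> h)\<close>, and \<open>J\<close> can be chosen so that this is less than \<open>1\<close>.
\<close>

lemma kappa_pos:
  assumes h: "0 < h" "h < \<beta> / 2"
  shows "0 < kappa \<beta> h"
proof -
  define W where "W = walk_law (tilted_step \<beta> h)"
  define r where "r = exp (- log_mgf \<beta> h)"
  have r: "0 < r" "r < 1" using log_mgf_pos[OF h] by (auto simp: r_def)
  interpret W: prob_space W unfolding W_def by (rule prob_space_walk_law)
  \<comment> \<open>choice of the height of the first jump\<close>
  have "(\<lambda>J. exp (- h) ^ J * (1 / (1 - r))) \<longlonglongrightarrow> 0 * (1 / (1 - r))"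
    using h by (intro tendsto_mult LIMSEQ_power_zero tendsto_const) auto
  then have "\<forall>\<^sub>F J in sequentially. exp (- h) ^ J * (1 / (1 - r)) < 1"
    by (intro order_tendstoD(2)) auto
  then obtain J0 where J0: "\<And>J. J0 \<le> J \<Longrightarrow> exp (- h) ^ J * (1 / (1 - r)) < 1" unfolding eventually_sequentially by blast
  define J where "J = Suc J0"
  have J: "0 < J" "exp (- h) ^ J * (1 / (1 - r)) < 1" unfolding J_def using J0[of "Suc J0"] by auto
  have expJ: "exp (- h * real J) = exp (- h) ^ J" by (simp add: exp_of_nat_mult[symmetric] mult.commute)
  define p0 where "p0 = pmf (tilted_step \<beta> h) (int J)"
  have p0: "0 < p0"
    using h beta_pos c_const_pos[OF beta_pos] by (simp add: p0_def pmf_tilted_step pmf_P_step)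
  define V where "V = {X::nat \<Rightarrow> int. \<forall>m\<in>{1..}. 0 < X m}"
  define S where "S = {X::nat \<Rightarrow> int. X 1 = int J}"
  define B where "B m = {X::nat \<Rightarrow> int. X 1 = int J \<and> X m \<le> 0}" for m
  have meas: "V \<in> W.events" "S \<in> W.events" "B m \<in> W.events" for m
    unfolding V_def S_def B_def W_def by (rule walk_law_sets)+
  have single: "measure_pmf.prob (Pi_pmf {0::nat} 0 (\<lambda>_. tilted_step \<beta> h)) {\<xi>. \<xi> 0 = int J} = p0"
  proof -
    have "measure_pmf.prob (map_pmf (\<lambda>\<xi>. \<xi> 0) (Pi_pmf {0::nat} 0 (\<lambda>_. tilted_step \<beta> h))) {int J} = p0"
      by (simp add: Pi_pmf_component p0_def measure_pmf_single)
    then show ?thesis by (simp add: vimage_def)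
  qed
  have "W.prob S = measure_pmf.prob (Pi_pmf {..<1} 0 (\<lambda>_. tilted_step \<beta> h)) {\<xi>. walk \<xi> 1 = int J}"
    unfolding S_def W_def by (rule measure_walk_law_eq[OF walk_law_sets(1)]) auto
  also have "\<dots> = p0" using single by (simp add: walk_def lessThan_Suc)
  finally have S: "W.prob S = p0" .
  have Bm: "W.prob (B (Suc m)) \<le> p0 * exp (- h) ^ J * r ^ m" for m
  proof -
    have "W.prob (B (Suc m)) = measure_pmf.prob (Pi_pmf {..<Suc m} 0 (\<lambda>_. tilted_step \<beta> h)) {\<xi>. walk \<xi> 1 = int J \<and> walk \<xi> (Suc m) \<le> 0}"
      unfolding B_def W_def by (rule measure_walk_law_eq[OF walk_law_sets(3)]) auto
    also have "{..<Suc m} = {0} \<union> {1..<Suc m}" by auto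
    also have "measure_pmf.prob (Pi_pmf ({0} \<union> {1..<Suc m}) 0 (\<lambda>_. tilted_step \<beta> h)) {\<xi>. walk \<xi> 1 = int J \<and> walk \<xi> (Suc m) \<le> 0}
       = measure_pmf.expectation (Pi_pmf {0} 0 (\<lambda>_. tilted_step \<beta> h)) (\<lambda>\<xi>. measure_pmf.prob (Pi_pmf {1..<Suc m} 0 (\<lambda>_. tilted_step \<beta> h))
          {\<eta>. walk (\<lambda>i. if i \<in> {0} then \<xi> i else \<eta> i) 1 = int J \<and> walk (\<lambda>i. if i \<in> {0} then \<xi> i else \<eta> i) (Suc m) \<le> 0})"
      by (rule prob_Pi_pmf_Un) auto
    also have "\<dots> \<le> measure_pmf.expectation (Pi_pmf {0::nat} 0 (\<lambda>_. tilted_step \<beta> h)) (\<lambda>\<xi>. indicator {\<xi>. \<xi> 0 = int J} \<xi> * (exp (- h) ^ J * r ^ m))"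
    proof (rule integral_mono)
      fix \<xi> :: "nat \<Rightarrow> int"
      have "walk (\<lambda>i. if i \<in> {0} then \<xi> i else \<eta> i) (Suc m) = \<xi> 0 + (\<Sum>i\<in>{1..<Suc m}. \<eta> i)" for \<eta>
      proof -
        have "{..<Suc m} = insert 0 {1..<Suc m}" by auto
        then show ?thesis by (simp add: walk_def)
      qed
      moreover have "walk (\<lambda>i. if i \<in> {0} then \<xi> i else \<eta> i) 1 = \<xi> 0" for \<eta> by (simp add: walk_def)
      ultimately have "measure_pmf.prob (Pi_pmf {1..<Suc m} 0 (\<lambda>_. tilted_step \<beta> h))
          {\<eta>. walk (\<lambda>i. if i \<in> {0} then \<xi> i else \<eta> i) 1 = int J \<and> walk (\<lambda>i. if i \<in> {0} then \<xi> i else \<eta> i) (Suc m) \<le> 0}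
        = measure_pmf.prob (Pi_pmf {1..<Suc m} 0 (\<lambda>_. tilted_step \<beta> h)) {\<eta>. \<xi> 0 = int J \<and> (\<Sum>i\<in>{1..<Suc m}. \<eta> i) \<le> - int J}"
        by (intro arg_cong[where f = "measure_pmf.prob _"]) auto
      also have "\<dots> \<le> indicator {\<xi>. \<xi> 0 = int J} \<xi> * (exp (- h) ^ J * r ^ m)"
      proof -
        have "measure_pmf.prob (Pi_pmf {1..<Suc m} 0 (\<lambda>_. tilted_step \<beta> h)) {\<eta>. (\<Sum>i\<in>{1..<Suc m}. \<eta> i) \<le> - int J} \<le> exp (- h) ^ J * r ^ m"
          using prob_iid_sum_le[OF h, of "{1..<Suc m}" J] unfolding expJ r_def[symmetric] by simp
        then show ?thesis by (auto simp: indicator_def)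
      qed
      finally show "measure_pmf.prob (Pi_pmf {1..<Suc m} 0 (\<lambda>_. tilted_step \<beta> h))
          {\<eta>. walk (\<lambda>i. if i \<in> {0} then \<xi> i else \<eta> i) 1 = int J \<and> walk (\<lambda>i. if i \<in> {0} then \<xi> i else \<eta> i) (Suc m) \<le> 0}
          \<le> indicator {\<xi>. \<xi> 0 = int J} \<xi> * (exp (- h) ^ J * r ^ m)" .
    next
      show "integrable (measure_pmf (Pi_pmf {0::nat} 0 (\<lambda>_. tilted_step \<beta> h))) (\<lambda>\<xi>. indicator {\<xi>. \<xi> 0 = int J} \<xi> * (exp (- h) ^ J * r ^ m))"
        using r by (intro measure_pmf.integrable_const_bound[where B = "exp (- h) ^ J * r ^ m"]) (auto simp: indicator_def)
    qed (auto intro!: measure_pmf.integrable_const_bound[where B = 1])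
    also have "\<dots> = p0 * (exp (- h) ^ J * r ^ m)"
      by (subst integral_mult_left_zero) (simp add: single)
    finally show ?thesis by (simp add: mult.assoc)
  qed
  have SV: "S - (\<Union>m. B (Suc (Suc m))) \<subseteq> V"
  proof
    fix X assume X: "X \<in> S - (\<Union>m. B (Suc (Suc m)))"
    have "0 < X m" if "1 \<le> m" for m
    proof (cases "m = 1")
      case True
      then show ?thesis using X J by (simp add: S_def)
    next
      case False
      then have "m = Suc (Suc (m - 2))" using that by simp
      then have "X \<notin> B m" using X by (metis DiffD2 UN_I UNIV_I)
      then show ?thesis using X by (auto simp: S_def B_def not_le)
    qed
    then show "X \<in> V" by (simp add: V_def)
  qed
  have s: "(\<lambda>m. p0 * exp (- h) ^ J * r ^ (m + 1)) sums (p0 * exp (- h) ^ J * (r ^ 1 / (1 - r)))"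
    using r by (intro sums_mult suminf_geometric_tail) auto
  have bs: "W.prob (B (Suc (Suc m))) \<le> p0 * exp (- h) ^ J * r ^ (m + 1)" for m using Bm[of "Suc m"] by simp
  have sB: "summable (\<lambda>m. W.prob (B (Suc (Suc m))))"
    by (rule summable_comparison_test'[OF sums_summable[OF s]]) (use bs in auto)
  have U: "(\<Union>m. B (Suc (Suc m))) \<in> W.events" using meas by auto
  have "W.prob (\<Union>m. B (Suc (Suc m))) \<le> (\<Sum>m. W.prob (B (Suc (Suc m))))"
    using meas by (intro W.finite_measure_subadditive_countably sB) auto
  also have "\<dots> \<le> (\<Sum>m. p0 * exp (- h) ^ J * r ^ (m + 1))"
    by (intro suminf_le bs sB sums_summable[OF s])
  also have "\<dots> = p0 * exp (- h) ^ J * (r ^ 1 / (1 - r))" using s by (simp only: sums_iff)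
  also have "\<dots> \<le> p0 * (exp (- h) ^ J * (1 / (1 - r)))"
    using p0 r by (simp add: mult.assoc) (intro mult_left_mono divide_right_mono; simp)
  also have "\<dots> < p0 * 1" using p0 J by (intro mult_strict_left_mono) auto
  finally have "W.prob (\<Union>m. B (Suc (Suc m))) < W.prob S" by (simp add: S)
  moreover have "W.prob S \<le> W.prob (S - (\<Union>m. B (Suc (Suc m)))) + W.prob (\<Union>m. B (Suc (Suc m)))"
    using meas U by (intro order_trans[OF W.finite_measure_mono measure_Un_le]) auto
  moreover have "W.prob (S - (\<Union>m. B (Suc (Suc m)))) \<le> W.prob V"
    using SV meas by (intro W.finite_measure_mono)
  ultimately have "0 < W.prob V" by linarith
  then show ?thesis by (simp add: kappa_def W_def V_def Ball_def)
qed

lemma pmf_tilted_step_tendsto: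
  assumes "t \<longlonglongrightarrow> s" "\<bar>s\<bar> < \<beta> / 2"
  shows "(\<lambda>k. pmf (tilted_step \<beta> (t k)) v) \<longlonglongrightarrow> pmf (tilted_step \<beta> s) v"
proof -
  have c: "isCont (log_mgf \<beta>) s" by (rule DERIV_isCont[OF DERIV_log_mgf[OF assms(2)]])
  have "(\<lambda>k. exp (t k * of_int v - log_mgf \<beta> (t k)) * pmf (P_step \<beta>) v) \<longlonglongrightarrow> exp (s * of_int v - log_mgf \<beta> s) * pmf (P_step \<beta>) v"
    by (intro tendsto_intros assms(1) isCont_tendsto_compose[OF c])
  moreover have "\<forall>\<^sub>F k in sequentially. exp (t k * of_int v - log_mgf \<beta> (t k)) * pmf (P_step \<beta>) v = pmf (tilted_step \<beta> (t k)) v"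
  proof -
    have "\<forall>\<^sub>F k in sequentially. \<bar>t k\<bar> < \<beta> / 2"
      by (rule order_tendstoD(2)[OF tendsto_rabs[OF assms(1)] assms(2)])
    then show ?thesis by eventually_elim (simp add: pmf_tilted_step beta_pos)
  qed
  ultimately have "(\<lambda>k. pmf (tilted_step \<beta> (t k)) v) \<longlonglongrightarrow> exp (s * of_int v - log_mgf \<beta> s) * pmf (P_step \<beta>) v"
    by (rule Lim_transform_eventually)
  then show ?thesis using assms(2) by (simp add: pmf_tilted_step beta_pos)
qed

lemma pmf_Pi_tendsto:
  assumes "\<And>i. i \<in> A \<Longrightarrow> (\<lambda>k. t k i) \<longlonglongrightarrow> s" "\<bar>s\<bar> < \<beta> / 2" "finite A"
  shows "(\<lambda>k. pmf (Pi_pmf A 0 (\<lambda>i. tilted_step \<beta> (t k i))) w) \<longlonglongrightarrow> pmf (Pi_pmf A 0 (\<lambda>_. tilted_step \<beta> s)) w"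
proof (cases "\<forall>x. x \<notin> A \<longrightarrow> w x = 0")
  case True
  show ?thesis
    unfolding pmf_Pi[OF assms(3)] if_P[OF True] by (intro tendsto_prod pmf_tilted_step_tendsto assms)
next
  case False
  show ?thesis unfolding pmf_Pi[OF assms(3)] if_not_P[OF False] by (rule tendsto_const)
qed

lemma kappa_upto_tendsto:
  assumes "t \<longlonglongrightarrow> s" "\<bar>s\<bar> < \<beta> / 2"
  shows "(\<lambda>k. kappa_upto M (t k)) \<longlonglongrightarrow> kappa_upto M s"
proof -
  define f :: "(nat \<Rightarrow> int) \<Rightarrow> real" where "f = indicator {w. \<forall>m\<in>{1..M}. 0 < (\<Sum>i<m. w i)}"
  have "(\<lambda>k. measure_pmf.expectation (Pi_pmf {..<M} 0 (\<lambda>_. tilted_step \<beta> (t k))) f)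
      \<longlonglongrightarrow> measure_pmf.expectation (Pi_pmf {..<M} 0 (\<lambda>_. tilted_step \<beta> s)) f"
    by (rule pmf_tendsto_expectation[where C = 1]) (use assms in \<open>auto intro!: pmf_Pi_tendsto simp: f_def\<close>)
  then show ?thesis by (simp add: f_def kappa_upto_def)
qed

lemma kappa_upto_tendsto_kappa:
  assumes h: "0 < h" "h < \<beta> / 2"
  shows "(\<lambda>M. kappa_upto M h) \<longlonglongrightarrow> kappa \<beta> h"
proof -
  define r where "r = exp (- log_mgf \<beta> h)"
  have r: "0 < r" "r < 1" using log_mgf_pos[OF h] by (auto simp: r_def)
  have "(\<lambda>M. r ^ M * (1 / (1 - r))) \<longlonglongrightarrow> 0 * (1 / (1 - r))"
    using r by (intro tendsto_mult LIMSEQ_power_zero tendsto_const) auto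
  then have "(\<lambda>M. r ^ M / (1 - r)) \<longlonglongrightarrow> 0" by simp
  then have "(\<lambda>M. kappa_upto M h - kappa \<beta> h) \<longlonglongrightarrow> 0"
    by (rule Lim_null_comparison[rotated])
      (use kappa_approx[OF h] in \<open>auto simp: eventually_sequentially r_def intro!: exI[of _ 1]\<close>)
  then show ?thesis by (simp add: LIM_zero_iff)
qed

text \<open>
  The approximations \<open>kappa_upto M\<close> are continuous in the tilt and converge locally uniformly.
\<close>

lemma kappa_tendsto:
  assumes t: "t \<longlonglongrightarrow> s" and s: "0 < s" "s < \<beta> / 2"
  shows "(\<lambda>k. kappa \<beta> (t k)) \<longlonglongrightarrow> kappa \<beta> s"
proof (rule tendsto_interchange[where a = "\<lambda>M k. kappa_upto (Suc M) (t k)" and b = "\<lambda>M. kappa_upto (Suc M) s"])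
  define r where "r = exp (- log_mgf \<beta> (s / 2))"
  have r: "0 < r" "r < 1" using log_mgf_pos[of "s / 2"] s by (auto simp: r_def)
  show "(\<lambda>k. kappa_upto (Suc M) (t k)) \<longlonglongrightarrow> kappa_upto (Suc M) s" for M
    using t s by (intro kappa_upto_tendsto) auto
  show "(\<lambda>M. kappa_upto (Suc M) s) \<longlonglongrightarrow> kappa \<beta> s"
    using kappa_upto_tendsto_kappa[OF s] by (rule LIMSEQ_Suc)
  have ev: "\<forall>\<^sub>F k in sequentially. s / 2 < t k" "\<forall>\<^sub>F k in sequentially. t k < \<beta> / 2"
    using s by (auto intro: order_tendstoD(1)[OF t] order_tendstoD(2)[OF t] simp del: half_gt_zero_iff less_divide_eq_numeral1 divide_less_eq_numeral1)
  show "\<forall>\<^sub>F k in sequentially. \<bar>kappa_upto (Suc M) (t k) - kappa \<beta> (t k)\<bar> \<le> r ^ Suc M / (1 - r)" for M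
    using ev
  proof eventually_elim
    case (elim k)
    define r' where "r' = exp (- log_mgf \<beta> (t k))"
    have "log_mgf \<beta> (s / 2) \<le> log_mgf \<beta> (t k)" using elim s by (intro log_mgf_mono) auto
    then have r': "0 < r'" "r' \<le> r" by (auto simp: r'_def r_def)
    have "\<bar>kappa_upto (Suc M) (t k) - kappa \<beta> (t k)\<bar> \<le> r' ^ Suc M / (1 - r')"
      unfolding r'_def using elim s by (intro kappa_approx) auto
    also have "\<dots> \<le> r ^ Suc M / (1 - r)"
      using r r' by (intro frac_le power_mono) auto
    finally show ?case .
  qed
  have "(\<lambda>M. r ^ Suc M * (1 / (1 - r))) \<longlonglongrightarrow> 0 * (1 / (1 - r))"
    using r by (intro tendsto_mult LIMSEQ_Suc[OF LIMSEQ_power_zero] tendsto_const) auto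
  then show "(\<lambda>M. r ^ Suc M / (1 - r)) \<longlonglongrightarrow> 0" by simp
qed


section \<open>The two ends of the excursion\<close>

text \<open>
  Two sequences of \<open>M\<close> increments are placed at the beginning of the bridge and, reversed in time and
  sign, at its end.  Outside of these indices the value is \<open>0\<close>, the default of the finite products.
\<close>

definition glue_ends :: "nat \<Rightarrow> nat \<Rightarrow> (nat \<Rightarrow> int) \<times> (nat \<Rightarrow> int) \<Rightarrow> nat \<Rightarrow> int" where
  "glue_ends M N p i = (if i < M then fst p i else if N - M \<le> i \<and> i < N then - snd p (N - 1 - i) else 0)"

text \<open>
  The tilts are antisymmetric and negation turns the tilt \<open>t\<close> into \<open>- t\<close>, so the reflected last
  increments have the same law as the first ones.
\<close>

lemma increments_edges:
  assumes h: "\<bar>h\<bar> < \<beta>" and M: "2 * M < N"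
  shows "increments h N ({..<M} \<union> {N - M..<N})
    = map_pmf (glue_ends M N) (pair_pmf (increments h N {..<M}) (increments h N {..<M}))"
proof -
  define A where "A = {N - M..<N}"
  have tail: "increments h N A = map_pmf (\<lambda>w j. if j \<in> A then - w (N - 1 - j) else 0) (increments h N {..<M})"
  proof -
    have "increments h N A = Pi_pmf A 0 (\<lambda>j. map_pmf uminus (tilted_step \<beta> (tilt h N (N - 1 - j))))"
      unfolding increments_def
    proof (rule Pi_pmf_cong)
      fix j assume j: "j \<in> A"
      then have jN: "j < N" by (simp add: A_def)
      then have "\<bar>tilt h N (N - 1 - j)\<bar> < \<beta> / 2" using h by (intro abs_tilt_less) auto
      then show "tilted_step \<beta> (tilt h N j) = map_pmf uminus (tilted_step \<beta> (tilt h N (N - 1 - j)))"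
        by (simp only: map_uminus_tilted_step tilt_reflect[OF jN] minus_minus)
    qed (auto simp: A_def)
    also have "\<dots> = map_pmf (\<lambda>w j. if j \<in> A then - w (N - 1 - j) else 0) (Pi_pmf {..<M} 0 (\<lambda>i. tilted_step \<beta> (tilt h N i)))"
    proof (rule Pi_pmf_reindex)
      show "bij_betw (\<lambda>j. N - 1 - j) A {..<M}"
        by (rule bij_betwI[where g = "\<lambda>j. N - 1 - j"]) (use M in \<open>auto simp: A_def\<close>)
    qed (auto simp: A_def)
    finally show ?thesis by (simp add: increments_def)
  qed
  have "increments h N ({..<M} \<union> A) = map_pmf (\<lambda>(f, g) x. if x \<in> {..<M} then f x else g x) (pair_pmf (increments h N {..<M}) (increments h N A))"
    unfolding increments_def using M by (intro Pi_pmf_union) (auto simp: A_def)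
  also have "\<dots> = map_pmf (glue_ends M N) (pair_pmf (increments h N {..<M}) (increments h N {..<M}))"
    unfolding tail pair_map_pmf2 map_pmf_comp
    by (intro map_pmf_cong refl) (auto simp: glue_ends_def A_def fun_eq_iff)
  finally show ?thesis by (simp add: A_def)
qed

text \<open>
  The block between the two ends consists of \<open>N - 2 M\<close> increments starting at index \<open>M\<close>.  The last two
  arguments of \<open>hit\<close> are what the bridge condition leaves for this block, given the increments at the
  two ends.
\<close>

lemma edge_prob_eq_expectation:
  assumes h: "\<bar>h\<bar> < \<beta>" and M: "2 * M < N"
  shows "edge_prob M h N k = measure_pmf.expectation (pair_pmf (increments h N {..<M}) (increments h N {..<M}))
     (\<lambda>(w, w'). indicator {w. \<forall>m\<in>{1..M}. 0 < (\<Sum>i<m. w i)} w * indicator {w. \<forall>m\<in>{1..M}. 0 < (\<Sum>i<m. w i)} w'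
        * hit M (N - 2 * M) (tilt h N) ((\<Sum>i<M. w' i) - (\<Sum>i<M. w i))
            ((int N - int M) * ((\<Sum>i<M. w' i) - (\<Sum>i<M. w i)) - (int k - ((\<Sum>i<M. (int N - int i) * w i) - (\<Sum>i<M. (int i + 1) * w' i)))))"
proof -
  define A where "A = {..<M} \<union> {N - M..<N}"
  have B: "A \<inter> {M..<M + (N - 2 * M)} = {}" "A \<union> {M..<M + (N - 2 * M)} = {..<N}"
    using M by (auto simp: A_def)
  have "edge_prob M h N k = measure_pmf.expectation (increments h N A) (\<lambda>\<xi>. indicator {\<xi>. positive_edges M N \<xi>} \<xi>
        * hit M (N - 2 * M) (tilt h N) (- (\<Sum>i\<in>A. \<xi> i))
            ((int N - int M) * - (\<Sum>i\<in>A. \<xi> i) - (int k - (\<Sum>i\<in>A. (int N - int i) * \<xi> i))))"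
    unfolding edge_prob_def
  proof (rule prob_bridge_block[OF B])
    fix \<xi> \<xi>' :: "nat \<Rightarrow> int" assume eq: "\<And>i. i \<in> A \<Longrightarrow> \<xi> i = \<xi>' i"
    have "(\<Sum>i<m. \<xi> i) = (\<Sum>i<m. \<xi>' i)" "(\<Sum>i\<in>{N-m..<N}. \<xi> i) = (\<Sum>i\<in>{N-m..<N}. \<xi>' i)" if "m \<in> {1..M}" for m
      using that by (auto intro!: sum.cong eq simp: A_def)
    then show "positive_edges M N \<xi> = positive_edges M N \<xi>'" by (simp add: positive_edges_def)
  qed
  also have "\<dots> = measure_pmf.expectation (pair_pmf (increments h N {..<M}) (increments h N {..<M}))
     (\<lambda>p. indicator {\<xi>. positive_edges M N \<xi>} (glue_ends M N p)
        * hit M (N - 2 * M) (tilt h N) (- (\<Sum>i\<in>A. glue_ends M N p i))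
            ((int N - int M) * - (\<Sum>i\<in>A. glue_ends M N p i) - (int k - (\<Sum>i\<in>A. (int N - int i) * glue_ends M N p i))))"
    unfolding A_def increments_edges[OF h M] by simp
  also have "(\<lambda>p. indicator {\<xi>. positive_edges M N \<xi>} (glue_ends M N p)
        * hit M (N - 2 * M) (tilt h N) (- (\<Sum>i\<in>A. glue_ends M N p i))
            ((int N - int M) * - (\<Sum>i\<in>A. glue_ends M N p i) - (int k - (\<Sum>i\<in>A. (int N - int i) * glue_ends M N p i))))
    = (\<lambda>(w, w'). indicator {w. \<forall>m\<in>{1..M}. 0 < (\<Sum>i<m. w i)} w * indicator {w. \<forall>m\<in>{1..M}. 0 < (\<Sum>i<m. w i)} w'
        * hit M (N - 2 * M) (tilt h N) ((\<Sum>i<M. w' i) - (\<Sum>i<M. w i))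
            ((int N - int M) * ((\<Sum>i<M. w' i) - (\<Sum>i<M. w i)) - (int k - ((\<Sum>i<M. (int N - int i) * w i) - (\<Sum>i<M. (int i + 1) * w' i)))))"
  proof
    fix p :: "(nat \<Rightarrow> int) \<times> (nat \<Rightarrow> int)"
    obtain w w' where p: "p = (w, w')" by (cases p)
    define \<xi> where "\<xi> = glue_ends M N p"
    have head: "(\<Sum>i<m. g i * \<xi> i) = (\<Sum>i<m. g i * w i)" if "m \<le> M" for m and g :: "nat \<Rightarrow> int"
      using that by (intro sum.cong) (auto simp: \<xi>_def p glue_ends_def)
    have tail: "(\<Sum>i\<in>{N-m..<N}. g i * \<xi> i) = - (\<Sum>i<m. g (N - 1 - i) * w' i)" if "m \<le> M" for m and g :: "nat \<Rightarrow> int"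
    proof -
      have "(\<Sum>i\<in>{N-m..<N}. g i * \<xi> i) = (\<Sum>i<m. g (N - 1 - i) * - w' i)"
        using that M by (intro sum.reindex_bij_witness[of _ "\<lambda>i. N - 1 - i" "\<lambda>i. N - 1 - i"])
          (auto simp: \<xi>_def p glue_ends_def)
      then show ?thesis by (simp add: sum_negf)
    qed
    have SA: "(\<Sum>i\<in>A. g i * \<xi> i) = (\<Sum>i<M. g i * w i) - (\<Sum>i<M. g (N - 1 - i) * w' i)" for g :: "nat \<Rightarrow> int"
    proof -
      have "(\<Sum>i\<in>A. g i * \<xi> i) = (\<Sum>i<M. g i * \<xi> i) + (\<Sum>i\<in>{N-M..<N}. g i * \<xi> i)"
        unfolding A_def using M by (intro sum.union_disjoint) auto
      then show ?thesis using head[of M g] tail[of M g] by simp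
    qed
    have E: "positive_edges M N \<xi> \<longleftrightarrow> (\<forall>m\<in>{1..M}. 0 < (\<Sum>i<m. w i)) \<and> (\<forall>m\<in>{1..M}. 0 < (\<Sum>i<m. w' i))"
      unfolding positive_edges_def using head[of _ "\<lambda>_. 1"] tail[of _ "\<lambda>_. 1"] by auto
    have g2: "(\<Sum>i<M. (int N - int (N - 1 - i)) * w' i) = (\<Sum>i<M. (int i + 1) * w' i)"
      using M by (intro sum.cong refl) auto
    show "indicator {\<xi>. positive_edges M N \<xi>} (glue_ends M N p)
        * hit M (N - 2 * M) (tilt h N) (- (\<Sum>i\<in>A. glue_ends M N p i))
            ((int N - int M) * - (\<Sum>i\<in>A. glue_ends M N p i) - (int k - (\<Sum>i\<in>A. (int N - int i) * glue_ends M N p i)))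
      = (case p of (w, w') \<Rightarrow> indicator {w. \<forall>m\<in>{1..M}. 0 < (\<Sum>i<m. w i)} w * indicator {w. \<forall>m\<in>{1..M}. 0 < (\<Sum>i<m. w i)} w'
        * hit M (N - 2 * M) (tilt h N) ((\<Sum>i<M. w' i) - (\<Sum>i<M. w i))
            ((int N - int M) * ((\<Sum>i<M. w' i) - (\<Sum>i<M. w i)) - (int k - ((\<Sum>i<M. (int N - int i) * w i) - (\<Sum>i<M. (int i + 1) * w' i)))))"
      unfolding \<xi>_def[symmetric] SA[of "\<lambda>i. int N - int i"] g2
      using SA[of "\<lambda>_. 1"] by (simp add: p E indicator_def)
  qed
  finally show ?thesis .
qed

end


context laplace_walk begin

lemma sum_tilt_antisym:
  assumes "2 * M \<le> N"
  shows "(\<Sum>i\<in>{M..<N - M}. cum1 (tilt h N i)) = 0"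
proof -
  have "(\<Sum>i\<in>{M..<N - M}. cum1 (tilt h N i)) = (\<Sum>i\<in>{M..<N - M}. cum1 (tilt h N (N - 1 - i)))"
    by (rule sum.reindex_bij_witness[of _ "\<lambda>i. N - 1 - i" "\<lambda>i. N - 1 - i"]) auto
  also have "\<dots> = - (\<Sum>i\<in>{M..<N - M}. cum1 (tilt h N i))"
    unfolding sum_negf[symmetric]
  proof (intro sum.cong refl)
    fix i assume "i \<in> {M..<N - M}"
    then have "tilt h N (N - 1 - i) = - tilt h N i" by (intro tilt_reflect) auto
    then show "cum1 (tilt h N (N - 1 - i)) = - cum1 (tilt h N i)" by (simp only: cum1_minus)
  qed
  finally show ?thesis by simp
qed

text \<open>
  By antisymmetry the tilted means add up to \<open>0\<close>, so the weights may be recentred at the middle of the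
  bridge; the weighted means then form a Riemann sum for \<open>- N\<^sup>2 G_prime h\<close>.  The Riemann error and the
  \<open>2 M\<close> missing terms are both of order \<open>N\<close>.
\<close>

lemma mean_area_block:
  assumes h: "\<bar>h\<bar> \<le> H" "H < \<beta>" and M: "2 * M < N"
  shows "\<bar>(\<Sum>j<N - 2 * M. real j * cum1 (tilt h N (M + j))) + (real N)\<^sup>2 * G_prime h\<bar>
    \<le> (1 + \<beta> + 2 * real M) * cgf_bound (H / 2) * real N"
proof -
  define B where "B = cgf_bound (H / 2)"
  have B: "0 < B" unfolding B_def using h by (intro cgf_bound_pos) auto
  define y where "y i = 1 / 2 - (real i + 1 / 2) / real N" for i
  have N: "0 < real N" using M by simp
  have t: "tilt h N i = h * y i" for i by (simp add: tilt_def y_def)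
  have yle: "\<bar>y i\<bar> \<le> 1" if "i < N" for i
    using abs_tilt_le[OF that, of 1] by (simp add: t[of _] tilt_def y_def)
  have ct: "\<bar>cum1 (tilt h N i)\<bar> \<le> B" if "i < N" for i
    unfolding B_def using abs_tilt_le[OF that, of h] h by (intro cum_le) auto
  have "(\<Sum>j<N - 2 * M. real j * cum1 (tilt h N (M + j))) = (\<Sum>i\<in>{M..<N - M}. (real i - real M) * cum1 (tilt h N i))"
    using M by (intro sum.reindex_bij_witness[of _ "\<lambda>i. i - M" "\<lambda>j. M + j"]) auto
  also have "\<dots> = (\<Sum>i\<in>{M..<N - M}. - real N * (y i * cum1 (tilt h N i)) + (real N / 2 - 1 / 2 - real M) * cum1 (tilt h N i))"
    using N by (intro sum.cong refl) (simp add: y_def field_simps)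
  also have "\<dots> = - real N * (\<Sum>i\<in>{M..<N - M}. y i * cum1 (tilt h N i))"
    using sum_tilt_antisym[of M N h] M
    by (simp only: sum.distrib sum_distrib_left[symmetric])
  also have "(\<Sum>i\<in>{M..<N - M}. y i * cum1 (tilt h N i)) = (\<Sum>i<N. y i * cum1 (tilt h N i)) - (\<Sum>i\<in>{..<M} \<union> {N - M..<N}. y i * cum1 (tilt h N i))"
  proof -
    have "{..<N} = {M..<N - M} \<union> ({..<M} \<union> {N - M..<N})" using M by auto
    moreover have "(\<Sum>i\<in>{M..<N - M} \<union> ({..<M} \<union> {N - M..<N}). y i * cum1 (tilt h N i))
       = (\<Sum>i\<in>{M..<N - M}. y i * cum1 (tilt h N i)) + (\<Sum>i\<in>{..<M} \<union> {N - M..<N}. y i * cum1 (tilt h N i))"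
      by (intro sum.union_disjoint) auto
    ultimately show ?thesis by simp
  qed
  finally have S: "(\<Sum>j<N - 2 * M. real j * cum1 (tilt h N (M + j)))
     = - real N * ((\<Sum>i<N. y i * cum1 (tilt h N i)) - (\<Sum>i\<in>{..<M} \<union> {N - M..<N}. y i * cum1 (tilt h N i)))" .
  have edge: "\<bar>\<Sum>i\<in>{..<M} \<union> {N - M..<N}. y i * cum1 (tilt h N i)\<bar> \<le> 2 * real M * B"
  proof -
    have "\<bar>\<Sum>i\<in>{..<M} \<union> {N - M..<N}. y i * cum1 (tilt h N i)\<bar> \<le> (\<Sum>i\<in>{..<M} \<union> {N - M..<N}. 1 * B)"
    proof (rule order_trans[OF sum_abs], rule sum_mono)
      fix i assume "i \<in> {..<M} \<union> {N - M..<N}"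
      then have "i < N" using M by auto
      from yle[OF this] ct[OF this] show "\<bar>y i * cum1 (tilt h N i)\<bar> \<le> 1 * B"
        unfolding abs_mult by (intro mult_mono) auto
    qed
    also have "card ({..<M} \<union> {N - M..<N}) = 2 * M"
      using M by (subst card_Un_disjoint) auto
    then have "(\<Sum>i\<in>{..<M} \<union> {N - M..<N}. 1 * B) = 2 * real M * B" by simp
    finally show ?thesis .
  qed
  have "\<bar>G_prime h - (\<Sum>i<N. y i * cum1 (tilt h N i)) / real N\<bar> \<le> (1 + \<beta>) * B / real N"
    unfolding t y_def B_def using G_prime_riemann[OF h] M by auto
  then have "real N * \<bar>G_prime h - (\<Sum>i<N. y i * cum1 (tilt h N i)) / real N\<bar> \<le> (1 + \<beta>) * B"
    using N by (simp add: field_simps)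
  moreover have "real N * \<bar>G_prime h - (\<Sum>i<N. y i * cum1 (tilt h N i)) / real N\<bar> = \<bar>real N * G_prime h - (\<Sum>i<N. y i * cum1 (tilt h N i))\<bar>"
    using N abs_mult_pos[of "real N" "G_prime h - (\<Sum>i<N. y i * cum1 (tilt h N i)) / real N"] by (simp add: field_simps)
  ultimately have full: "\<bar>real N * G_prime h - (\<Sum>i<N. y i * cum1 (tilt h N i))\<bar> \<le> (1 + \<beta>) * B" by simp
  have "(\<Sum>j<N - 2 * M. real j * cum1 (tilt h N (M + j))) + (real N)\<^sup>2 * G_prime h
     = real N * ((real N * G_prime h - (\<Sum>i<N. y i * cum1 (tilt h N i))) + (\<Sum>i\<in>{..<M} \<union> {N - M..<N}. y i * cum1 (tilt h N i)))"
    unfolding S by (simp add: power2_eq_square algebra_simps)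
  also have "\<bar>\<dots>\<bar> \<le> real N * ((1 + \<beta>) * B + 2 * real M * B)"
    unfolding abs_mult using full edge N by (intro mult_mono order_trans[OF abs_triangle_ineq] add_mono) auto
  finally show ?thesis by (simp add: B_def algebra_simps)
qed

lemma tilt_close:
  assumes h: "\<bar>h\<bar> \<le> H" "H < \<beta>" "\<bar>g\<bar> \<le> H" and M: "2 * M < N" and j: "j < N - 2 * M"
  shows "\<bar>cum2 (tilt h N (M + j)) - cum2 (g * (1 / 2 - real j / real (N - 2 * M)))\<bar>
    \<le> cgf_bound (H / 2) * (\<bar>h - g\<bar> + \<beta> * ((3 * real M + 1) / real N))"
proof -
  define n where "n = N - 2 * M"
  have n: "0 < real n" "real N = real n + 2 * real M" "real j \<le> real n" "j < n" using M j by (auto simp: n_def)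
  have N: "0 < real N" using M by simp
  have MjN: "M + j < N" using j by simp
  have x: "real j / real n \<in> {0..1}" using n by auto
  have "\<bar>real j / real n - (real (M + j) + 1 / 2) / real N\<bar> \<le> (3 * real M + 1) / real N"
  proof -
    have "real j / real n - (real (M + j) + 1 / 2) / real N = (2 * real M * (real j / real n) - (real M + 1 / 2)) / real N"
      using n N by (simp add: field_simps)
    also have "\<bar>\<dots>\<bar> \<le> (3 * real M + 1) / real N"
    proof -
      have "0 \<le> 2 * real M * (real j / real n)" by simp
      moreover have "2 * real M * (real j / real n) \<le> 2 * real M * 1"
        using x by (intro mult_left_mono) auto
      ultimately have "\<bar>2 * real M * (real j / real n) - (real M + 1 / 2)\<bar> \<le> 3 * real M + 1" by linarith
      then show ?thesis using N by (simp add: abs_divide divide_right_mono)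
    qed
    finally show ?thesis .
  qed
  note xd = this
  have "tilt h N (M + j) - g * (1 / 2 - real j / real n)
     = (h - g) * (1 / 2 - (real (M + j) + 1 / 2) / real N) + g * (real j / real n - (real (M + j) + 1 / 2) / real N)"
  proof -
    have "h * (1 / 2 - u) - g * (1 / 2 - v) = (h - g) * (1 / 2 - u) + g * (v - u)" for u v
      by (simp add: field_simps)
    then show ?thesis by (simp only: tilt_def)
  qed
  also have "\<bar>\<dots>\<bar> \<le> \<bar>h - g\<bar> + \<beta> * ((3 * real M + 1) / real N)"
  proof (rule order_trans[OF abs_triangle_ineq], rule add_mono)
    have "\<bar>(h - g) * (1 / 2 - (real (M + j) + 1 / 2) / real N)\<bar> \<le> \<bar>h - g\<bar> / 2"
      using abs_tilt_le[OF MjN, of "h - g"] by (simp add: tilt_def)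
    then show "\<bar>(h - g) * (1 / 2 - (real (M + j) + 1 / 2) / real N)\<bar> \<le> \<bar>h - g\<bar>"
      by (rule order_trans) simp
    show "\<bar>g * (real j / real n - (real (M + j) + 1 / 2) / real N)\<bar> \<le> \<beta> * ((3 * real M + 1) / real N)"
      unfolding abs_mult using h xd by (intro mult_mono) auto
  qed
  finally have d: "\<bar>tilt h N (M + j) - g * (1 / 2 - real j / real n)\<bar> \<le> \<bar>h - g\<bar> + \<beta> * ((3 * real M + 1) / real N)" .
  have "\<bar>cum2 (tilt h N (M + j)) - cum2 (g * (1 / 2 - real j / real n))\<bar> \<le> cgf_bound (H / 2) * \<bar>tilt h N (M + j) - g * (1 / 2 - real j / real n)\<bar>"
    using abs_tilt_le[OF MjN, of h] abs_arg_le[OF x, of g] h by (intro cum_Lipschitz) auto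
  also have "\<dots> \<le> cgf_bound (H / 2) * (\<bar>h - g\<bar> + \<beta> * ((3 * real M + 1) / real N))"
    using d cgf_bound_pos[of "H / 2"] h by (intro mult_left_mono) auto
  finally show ?thesis by (simp add: n_def)
qed

text \<open>
  For fixed increments \<open>w\<close>, \<open>w'\<close> at the two ends the target of the middle block differs from its mean
  by \<open>O(1)\<close> in the sum and \<open>O(N)\<close> in the weighted sum, both negligible, so the local limit theorem gives
  the same limit for all of them.  The bound \<open>C\<close> on the rescaled point probabilities allows passing to
  the limit in the expectation over the two ends, whose laws converge because their tilts tend to
  \<open>g / 2\<close>.
\<close>

theorem edge_prob_limit:
  fixes N a :: "nat \<Rightarrow> nat" and h :: "nat \<Rightarrow> real"
  assumes h: "\<And>k. 0 < h k" "\<And>k. h k \<le> H" "H < \<beta>" and hg: "h \<longlonglongrightarrow> g" "0 < g"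
    and N: "filterlim N at_top sequentially" "\<And>k. 2 * M < N k"
    and a: "\<And>k. real (a k) = (real (N k))\<^sup>2 * G_prime (h k)"
  shows "(\<lambda>k. (real (N k))\<^sup>2 * edge_prob M (h k) (N k) (a k))
    \<longlonglongrightarrow> (kappa_upto M (g / 2))\<^sup>2 / (2 * pi * sqrt (theta \<beta> g))"
proof -
  define n where "n k = N k - 2 * M" for k
  define L where "L = 1 / (2 * pi * sqrt (theta \<beta> g))"
  define S where "S = {w::nat \<Rightarrow> int. \<forall>m\<in>{1..M}. 0 < (\<Sum>i<m. w i)}"
  have gH: "g \<le> H" by (rule LIMSEQ_le_const2[OF hg(1)]) (use h in auto)
  have habs: "\<bar>h k\<bar> \<le> H" "\<bar>h k\<bar> < \<beta>" for k using h(1)[of k] h(2)[of k] h(3) by auto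
  have g: "\<bar>g\<bar> \<le> H" "\<bar>g\<bar> < \<beta>" using gH hg(2) h(3) by auto
  have n: "filterlim n at_top sequentially"
    unfolding n_def[abs_def] filterlim_at_top
  proof
    fix Z
    have "\<forall>\<^sub>F k in sequentially. Z + 2 * M \<le> N k" using N(1) by (simp add: filterlim_at_top)
    then show "\<forall>\<^sub>F k in sequentially. Z \<le> N k - 2 * M" by eventually_elim auto
  qed
  have n_pos: "0 < n k" for k using N(2)[of k] by (simp add: n_def)
  have Nn: "real (N k) = real (n k) + 2 * real M" for k using N(2)[of k] by (simp add: n_def)
  have Nle: "real (N k) \<le> (1 + 2 * real M) * real (n k)" for k
  proof -
    have "2 * real M * 1 \<le> 2 * real M * real (n k)" using n_pos[of k] by (intro mult_left_mono) auto
    then show ?thesis by (simp add: Nn algebra_simps)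
  qed
  have rn: "filterlim (\<lambda>k. real (n k)) at_top sequentially" by (rule filterlim_compose[OF filterlim_real_sequentially n])
  have rN: "filterlim (\<lambda>k. real (N k)) at_top sequentially" by (rule filterlim_compose[OF filterlim_real_sequentially N(1)])
  have inv_n: "(\<lambda>k. c / real (n k)) \<longlonglongrightarrow> 0" for c :: real
    by (rule tendsto_divide_0[OF tendsto_const]) (use filterlim_at_top_imp_at_infinity[OF rn] in simp)
  have inv_N: "(\<lambda>k. c / real (N k)) \<longlonglongrightarrow> 0" for c :: real
    by (rule tendsto_divide_0[OF tendsto_const]) (use filterlim_at_top_imp_at_infinity[OF rN] in simp)
  have inv_sqrt: "(\<lambda>k. c / sqrt (n k)) \<longlonglongrightarrow> 0" for c :: real
    by (rule tendsto_divide_0[OF tendsto_const])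
      (use filterlim_at_top_imp_at_infinity[OF filterlim_compose[OF sqrt_at_top rn]] in simp)
  have mom: "(\<lambda>k. (\<Sum>j<n k. (real j / real (n k)) ^ p * cum2 (tilt (h k) (N k) (M + j))) / real (n k)) \<longlonglongrightarrow> moment p g" for p
    unfolding moment_def
  proof (rule riemann_sum_tendsto[OF _ n])
    show "continuous_on {0..1} (\<lambda>x. x ^ p * cum2 (g * (1 / 2 - x)))"
      by (intro continuous_intros abs_arg_less g) auto
    define e where "e k = cgf_bound (H / 2) * (\<bar>h k - g\<bar> + \<beta> * ((3 * real M + 1) / real (N k)))" for k
    show "e \<longlonglongrightarrow> 0"
    proof -
      have "e \<longlonglongrightarrow> cgf_bound (H / 2) * (\<bar>g - g\<bar> + \<beta> * 0)"
        unfolding e_def[abs_def] by (intro tendsto_intros hg inv_N)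
      then show ?thesis by simp
    qed
    show "\<bar>(real j / real (n k)) ^ p * cum2 (tilt (h k) (N k) (M + j)) - (real j / real (n k)) ^ p * cum2 (g * (1 / 2 - real j / real (n k)))\<bar> \<le> e k"
      if j: "j < n k" for k j
    proof -
      have "(real j / real (n k)) ^ p \<le> 1" using j by (intro power_le_one) auto
      then have "\<bar>(real j / real (n k)) ^ p\<bar> \<le> 1" by simp
      moreover have "\<bar>cum2 (tilt (h k) (N k) (M + j)) - cum2 (g * (1 / 2 - real j / real (n k)))\<bar> \<le> e k"
        unfolding e_def n_def using j by (intro tilt_close habs h g N) (auto simp: n_def)
      ultimately have "\<bar>(real j / real (n k)) ^ p\<bar> * \<bar>cum2 (tilt (h k) (N k) (M + j)) - cum2 (g * (1 / 2 - real j / real (n k)))\<bar> \<le> 1 * e k"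
        by (intro mult_mono) auto
      then show ?thesis by (simp only: abs_mult[symmetric] right_diff_distrib[of "_ ^ _"] mult_1_left)
    qed
  qed
  define X where "X = (\<lambda>(w::nat \<Rightarrow> int, w'). (\<Sum>i<M. w' i) - (\<Sum>i<M. w i))"
  define A where "A k = (\<lambda>(w::nat \<Rightarrow> int, w'). (int (N k) - int M) * ((\<Sum>i<M. w' i) - (\<Sum>i<M. w i)) - (int (a k) - ((\<Sum>i<M. (int (N k) - int i) * w i) - (\<Sum>i<M. (int i + 1) * w' i))))" for k
  have hit_lim: "(\<lambda>k. (real (n k))\<^sup>2 * hit M (n k) (tilt (h k) (N k)) (X p) (A k p)) \<longlonglongrightarrow> L" for p
  proof -
    obtain w w' where p: "p = (w, w')" by (cases p)
    have antisym: "(\<Sum>j<n k. cum1 (tilt (h k) (N k) (M + j))) = 0" for k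
    proof -
      have "(\<Sum>j<n k. cum1 (tilt (h k) (N k) (M + j))) = (\<Sum>i\<in>{M..<N k - M}. cum1 (tilt (h k) (N k) i))"
        using N(2)[of k] by (intro sum.reindex_bij_witness[of _ "\<lambda>i. i - M" "\<lambda>j. M + j"]) (auto simp: n_def)
      then show ?thesis using sum_tilt_antisym[of M "N k"] N(2)[of k] by simp
    qed
    have "(\<lambda>k. (real (n k))\<^sup>2 * hit M (n k) (tilt (h k) (N k)) (X p) (A k p))
       \<longlonglongrightarrow> 1 / (2 * pi * sqrt (moment 0 g * moment 2 g - (moment 1 g)\<^sup>2))"
    proof (rule hit_local_limit[where T = "H / 2" and m = "\<lambda>_. M" and x = "\<lambda>_. X p"])
      show "\<bar>tilt (h k) (N k) j\<bar> \<le> H / 2" if "j \<in> {M..<M + n k}" for k j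
      proof -
        have "j < N k" using that N(2)[of k] by (auto simp: n_def)
        from abs_tilt_le[OF this, of "h k"] show ?thesis using habs(1)[of k] by linarith
      qed
      show "(\<lambda>k. ((\<Sum>j<n k. cum1 (tilt (h k) (N k) (M + j))) - real_of_int (X p)) / sqrt (real (n k))) \<longlonglongrightarrow> 0"
        unfolding antisym using inv_sqrt[of "- of_int (X p)"] by simp
      show "(\<lambda>k. ((\<Sum>j<n k. real j * cum1 (tilt (h k) (N k) (M + j))) - real_of_int (A k p)) / (real (n k) * sqrt (real (n k)))) \<longlonglongrightarrow> 0"
      proof -
        define K where "K = (1 + \<beta> + 2 * real M) * cgf_bound (H / 2) + (real_of_int \<bar>X p\<bar> + (\<Sum>i<M. real_of_int \<bar>w i\<bar>) + (\<Sum>i<M. (real i + 1) * real_of_int \<bar>w' i\<bar>))"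
        have K: "\<bar>(\<Sum>j<n k. real j * cum1 (tilt (h k) (N k) (M + j))) - real_of_int (A k p)\<bar> \<le> K * real (N k)" for k
        proof -
          define U where "U = (\<Sum>j<n k. real j * cum1 (tilt (h k) (N k) (M + j)))"
          have U: "\<bar>U + (real (N k))\<^sup>2 * G_prime (h k)\<bar> \<le> (1 + \<beta> + 2 * real M) * cgf_bound (H / 2) * real (N k)"
            unfolding U_def n_def using habs h N(2) by (intro mean_area_block) auto
          define R where "R = (int (N k) - int M) * X p + (\<Sum>i<M. (int (N k) - int i) * w i) - (\<Sum>i<M. (int i + 1) * w' i)"
          have Ak: "A k p = R - int (a k)" by (simp add: A_def X_def R_def p)
          have N1: "1 \<le> real (N k)" using N(2)[of k] by simp
          have R: "\<bar>real_of_int R\<bar> \<le> (real_of_int \<bar>X p\<bar> + (\<Sum>i<M. real_of_int \<bar>w i\<bar>) + (\<Sum>i<M. (real i + 1) * real_of_int \<bar>w' i\<bar>)) * real (N k)"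
          proof -
            have r1: "\<bar>(real (N k) - real M) * real_of_int (X p)\<bar> \<le> real (N k) * real_of_int \<bar>X p\<bar>"
              unfolding abs_mult using N(2)[of k] by (intro mult_mono) auto
            have r2: "\<bar>\<Sum>i<M. (real (N k) - real i) * real_of_int (w i)\<bar> \<le> (\<Sum>i<M. real (N k) * real_of_int \<bar>w i\<bar>)"
              using N(2)[of k] by (intro order_trans[OF sum_abs] sum_mono) (auto simp: abs_mult intro!: mult_mono)
            have r3: "\<bar>\<Sum>i<M. (real i + 1) * real_of_int (w' i)\<bar> \<le> (\<Sum>i<M. real (N k) * ((real i + 1) * real_of_int \<bar>w' i\<bar>))"
            proof (intro order_trans[OF sum_abs] sum_mono)
              fix i
              have "1 * ((real i + 1) * real_of_int \<bar>w' i\<bar>) \<le> real (N k) * ((real i + 1) * real_of_int \<bar>w' i\<bar>)"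
                using N1 by (intro mult_right_mono) auto
              then show "\<bar>(real i + 1) * real_of_int (w' i)\<bar> \<le> real (N k) * ((real i + 1) * real_of_int \<bar>w' i\<bar>)"
                by (simp add: abs_mult)
            qed
            have "real_of_int R = (real (N k) - real M) * real_of_int (X p) + (\<Sum>i<M. (real (N k) - real i) * real_of_int (w i)) - (\<Sum>i<M. (real i + 1) * real_of_int (w' i))"
              by (simp add: R_def)
            also have "\<bar>\<dots>\<bar> \<le> real (N k) * real_of_int \<bar>X p\<bar> + (\<Sum>i<M. real (N k) * real_of_int \<bar>w i\<bar>) + (\<Sum>i<M. real (N k) * ((real i + 1) * real_of_int \<bar>w' i\<bar>))"
              using r1 r2 r3 by linarith
            finally show ?thesis by (simp only: sum_distrib_left[symmetric] distrib_left[symmetric] mult.commute)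
          qed
          have "U - real_of_int (A k p) = (U + (real (N k))\<^sup>2 * G_prime (h k)) - real_of_int R"
            unfolding Ak using a[of k] by simp
          then have "\<bar>U - real_of_int (A k p)\<bar> \<le> \<bar>U + (real (N k))\<^sup>2 * G_prime (h k)\<bar> + \<bar>real_of_int R\<bar>" by linarith
          also have "\<dots> \<le> K * real (N k)" using U R unfolding K_def distrib_right by linarith
          finally show ?thesis unfolding U_def .
        qed
        have K0: "0 \<le> K" 
        proof -
          have "0 \<le> K * real (N 0)" using K[of 0] abs_ge_zero order_trans by blast
          then show ?thesis using N(2)[of 0] by (simp add: zero_le_mult_iff)
        qed
        show ?thesis
        proof (rule Lim_null_comparison[OF _ inv_sqrt[of "K * (1 + 2 * real M)"]], intro always_eventually allI)
          fix k
          have "K * real (N k) \<le> K * ((1 + 2 * real M) * real (n k))" using K0 Nle by (intro mult_left_mono) auto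
          then have "\<bar>(\<Sum>j<n k. real j * cum1 (tilt (h k) (N k) (M + j))) - real_of_int (A k p)\<bar> \<le> K * (1 + 2 * real M) * real (n k)"
            using K[of k] by (simp add: mult.assoc)
          then have "\<bar>(\<Sum>j<n k. real j * cum1 (tilt (h k) (N k) (M + j))) - real_of_int (A k p)\<bar> / (real (n k) * sqrt (real (n k)))
             \<le> (K * (1 + 2 * real M) * real (n k)) / (real (n k) * sqrt (real (n k)))"
            by (rule divide_right_mono) auto
          also have "\<dots> = K * (1 + 2 * real M) / sqrt (n k)" using n_pos[of k] by simp
          finally show "norm (((\<Sum>j<n k. real j * cum1 (tilt (h k) (N k) (M + j))) - real_of_int (A k p)) / (real (n k) * sqrt (real (n k)))) \<le> K * (1 + 2 * real M) / sqrt (n k)"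
            by (simp add: abs_divide)
        qed
      qed
    qed (use h n n_pos mom[of 0] mom[of 1] mom[of 2] moment_pos[OF g(2)] in auto)
    then show ?thesis by (simp add: L_def theta_eq_moments[OF g(2)])
  qed
  define f where "f k p = indicator S (fst p) * indicator S (snd p) * ((real (n k))\<^sup>2 * hit M (n k) (tilt (h k) (N k)) (X p) (A k p))" for k and p :: "(nat \<Rightarrow> int) \<times> (nat \<Rightarrow> int)"
  define D where "D = Pi_pmf {..<M} (0::int) (\<lambda>_. tilted_step \<beta> (g / 2))"
  have "(\<lambda>k. measure_pmf.expectation (pair_pmf (increments (h k) (N k) {..<M}) (increments (h k) (N k) {..<M})) (f k))
      \<longlonglongrightarrow> measure_pmf.expectation (pair_pmf D D) (\<lambda>p. indicator S (fst p) * indicator S (snd p) * L)"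
  proof -
    obtain C where C: "C > 0" "\<And>m n \<tau> x a. (\<forall>j\<in>{m..<m+n}. \<bar>\<tau> j\<bar> < \<beta> / 2) \<Longrightarrow> 0 < n \<Longrightarrow> hit m n \<tau> x a \<le> C / (real n)\<^sup>2"
      using hit_le by blast
    show ?thesis
    proof (rule pmf_tendsto_expectation[where C = C])
      fix p :: "(nat \<Rightarrow> int) \<times> (nat \<Rightarrow> int)"
      have t: "(\<lambda>k. tilt (h k) (N k) i) \<longlonglongrightarrow> g / 2" for i
      proof -
        have "(\<lambda>k. h k * (1 / 2 - (real i + 1 / 2) / real (N k))) \<longlonglongrightarrow> g * (1 / 2 - 0)"
          by (intro tendsto_intros hg inv_N)
        then show ?thesis by (simp add: tilt_def)
      qed
      have inc: "(\<lambda>k. pmf (increments (h k) (N k) {..<M}) w) \<longlonglongrightarrow> pmf D w" for w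
        unfolding increments_def D_def using g t by (intro pmf_Pi_tendsto) auto
      show "(\<lambda>k. pmf (pair_pmf (increments (h k) (N k) {..<M}) (increments (h k) (N k) {..<M})) p) \<longlonglongrightarrow> pmf (pair_pmf D D) p"
        by (cases p) (simp add: pmf_pair tendsto_mult inc)
      show "(\<lambda>k. f k p) \<longlonglongrightarrow> indicator S (fst p) * indicator S (snd p) * L"
        unfolding f_def by (intro tendsto_intros hit_lim)
      fix k
      have "\<forall>j\<in>{M..<M + n k}. \<bar>tilt (h k) (N k) j\<bar> < \<beta> / 2"
      proof
        fix j assume "j \<in> {M..<M + n k}"
        then have "j < N k" using N(2)[of k] by (auto simp: n_def)
        then show "\<bar>tilt (h k) (N k) j\<bar> < \<beta> / 2" using habs(2) by (rule abs_tilt_less)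
      qed
      from C(2)[OF this n_pos, of "X p" "A k p"]
      have "(real (n k))\<^sup>2 * hit M (n k) (tilt (h k) (N k)) (X p) (A k p) \<le> C"
        using n_pos[of k] by (simp add: field_simps)
      then show "\<bar>f k p\<bar> \<le> C"
        using C(1) hit_nonneg by (auto simp: f_def indicator_def abs_mult)
    qed
  qed
  also have "measure_pmf.expectation (pair_pmf D D) (\<lambda>p. indicator S (fst p) * indicator S (snd p) * L) = (kappa_upto M (g / 2))\<^sup>2 * L"
  proof -
    have "measure_pmf.expectation (pair_pmf D D) (\<lambda>p. indicator S (fst p) * indicator S (snd p)) = measure_pmf.prob (pair_pmf D D) (S \<times> S)"
    proof -
      have "(\<lambda>p. indicator S (fst p) * indicator S (snd p)) = (indicator (S \<times> S) :: _ \<Rightarrow> real)"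
        by (auto simp: fun_eq_iff indicator_def)
      then show ?thesis by simp
    qed
    also have "\<dots> = measure_pmf.prob D S * measure_pmf.prob D S"
    proof -
      have "measure_pmf.prob D {y. (x, y) \<in> S \<times> S} = indicator S x * measure_pmf.prob D S" for x
        by (cases "x \<in> S") auto
      then show ?thesis unfolding prob_pair_pmf by (simp only: integral_mult_left_zero) simp
    qed
    also have "measure_pmf.prob D S = kappa_upto M (g / 2)" by (simp add: kappa_upto_def D_def S_def)
    finally show ?thesis by (simp add: integral_mult_left_zero power2_eq_square)
  qed
  also have "(\<lambda>k. measure_pmf.expectation (pair_pmf (increments (h k) (N k) {..<M}) (increments (h k) (N k) {..<M})) (f k))
     = (\<lambda>k. (real (n k))\<^sup>2 * edge_prob M (h k) (N k) (a k))"
  proof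
    fix k
    have "f k = (\<lambda>p. (real (n k))\<^sup>2 * (case p of (w, w') \<Rightarrow> indicator S w * indicator S w'
        * hit M (N k - 2 * M) (tilt (h k) (N k)) ((\<Sum>i<M. w' i) - (\<Sum>i<M. w i))
            ((int (N k) - int M) * ((\<Sum>i<M. w' i) - (\<Sum>i<M. w i)) - (int (a k) - ((\<Sum>i<M. (int (N k) - int i) * w i) - (\<Sum>i<M. (int i + 1) * w' i))))))"
      by (auto simp: f_def X_def A_def n_def fun_eq_iff)
    then show "measure_pmf.expectation (pair_pmf (increments (h k) (N k) {..<M}) (increments (h k) (N k) {..<M})) (f k) = (real (n k))\<^sup>2 * edge_prob M (h k) (N k) (a k)"
      unfolding edge_prob_eq_expectation[OF habs(2) N(2)] S_def by (simp only: integral_mult_right_zero)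
  qed
  finally have lim: "(\<lambda>k. (real (n k))\<^sup>2 * edge_prob M (h k) (N k) (a k)) \<longlonglongrightarrow> (kappa_upto M (g / 2))\<^sup>2 * L" .
  \<comment> \<open>the local limit theorem normalises by \<open>n = N - 2 M\<close> instead of \<open>N\<close>\<close>
  have "(\<lambda>k. (1 + 2 * real M / real (n k))\<^sup>2 * ((real (n k))\<^sup>2 * edge_prob M (h k) (N k) (a k))) \<longlonglongrightarrow> (1 + 0)\<^sup>2 * ((kappa_upto M (g / 2))\<^sup>2 * L)"
    by (intro tendsto_intros lim inv_n)
  moreover have "(1 + 2 * real M / real (n k))\<^sup>2 * ((real (n k))\<^sup>2 * e) = (real (N k))\<^sup>2 * e" for k e
  proof -
    have "(1 + 2 * real M / real (n k)) * real (n k) = real (N k)" using n_pos[of k] by (simp add: Nn field_simps)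
    then show ?thesis by (simp only: power_mult_distrib[symmetric] mult.assoc[symmetric])
  qed
  ultimately show ?thesis by (simp add: L_def)
qed


section \<open>Uniform asymptotics\<close>

theorem excursion_prob_limit:
  fixes N a :: "nat \<Rightarrow> nat" and h :: "nat \<Rightarrow> real"
  assumes h: "\<And>k. 0 < h k" "\<And>k. h k \<le> H" "H < \<beta>" and hg: "h \<longlonglongrightarrow> g" "0 < g"
    and N: "filterlim N at_top sequentially"
    and a: "\<And>k. real (a k) = (real (N k))\<^sup>2 * G_prime (h k)"
  shows "(\<lambda>k. (real (N k))\<^sup>2 * excursion_prob (h k) (N k) (a k))
    \<longlonglongrightarrow> (kappa \<beta> (g / 2))\<^sup>2 / (2 * pi * sqrt (theta \<beta> g))"
proof -
  have gH: "g \<le> H" by (rule LIMSEQ_le_const2[OF hg(1)]) (use h in auto)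
  define \<eta> where "\<eta> = g / 2"
  have \<eta>: "0 < \<eta>" "\<eta> < \<beta>" using hg(2) gH h(3) by (auto simp: \<eta>_def)
  obtain C where C: "C > 0" "\<And>M h N k. \<eta> \<le> h \<Longrightarrow> h < \<beta> \<Longrightarrow> 2 * M < N \<Longrightarrow>
     \<bar>edge_prob M h N k - excursion_prob h N k\<bar> \<le> C * exp (- decay_rate \<eta>) ^ M / (real N)\<^sup>2"
    using edge_prob_approx[OF \<eta>] by blast
  have Nev: "\<forall>\<^sub>F k in sequentially. 2 * M < N k" for M
  proof -
    have "\<forall>\<^sub>F k in sequentially. 2 * M + 1 \<le> N k" using N by (simp add: filterlim_at_top)
    then show ?thesis by eventually_elim simp
  qed
  show ?thesis
  proof (rule tendsto_interchange[where a = "\<lambda>M k. (real (N k))\<^sup>2 * edge_prob M (h k) (N k) (a k)"])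
    show "(\<lambda>k. (real (N k))\<^sup>2 * edge_prob M (h k) (N k) (a k)) \<longlonglongrightarrow> (kappa_upto M (g / 2))\<^sup>2 / (2 * pi * sqrt (theta \<beta> g))" for M
    proof -
      \<comment> \<open>the two ends are disjoint only from some index on, so the sequences are shifted\<close>
      obtain k0 where k0: "\<And>k. k0 \<le> k \<Longrightarrow> 2 * M < N k" using Nev[of M] unfolding eventually_sequentially by blast
      have "(\<lambda>k. (real (N (k + k0)))\<^sup>2 * edge_prob M (h (k + k0)) (N (k + k0)) (a (k + k0)))
          \<longlonglongrightarrow> (kappa_upto M (g / 2))\<^sup>2 / (2 * pi * sqrt (theta \<beta> g))"
      proof (rule edge_prob_limit[OF h(1) h(2) h(3)])
        show "(\<lambda>k. h (k + k0)) \<longlonglongrightarrow> g" by (rule LIMSEQ_ignore_initial_segment[OF hg(1)])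
        show "filterlim (\<lambda>k. N (k + k0)) at_top sequentially"
          by (rule filterlim_compose[OF N filterlim_add_const_nat_at_top])
      qed (use k0 hg a in auto)
      then show ?thesis by (rule LIMSEQ_offset)
    qed
    have "(\<lambda>M. kappa_upto M (g / 2)) \<longlonglongrightarrow> kappa \<beta> (g / 2)"
      using hg gH h by (intro kappa_upto_tendsto_kappa) auto
    then show "(\<lambda>M. (kappa_upto M (g / 2))\<^sup>2 / (2 * pi * sqrt (theta \<beta> g))) \<longlonglongrightarrow> (kappa \<beta> (g / 2))\<^sup>2 / (2 * pi * sqrt (theta \<beta> g))"
      unfolding divide_inverse by (intro tendsto_intros)
    have hev: "\<forall>\<^sub>F k in sequentially. \<eta> < h k"
      using order_tendstoD(1)[OF hg(1), of \<eta>] hg(2) by (simp add: \<eta>_def)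
    show "\<forall>\<^sub>F k in sequentially. \<bar>(real (N k))\<^sup>2 * edge_prob M (h k) (N k) (a k) - (real (N k))\<^sup>2 * excursion_prob (h k) (N k) (a k)\<bar>
       \<le> C * exp (- decay_rate \<eta>) ^ M" for M
      using hev Nev[of M]
    proof eventually_elim
      case (elim k)
      have N0: "0 < (real (N k))\<^sup>2" using elim by simp
      have "h k < \<beta>" using h(2)[of k] h(3) by simp
      then have "\<bar>edge_prob M (h k) (N k) (a k) - excursion_prob (h k) (N k) (a k)\<bar> \<le> C * exp (- decay_rate \<eta>) ^ M / (real (N k))\<^sup>2"
        using elim by (intro C) auto
      then have "(real (N k))\<^sup>2 * \<bar>edge_prob M (h k) (N k) (a k) - excursion_prob (h k) (N k) (a k)\<bar> \<le> C * exp (- decay_rate \<eta>) ^ M"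
        using N0 by (simp add: field_simps)
      moreover have "(real (N k))\<^sup>2 * \<bar>edge_prob M (h k) (N k) (a k) - excursion_prob (h k) (N k) (a k)\<bar>
         = \<bar>(real (N k))\<^sup>2 * edge_prob M (h k) (N k) (a k) - (real (N k))\<^sup>2 * excursion_prob (h k) (N k) (a k)\<bar>"
        unfolding right_diff_distrib[symmetric] abs_mult using N0 by simp
      ultimately show ?case by simp
    qed
    have "(\<lambda>M. C * exp (- decay_rate \<eta>) ^ M) \<longlonglongrightarrow> C * 0"
      using decay_rate_pos[OF \<eta>] by (intro tendsto_mult tendsto_const LIMSEQ_power_zero) auto
    then show "(\<lambda>M. C * exp (- decay_rate \<eta>) ^ M) \<longlonglongrightarrow> 0" by simp
  qed
qed

lemma C_const_pos:
  assumes "0 < q"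
  shows "0 < C_const \<beta> q"
proof -
  have "0 < kappa \<beta> (h_tilde \<beta> q / 2)" using h_tilde_props[OF assms] by (intro kappa_pos) auto
  moreover have "0 < theta \<beta> (h_tilde \<beta> q)" using h_tilde_props[OF assms] by (intro theta_pos) auto
  ultimately show ?thesis by (simp add: C_const_def)
qed

definition asymptotic_value :: "real \<Rightarrow> nat \<Rightarrow> real" where
  "asymptotic_value q N = C_const \<beta> q / (real N)\<^sup>2 * exp (- real N * psi_tilde \<beta> q)"

text \<open>
  The exponential factors cancel up to the error of the midpoint rule.
\<close>

lemma excursion_ratio_eq:
  assumes q: "0 < q" and N: "0 < N" and k: "q * (real N)\<^sup>2 = real k"
  shows "measure (walk_law (P_step \<beta>)) (excursions N k) / asymptotic_value q N
    = exp ((\<Sum>i<N. log_mgf \<beta> (tilt (h_tilde \<beta> q) N i)) - real N * G_fun \<beta> (h_tilde \<beta> q))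
      * ((real N)\<^sup>2 * excursion_prob (h_tilde \<beta> q) N k) / C_const \<beta> q"
proof -
  define h where "h = h_tilde \<beta> q"
  define s where "s = (\<Sum>i<N. log_mgf \<beta> (tilt h N i))"
  have h: "\<bar>h\<bar> < \<beta>" using h_tilde_props[OF q] by (simp add: h_def)
  have "h * real k / real N = h * q * real N" using N k[symmetric] by (simp add: power2_eq_square)
  then have m: "measure (walk_law (P_step \<beta>)) (excursions N k) = exp (s - h * q * real N) * excursion_prob h N k"
    unfolding prob_excursions_eq[OF h N] excursion_prob_def s_def by simp
  have "exp (s - h * q * real N) = exp (s - real N * G_fun \<beta> h) * exp (- real N * psi_tilde \<beta> q)"
    unfolding exp_add[symmetric] psi_tilde_def h_def by (simp add: algebra_simps)
  then show ?thesis
    unfolding m asymptotic_value_def h_def[symmetric] s_def[symmetric] using N C_const_pos[OF q] by (simp add: field_simps)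
qed

lemma excursion_ratio_limit:
  fixes N a :: "nat \<Rightarrow> nat" and q :: "nat \<Rightarrow> real"
  assumes q: "\<And>k. q1 \<le> q k" "\<And>k. q k \<le> q2" "0 < q1" and lim: "(\<lambda>k. h_tilde \<beta> (q k)) \<longlonglongrightarrow> g"
    and N: "filterlim N at_top sequentially" and a: "\<And>k. q k * (real (N k))\<^sup>2 = real (a k)"
  shows "(\<lambda>k. measure (walk_law (P_step \<beta>)) (excursions (N k) (a k)) / asymptotic_value (q k) (N k)) \<longlonglongrightarrow> 1"
proof -
  define h where "h k = h_tilde \<beta> (q k)" for k
  define H where "H = h_tilde \<beta> q2"
  have q0: "0 < q k" for k using q(1)[of k] q(3) by simp
  have q2: "0 < q2" using q(2)[of 0] q0[of 0] by simp
  have H: "0 < H" "H < \<beta>" using h_tilde_props[OF q2] by (auto simp: H_def)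
  have hprop: "0 < h k" "h k < \<beta>" "G_prime (h k) = q k" "h k \<le> H" for k
    using h_tilde_props[OF q0[of k]] h_tilde_mono[OF q0 q(2)] by (auto simp: h_def H_def)
  have hlim: "h \<longlonglongrightarrow> g" using lim by (simp add: h_def[abs_def])
  have glow: "h_tilde \<beta> q1 \<le> g"
    by (rule LIMSEQ_le_const[OF hlim]) (use h_tilde_mono[OF q(3) q(1)] in \<open>auto simp: h_def\<close>)
  have g: "0 < g" using glow h_tilde_props(1)[OF q(3)] by simp
  have gH: "g \<le> H" by (rule LIMSEQ_le_const2[OF hlim]) (use hprop in auto)
  have g2: "g < \<beta>" using gH H by simp
  define L where "L = (kappa \<beta> (g / 2))\<^sup>2 / (2 * pi * sqrt (theta \<beta> g))"
  have th: "0 < theta \<beta> g" using g g2 by (intro theta_pos) auto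
  have L: "0 < L"
    unfolding L_def using kappa_pos[of "g / 2"] g g2 th by auto
  have exc: "(\<lambda>k. (real (N k))\<^sup>2 * excursion_prob (h k) (N k) (a k)) \<longlonglongrightarrow> L"
    unfolding L_def
    by (rule excursion_prob_limit[OF hprop(1) hprop(4) H(2) hlim g N]) (use a hprop in \<open>simp add: mult.commute\<close>)
  have Cl: "(\<lambda>k. C_const \<beta> (q k)) \<longlonglongrightarrow> L"
  proof -
    have "(\<lambda>k. kappa \<beta> (h k / 2)) \<longlonglongrightarrow> kappa \<beta> (g / 2)"
      using g g2 by (intro kappa_tendsto tendsto_intros hlim) auto
    moreover have "(\<lambda>k. theta \<beta> (h k)) \<longlonglongrightarrow> theta \<beta> g"
    proof -
      have "isCont (theta \<beta>) g"
        using theta_continuous g g2 by (simp add: continuous_on_eq_continuous_at)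
      then show ?thesis by (rule isCont_tendsto_compose[OF _ hlim])
    qed
    ultimately have "(\<lambda>k. 1 / (2 * pi * sqrt (theta \<beta> (h k))) * (kappa \<beta> (h k / 2))\<^sup>2) \<longlonglongrightarrow> 1 / (2 * pi * sqrt (theta \<beta> g)) * (kappa \<beta> (g / 2))\<^sup>2"
      using th by (intro tendsto_intros) auto
    then show ?thesis by (simp add: C_const_def h_def L_def)
  qed
  have Nev: "\<forall>\<^sub>F k in sequentially. 0 < N k"
  proof -
    have "\<forall>\<^sub>F k in sequentially. 1 \<le> N k" using N by (simp add: filterlim_at_top)
    then show ?thesis by eventually_elim simp
  qed
  define s where "s k = (\<Sum>i<N k. log_mgf \<beta> (tilt (h k) (N k) i)) - real (N k) * G_fun \<beta> (h k)" for k
  have s0: "s \<longlonglongrightarrow> 0"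
  proof (rule Lim_null_comparison)
    have rN: "filterlim (\<lambda>k. real (N k)) at_top sequentially" by (rule filterlim_compose[OF filterlim_real_sequentially N])
    show "(\<lambda>k. \<beta>\<^sup>2 * cgf_bound (H / 2) / real (N k)) \<longlonglongrightarrow> 0"
      by (rule tendsto_divide_0[OF tendsto_const]) (use filterlim_at_top_imp_at_infinity[OF rN] in simp)
    show "\<forall>\<^sub>F k in sequentially. norm (s k) \<le> \<beta>\<^sup>2 * cgf_bound (H / 2) / real (N k)"
      using Nev
    proof eventually_elim
      case (elim k)
      define m where "m = (\<Sum>i<N k. log_mgf \<beta> (tilt (h k) (N k) i))"
      have "\<bar>G_fun \<beta> (h k) - m / real (N k)\<bar> \<le> \<beta>\<^sup>2 * cgf_bound (H / 2) / (real (N k))\<^sup>2"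
        unfolding m_def tilt_def using hprop(1,4)[of k] H elim by (intro G_fun_midpoint) auto
      then have "real (N k) * \<bar>G_fun \<beta> (h k) - m / real (N k)\<bar> \<le> real (N k) * (\<beta>\<^sup>2 * cgf_bound (H / 2) / (real (N k))\<^sup>2)"
        by (intro mult_left_mono) auto
      also have "\<dots> = \<beta>\<^sup>2 * cgf_bound (H / 2) / real (N k)" using elim by (simp add: power2_eq_square)
      also have "real (N k) * \<bar>G_fun \<beta> (h k) - m / real (N k)\<bar> = \<bar>real (N k) * (G_fun \<beta> (h k) - m / real (N k))\<bar>"
        by (simp add: abs_mult)
      also have "real (N k) * (G_fun \<beta> (h k) - m / real (N k)) = - s k"
        using elim by (simp add: s_def m_def right_diff_distrib)
      finally show ?case by simp
    qed
  qed
  have "(\<lambda>k. exp (s k) * ((real (N k))\<^sup>2 * excursion_prob (h k) (N k) (a k)) / C_const \<beta> (q k)) \<longlonglongrightarrow> exp 0 * L / L"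
    using L by (intro tendsto_intros s0 exc Cl) auto
  then have *: "(\<lambda>k. exp (s k) * ((real (N k))\<^sup>2 * excursion_prob (h k) (N k) (a k)) / C_const \<beta> (q k)) \<longlonglongrightarrow> 1"
    using L by simp
  show ?thesis
  proof (rule Lim_transform_eventually[OF *])
    show "\<forall>\<^sub>F k in sequentially. exp (s k) * ((real (N k))\<^sup>2 * excursion_prob (h k) (N k) (a k)) / C_const \<beta> (q k)
       = measure (walk_law (P_step \<beta>)) (excursions (N k) (a k)) / asymptotic_value (q k) (N k)"
      using Nev
    proof eventually_elim
      case (elim k)
      show ?case unfolding excursion_ratio_eq[OF q0 elim a] by (simp add: s_def h_def)
    qed
  qed
qed

text \<open>
  A failure of uniformity would provide \<open>N \<rightarrow> \<infinity>\<close> and \<open>q\<close> in the interval with a ratio bounded away from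
  \<open>1\<close>.  The corresponding values of \<open>h_tilde\<close> stay in a compact interval, so along a subsequence they
  converge, contradicting the sequential limit.
\<close>

lemma excursion_ratio_uniform:
  assumes q: "0 < q1" "q1 \<le> q2" and \<delta>: "0 < \<delta>"
  shows "\<exists>N\<^sub>0. \<forall>N\<ge>N\<^sub>0. \<forall>q\<in>{q1..q2}. \<forall>k. q * (real N)\<^sup>2 = real k \<longrightarrow>
    \<bar>measure (walk_law (P_step \<beta>)) (excursions N k) / asymptotic_value q N - 1\<bar> < \<delta>"
proof (rule ccontr)
  define R where "R N q k = measure (walk_law (P_step \<beta>)) (excursions N k) / asymptotic_value q N" for N q k
  assume neg: "\<not> ?thesis"
  have "\<forall>n. \<exists>p. n \<le> fst p \<and> fst (snd p) \<in> {q1..q2} \<and> fst (snd p) * (real (fst p))\<^sup>2 = real (snd (snd p))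
      \<and> \<delta> \<le> \<bar>R (fst p) (fst (snd p)) (snd (snd p)) - 1\<bar>"
  proof
    fix n
    obtain N q k where "n \<le> N" "q \<in> {q1..q2}" "q * (real N)\<^sup>2 = real k" "\<delta> \<le> \<bar>R N q k - 1\<bar>"
      using neg unfolding R_def not_ex not_all not_less by (metis not_less)
    then show "\<exists>p. n \<le> fst p \<and> fst (snd p) \<in> {q1..q2} \<and> fst (snd p) * (real (fst p))\<^sup>2 = real (snd (snd p))
      \<and> \<delta> \<le> \<bar>R (fst p) (fst (snd p)) (snd (snd p)) - 1\<bar>"
      by (intro exI[of _ "(N, q, k)"]) simp
  qed
  from choice[OF this] obtain p where p: "\<And>n. n \<le> fst (p n)" "\<And>n. fst (snd (p n)) \<in> {q1..q2}"
    "\<And>n. fst (snd (p n)) * (real (fst (p n)))\<^sup>2 = real (snd (snd (p n)))"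
    "\<And>n. \<delta> \<le> \<bar>R (fst (p n)) (fst (snd (p n))) (snd (snd (p n))) - 1\<bar>"
    by blast
  have hin: "h_tilde \<beta> (fst (snd (p n))) \<in> {h_tilde \<beta> q1..h_tilde \<beta> q2}" for n
    using p(2)[of n] q by (auto intro!: h_tilde_mono)
  obtain g s where s: "strict_mono (s :: nat \<Rightarrow> nat)" "((\<lambda>n. h_tilde \<beta> (fst (snd (p n)))) \<circ> s) \<longlonglongrightarrow> g"
    using hin compact_imp_seq_compact[OF compact_Icc, of "h_tilde \<beta> q1" "h_tilde \<beta> q2"] unfolding seq_compact_def by metis
  have "filterlim (\<lambda>n. fst (p (s n))) at_top sequentially"
  proof (rule filterlim_at_top_mono[OF filterlim_subseq[OF s(1)]])
    show "\<forall>\<^sub>F n in sequentially. s n \<le> fst (p (s n))" using p(1) by simp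
  qed
  then have "(\<lambda>n. R (fst (p (s n))) (fst (snd (p (s n)))) (snd (snd (p (s n))))) \<longlonglongrightarrow> 1"
    unfolding R_def using p(2,3) s(2) q(1)
    by (intro excursion_ratio_limit[where g = g and ?q1.0 = q1 and ?q2.0 = q2]) (auto simp: o_def)
  then have "\<forall>\<^sub>F n in sequentially. dist (R (fst (p (s n))) (fst (snd (p (s n)))) (snd (snd (p (s n))))) 1 < \<delta>"
    using \<delta> by (rule tendstoD)
  then obtain n where "dist (R (fst (p (s n))) (fst (snd (p (s n)))) (snd (snd (p (s n))))) 1 < \<delta>"
    by (rule eventually_happens'[rotated, THEN exE]) auto
  then show False using p(4)[of "s n"] by (simp add: dist_real_def)
qed

end

theorem proposition4p5:
  fixes \<beta> q\<^sub>1 q\<^sub>2 :: real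
  assumes "\<beta> > 0" and "q\<^sub>1 \<le> q\<^sub>2" and "{q\<^sub>1..q\<^sub>2} \<subseteq> {0<..}"
  shows "\<exists>r :: nat \<Rightarrow> real \<Rightarrow> real.
    (\<forall>\<delta>>0. \<exists>N\<^sub>0. \<forall>N\<ge>N\<^sub>0. \<forall>q\<in>{q\<^sub>1..q\<^sub>2}. q * (real N)\<^sup>2 \<in> \<nat> \<longrightarrow> \<bar>r N q\<bar> < \<delta>) \<and>
    (\<forall>N\<ge>1. \<forall>q\<in>{q\<^sub>1..q\<^sub>2}. \<forall>k :: nat. q * (real N)\<^sup>2 = real k \<longrightarrow>
       measure (walk_law (P_step \<beta>)) (excursions N k)
         = C_const \<beta> q / (real N)\<^sup>2 * exp (- real N * psi_tilde \<beta> q) * (1 + r N q))"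
proof -
  interpret laplace_walk \<beta> by unfold_locales (rule assms(1))
  have q: "0 < q\<^sub>1" using assms(2,3) by auto
  \<comment> \<open>\<open>q N\<^sup>2\<close> is an integer whenever the value of \<open>r\<close> matters, so that the rounding is harmless\<close>
  define r where "r N q = measure (walk_law (P_step \<beta>)) (excursions N (nat \<lfloor>q * (real N)\<^sup>2\<rfloor>)) / asymptotic_value q N - 1" for N q
  have r: "r N q = measure (walk_law (P_step \<beta>)) (excursions N k) / asymptotic_value q N - 1"
    if "q * (real N)\<^sup>2 = real k" for N q k
    unfolding r_def that by simp
  show ?thesis
  proof (intro exI[of _ r] conjI allI impI ballI)
    fix \<delta> :: real assume "0 < \<delta>"
    from excursion_ratio_uniform[OF q assms(2) this] obtain N0 where
      N0: "\<And>N q k. N0 \<le> N \<Longrightarrow> q \<in> {q\<^sub>1..q\<^sub>2} \<Longrightarrow> q * (real N)\<^sup>2 = real k \<Longrightarrow>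
        \<bar>measure (walk_law (P_step \<beta>)) (excursions N k) / asymptotic_value q N - 1\<bar> < \<delta>" by blast
    show "\<exists>N\<^sub>0. \<forall>N\<ge>N\<^sub>0. \<forall>q\<in>{q\<^sub>1..q\<^sub>2}. q * (real N)\<^sup>2 \<in> \<nat> \<longrightarrow> \<bar>r N q\<bar> < \<delta>"
    proof (intro exI[of _ N0] allI impI ballI)
      fix N q assume "N0 \<le> N" "q \<in> {q\<^sub>1..q\<^sub>2}" "q * (real N)\<^sup>2 \<in> \<nat>"
      moreover from this(3) obtain k where "q * (real N)\<^sup>2 = real k" by (auto simp: Nats_def)
      ultimately show "\<bar>r N q\<bar> < \<delta>" using N0 r by metis
    qed
  next
    fix N q k assume N: "1 \<le> N" and qq: "q \<in> {q\<^sub>1..q\<^sub>2}" and k: "q * (real N)\<^sup>2 = real k"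
    have "0 < q" using qq q by simp
    then have "0 < asymptotic_value q N" unfolding asymptotic_value_def using C_const_pos N by simp
    then show "measure (walk_law (P_step \<beta>)) (excursions N k)
         = C_const \<beta> q / (real N)\<^sup>2 * exp (- real N * psi_tilde \<beta> q) * (1 + r N q)"
      unfolding r[OF k] asymptotic_value_def[symmetric] by simp
  qed
qed

end
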